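(* Let $l\ge 8$ be even. A tree $T$ is an exact $5$-leaf root of the cycle $C_l$ if and only if, after possibly reversing the spine, $$T\cong T(W)$$ for some word $W\in\mathcal N\cup\mathcal X$ with $\lambda(W)=l$.
   Context: Graphs are finite, simple, undirected. $C_l$ is the chordless cycle on $l$ vertices. A tree $T$ is an exact $5$-leaf root of a graph $G$ if the leaf set of $T$ is (identified with) $V(G)$ and, for distinct leaves $u,v$, $uv\in E(G)$ if and only if $\operatorname{dist}_T(u,v)=5$. So $T$ is an exact $5$-leaf root of $C_l$ means that the graph on the leaves of $T$, joining two leaves exactly when their distance is $5$, is a cycle on $l$ vertices. Spine words. For a finite sequence (word) $W=A_0|A_1|\cdots|A_m$ with $A_i\subseteq\{1,2,3\}$, the tree $T(W)$ is obtained from a path (the spine) $x_0x_1\cdots x_m$ by attaching, for every $i$ and every $r\in A_i$, a pendant path of length $r$ at $x_i$ (these paths being disjoint except at $x_i$); its free end is the leaf $z_{i,r}$. Put $\lambda(W)=\sum_{i=0}^m|A_i|$. Reversing the spine means replacing $W$ by $A_m|\cdots|A_0$. Symbols: $0=\varnothing$, $1=\{1\}$, $12=\{1,2\}$, $13=\{1,3\}$, $23=\{2,3\}$, $123=\{1,2,3\}$. Juxtaposition of words or sets of words (languages) denotes concatenation (the symbol sequences are concatenated, with $|$ inserted between them), and $\mathcal B^{*}$ is the set of all concatenations of zero or more words of $\mathcal B$. Blocks: $B_2=1|1|0$; $B_3=12|0$; $B_4=1|1|1|1|12|1|1|1|1|0$; $B_5=1|13|1|0$; $B_6=1|1|1|13|1|1|1|0$;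 $\mathcal B=\{B_2,B_3,B_4,B_5,B_6\}$. $L_1=123|13|1|1|1|0$; $L_2=123|1|12|1|1|1|1|0$; $\mathcal L=\{L_1,L_2\}$. $R_1=1|1|1|13|123$; $R_2=1|1|1|1|12|1|123$; $\mathcal R=\{R_1,R_2\}$. $D_1=123|13|123$; $D_2=123|1|12|1|123$; $\mathcal D=\{D_1,D_2\}$. If a word $U$ ends in the symbol $0$, $\widehat U$ is the word obtained by replacing that final $0$ by $23$; for a set $\mathcal U$ of such words $\widehat{\mathcal U}=\{\widehat U:U\in\mathcal U\}$. The languages are $$\mathcal N=23\,\mathcal B^{*}\,\widehat{\mathcal B},$$ $$\mathcal X=\widehat{\mathcal L}\ \cup\ \mathcal L\,\mathcal B^{*}\,\widehat{\mathcal B}\ \cup\ 23\,\mathcal B^{*}\,\mathcal R\ \cup\ \mathcal D\ \cup\ \mathcal L\,\mathcal B^{*}\,\mathcal R.$$ *)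

theory Defs
  imports "Graph_Theory.Graph_Theory"
begin

section \<open>Trees, leaves and exact leaf roots\<close>

text \<open>
  Finite simple undirected graphs are the \<open>pair_graph\<close>s of \<open>Graph_Theory\<close>: every undirected edge
  is a pair of opposite arcs.  The library predicate \<open>tree\<close> cannot be used for them, because
  \<open>forest\<close> counts a pair of opposite arcs as a directed cycle (of length 2).  A cycle of such
  a graph in the usual undirected sense is a library cycle with at least three arcs.
\<close>

definition undirected_tree :: "'a pair_pre_digraph \<Rightarrow> bool" where
  "undirected_tree T \<longleftrightarrow>
     pair_graph T \<and> connected T \<and> \<not> (\<exists>p. pre_digraph.cycle T p \<and> 3 \<le> length p)"

text \<open>As arcs come in opposite pairs, the out-degree is the undirected degree.\<close>

definition leaves :: "'a pair_pre_digraph \<Rightarrow> 'a set" where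
  "leaves T = {v \<in> pverts T. out_degree T v = 1}"

definition graph_dist :: "'a pair_pre_digraph \<Rightarrow> 'a \<Rightarrow> 'a \<Rightarrow> ereal" where
  "graph_dist G u v = wf_digraph.\<mu> G (\<lambda>_. 1) u v"

text \<open>The bijection \<open>\<phi>\<close> is the identification of the vertices of \<open>G\<close> with the leaves of \<open>T\<close>.\<close>

definition exact_leaf_root :: "nat \<Rightarrow> 'a pair_pre_digraph \<Rightarrow> 'b pair_pre_digraph \<Rightarrow> bool" where
  "exact_leaf_root k T G \<longleftrightarrow> undirected_tree T \<and>
     (\<exists>\<phi>. bij_betw \<phi> (pverts G) (leaves T) \<and>
       (\<forall>u \<in> pverts G. \<forall>v \<in> pverts G. u \<noteq> v \<longrightarrow>
         ((u, v) \<in> parcs G \<longleftrightarrow> graph_dist T (\<phi> u) (\<phi> v) = ereal (real k))))"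

text \<open>\<open>C\<^sub>l\<close>, meaningful for \<open>l \<ge> 3\<close>.\<close>

definition cycle_graph :: "nat \<Rightarrow> nat pair_pre_digraph" where
  "cycle_graph l = \<lparr> pverts = {..<l},
     parcs = {(i, j). i < l \<and> j < l \<and> (j = (i + 1) mod l \<or> i = (j + 1) mod l)} \<rparr>"


section \<open>Spine words and their trees\<close>

type_synonym spine_word = "nat set list"

text \<open>
  \<open>Spine i\<close> is \<open>x\<^sub>i\<close>; \<open>Pendant i r j\<close>, for \<open>1 \<le> j \<le> r\<close>, is the vertex at distance \<open>j\<close> from \<open>x\<^sub>i\<close>
  on the pendant path of length \<open>r\<close> attached at \<open>x\<^sub>i\<close>.  The leaf \<open>z\<^sub>i\<^sub>,\<^sub>r\<close> is \<open>Pendant i r r\<close>.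
\<close>

datatype spine_vertex = Spine nat | Pendant nat nat nat

definition spine_tree_edges :: "spine_word \<Rightarrow> spine_vertex rel" where
  "spine_tree_edges W =
     {(Spine i, Spine (i + 1)) | i. i + 1 < length W}
     \<union> {(Spine i, Pendant i r 1) | i r. i < length W \<and> r \<in> W ! i}
     \<union> {(Pendant i r j, Pendant i r (j + 1)) | i r j.
          i < length W \<and> r \<in> W ! i \<and> 1 \<le> j \<and> j < r}"

definition spine_tree :: "spine_word \<Rightarrow> spine_vertex pair_pre_digraph" where
  "spine_tree W = \<lparr>
     pverts = {Spine i | i. i < length W}
       \<union> {Pendant i r j | i r j. i < length W \<and> r \<in> W ! i \<and> 1 \<le> j \<and> j \<le> r},
     parcs = spine_tree_edges W \<union> (spine_tree_edges W)\<inverse> \<rparr>"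

definition spine_size :: "spine_word \<Rightarrow> nat" where
  "spine_size W = (\<Sum>i<length W. card (W ! i))"


section \<open>The languages\<close>

abbreviation S0 :: "nat set" where "S0 \<equiv> {}"
abbreviation S1 :: "nat set" where "S1 \<equiv> {1}"
abbreviation S12 :: "nat set" where "S12 \<equiv> {1, 2}"
abbreviation S13 :: "nat set" where "S13 \<equiv> {1, 3}"
abbreviation S23 :: "nat set" where "S23 \<equiv> {2, 3}"
abbreviation S123 :: "nat set" where "S123 \<equiv> {1, 2, 3}"

definition lang_conc :: "'a list set \<Rightarrow> 'a list set \<Rightarrow> 'a list set" (infixr \<open>\<odot>\<close> 75) where
  "K \<odot> L = {u @ v | u v. u \<in> K \<and> v \<in> L}"

definition lang_star :: "'a list set \<Rightarrow> 'a list set" where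
  "lang_star K = {concat ws | ws. set ws \<subseteq> K}"

text \<open>Only applied to words ending in \<open>S0\<close>.\<close>

definition hat :: "spine_word \<Rightarrow> spine_word" where
  "hat U = butlast U @ [S23]"

definition blocks_B :: "spine_word set" where
  "blocks_B =
    {[S1, S1, S0],
     [S12, S0],
     [S1, S1, S1, S1, S12, S1, S1, S1, S1, S0],
     [S1, S13, S1, S0],
     [S1, S1, S1, S13, S1, S1, S1, S0]}"

definition blocks_L :: "spine_word set" where
  "blocks_L =
    {[S123, S13, S1, S1, S1, S0],
     [S123, S1, S12, S1, S1, S1, S1, S0]}"

definition blocks_R :: "spine_word set" where
  "blocks_R =
    {[S1, S1, S1, S13, S123],
     [S1, S1, S1, S1, S12, S1, S123]}"

definition blocks_D :: "spine_word set" where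
  "blocks_D =
    {[S123, S13, S123],
     [S123, S1, S12, S1, S123]}"

definition lang_N :: "spine_word set" where
  "lang_N = {[S23]} \<odot> lang_star blocks_B \<odot> hat ` blocks_B"

definition lang_X :: "spine_word set" where
  "lang_X = hat ` blocks_L
     \<union> blocks_L \<odot> lang_star blocks_B \<odot> hat ` blocks_B
     \<union> {[S23]} \<odot> lang_star blocks_B \<odot> blocks_R
     \<union> blocks_D
     \<union> blocks_L \<odot> lang_star blocks_B \<odot> blocks_R"

end

theory Submission
  imports Defs
begin

text \<open>
  The proof answers two separate questions: which trees have a long cycle as their leaf graph (leaves
  at distance 5 being joined), and for which words the leaf graph of a spine tree is a cycle.

  \<^bold>\<open>Trees.\<close> Fix a vertex \<open>x\<close>. Two leaves in different branches at \<open>x\<close> are joined if and only if their depths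
  add up to 5, so edges between branches join depths 1 and 4 or depths 2 and 3. Leaves attached to the
  same vertex would be twins and lie on a 4-cycle; hence there is at most one leaf of depth 1, and each
  branch has at most one of depth 2. These few leaves cannot connect three branches with at least
  two leaves each into one long cycle (\<open>not_three_nontrivial\<close>): there is always a vertex with
  three neighbours, a cycle of length 4 or 6, or a proper set of leaves that is left by fewer than two
  edges. A branch with one leaf is a pendant path, of length at most 3 and of a different length for
  each such branch at \<open>x\<close> (\<open>lone_length\<close>, \<open>lone_distinct\<close>). So the vertices outside the pendant
  paths form a path, and the tree is a spine tree (\<open>embeds_spine_tree\<close>).

  \<^bold>\<open>Words.\<close> In the tree of a word, \<open>z\<^sub>i\<^sub>,\<^sub>r\<close> and \<open>z\<^sub>j\<^sub>,\<^sub>s\<close> are joined if and only if \<open>r + s + \<bar>i - j\<bar> = 5\<close>. Call a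
  prefix two-ended if its leaves form a path and only the ends of this path are near enough to the rest
  of the word to have neighbours there, at the same two distances as the leaves of the word \<open>23\<close>. The
  rest of the word cannot tell two-ended prefixes apart (\<open>cyclic_word_append\<close>), and a two-ended prefix
  stays two-ended when a block is appended (\<open>two_ended_append\<close>). So the blocks between the two ends
  of a word can be inserted and removed one at a time, and only finitely many words remain to be
  checked. Conversely, a word that starts with \<open>23\<close> or \<open>123\<close> is explored from the left. Two things
  keep this exploration finite: the degrees of the first leaves determine what comes next, and
  once a path of leaves reaches a position where it can be closed, it is either continued past it or the
  word ends right there (\<open>path_closes\<close>). The outcome is that the word is one of the short words with
  no inner block, or begins with a two-ended prefix from the list (\<open>admissible_S23\<close>, \<open>admissible_S123\<close>),
  which is then replaced by \<open>23\<close>.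

  The exploration applies to the word of a tree read in either direction, so the reversed word
  matters only for the direction from words to trees.
\<close>

section \<open>Cycles as connected 2-regular graphs\<close>

definition nbrs :: "'v set \<Rightarrow> ('v \<Rightarrow> 'v \<Rightarrow> bool) \<Rightarrow> 'v \<Rightarrow> 'v set" where
  "nbrs L R u = {v \<in> L. R u v}"

definition closed_in :: "'v set \<Rightarrow> ('v \<Rightarrow> 'v \<Rightarrow> bool) \<Rightarrow> 'v set \<Rightarrow> bool" where
  "closed_in L R S \<longleftrightarrow> S \<subseteq> L \<and> (\<forall>u\<in>S. nbrs L R u \<subseteq> S)"

definition connected_on :: "'v set \<Rightarrow> ('v \<Rightarrow> 'v \<Rightarrow> bool) \<Rightarrow> bool" where
  "connected_on L R \<longleftrightarrow> (\<forall>S. closed_in L R S \<longrightarrow> S = {} \<or> S = L)"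

definition cyclic_on :: "'v set \<Rightarrow> ('v \<Rightarrow> 'v \<Rightarrow> bool) \<Rightarrow> bool" where
  "cyclic_on L R \<longleftrightarrow> connected_on L R \<and> (\<forall>u\<in>L. card (nbrs L R u) = 2)"

lemma card_2_subset: "card N = 2 \<Longrightarrow> v \<in> N \<Longrightarrow> w \<in> N \<Longrightarrow> v \<noteq> w \<Longrightarrow> N = {v, w}"
  by (auto simp: card_2_iff)

lemma connected_onD:
  assumes "connected_on L R" "S \<subseteq> L" "S \<noteq> {}" "\<And>u v. u \<in> S \<Longrightarrow> v \<in> L \<Longrightarrow> R u v \<Longrightarrow> v \<in> S"
  shows "S = L"
  using assms unfolding connected_on_def closed_in_def nbrs_def by blast

text \<open>Two neighbours inside the set are all neighbours, so such a set is closed.\<close>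

lemma cyclic_on_ring:
  assumes "cyclic_on L R" "S \<subseteq> L" "S \<noteq> {}"
    and two: "\<And>u. u \<in> S \<Longrightarrow> \<exists>v\<in>S. \<exists>w\<in>S. v \<noteq> w \<and> R u v \<and> R u w"
  shows "S = L"
proof (rule connected_onD)
  fix u v assume u: "u \<in> S" and v: "v \<in> L" "R u v"
  obtain a b where ab: "a \<in> S" "b \<in> S" "a \<noteq> b" "R u a" "R u b" using two[OF u] by blast
  have "nbrs L R u = {a, b}"
    using assms(1,2) u ab by (intro card_2_subset) (auto simp: cyclic_on_def nbrs_def)
  then show "v \<in> S" using v ab by (auto simp: nbrs_def)
qed (use assms in \<open>auto simp: cyclic_on_def\<close>)

text \<open>
  The cut condition says that no single edge separates a cycle. It follows from 2-regularity and
  connectedness by counting, and directly from a cyclic numbering of the vertices. The bound 7 rules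
  out 4-cycles and 6-cycles, which are the short cycles that come up in trees.
\<close>

locale long_cycle =
  fixes L :: "'v set" and R :: "'v \<Rightarrow> 'v \<Rightarrow> bool"
  assumes sym: "R u v \<Longrightarrow> R v u" and irrefl: "\<not> R u u"
    and cyclic: "cyclic_on L R"
    and cut: "S \<subseteq> L \<Longrightarrow> S \<noteq> {} \<Longrightarrow> S \<noteq> L \<Longrightarrow>
      \<exists>s\<in>S. \<exists>s'\<in>S. \<exists>w\<in>L - S. \<exists>w'\<in>L - S. R s w \<and> R s' w' \<and> (s, w) \<noteq> (s', w')"
    and card: "7 \<le> card L"
begin

lemma connected: "connected_on L R"
  using cyclic by (simp add: cyclic_on_def)

lemma no_three_nbrs:
  assumes "u \<in> L" "a \<in> L" "b \<in> L" "c \<in> L" "R u a" "R u b" "R u c"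
  shows "a = b \<or> a = c \<or> b = c"
proof (rule ccontr)
  assume n: "\<not> ?thesis"
  have "card (nbrs L R u) = 2" using cyclic assms(1) by (simp add: cyclic_on_def)
  then have "nbrs L R u = {a, b}" using assms n by (intro card_2_subset) (auto simp: nbrs_def)
  then show False using assms n by (auto simp: nbrs_def)
qed

lemma two_nbrs:
  assumes "u \<in> L" obtains a b where "a \<in> L" "b \<in> L" "a \<noteq> b" "R u a" "R u b"
proof -
  have "card (nbrs L R u) = 2" using cyclic assms(1) by (simp add: cyclic_on_def)
  then obtain a b where "nbrs L R u = {a, b}" "a \<noteq> b" by (auto simp: card_2_iff)
  then have "a \<in> nbrs L R u" "b \<in> nbrs L R u" by simp_all
  then show ?thesis using that \<open>a \<noteq> b\<close> by (auto simp: nbrs_def)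
qed

lemma no_small_ring:
  assumes "S \<subseteq> L" "S \<noteq> {}" "finite S" "card S < 7"
    and "\<And>u. u \<in> S \<Longrightarrow> \<exists>v\<in>S. \<exists>w\<in>S. v \<noteq> w \<and> R u v \<and> R u w"
  shows False
  using cyclic_on_ring[OF cyclic assms(1,2,5)] assms(4) card by simp

lemma no_four_cycle:
  assumes "{u, u', w, w'} \<subseteq> L" "u \<noteq> u'" "w \<noteq> w'" "R u w" "R u w'" "R u' w" "R u' w'"
  shows False
proof (rule no_small_ring[of "{u, u', w, w'}"])
  have "card {u, u', w, w'} \<le> 4" by (simp add: card_insert_if)
  then show "card {u, u', w, w'} < 7" by simp
  show "\<exists>v\<in>{u, u', w, w'}. \<exists>w'\<in>{u, u', w, w'}. v \<noteq> w' \<and> R x v \<and> R x w'" if "x \<in> {u, u', w, w'}" for x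
    using that assms(2-) sym[OF assms(4)] sym[OF assms(5)] sym[OF assms(6)] sym[OF assms(7)] by auto
qed (use assms in auto)

text \<open>
  A cycle stays connected when one vertex is removed: if all edges leaving \<open>S\<close> started at one vertex,
  both neighbours of that vertex would be outside and the rest of \<open>S\<close> would be closed.
\<close>

lemma two_exits:
  assumes S: "S \<subseteq> L" "S \<noteq> L" and ab: "a \<in> S" "b \<in> S" "a \<noteq> b"
  obtains s s' w w' where "s \<in> S" "s' \<in> S" "s \<noteq> s'" "w \<in> L - S" "w' \<in> L - S" "R s w" "R s' w'"
proof -
  obtain s s' w w' where e: "s \<in> S" "s' \<in> S" "w \<in> L - S" "w' \<in> L - S" "R s w" "R s' w'" "(s, w) \<noteq> (s', w')"
    using cut[OF S(1) _ S(2)] ab by blast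
  show ?thesis
  proof (cases "s = s'")
    case False then show ?thesis using that e by blast
  next
    case True
    have "S - {s} \<noteq> L" using S e by blast
    moreover have "S - {s} \<subseteq> L" "S - {s} \<noteq> {}" using S ab by auto
    ultimately obtain u v where uv: "u \<in> S - {s}" "v \<in> L" "R u v" "v \<notin> S - {s}"
      using connected_onD[OF connected, of "S - {s}"] by blast
    have "v \<noteq> s"
    proof
      assume "v = s"
      then have "u = w \<or> u = w' \<or> w = w'"
        using no_three_nbrs[of s u w w'] sym[OF uv(3)] e True S uv by auto
      then show False using e uv True by auto
    qed
    then have "v \<in> L - S" using uv by auto
    then show ?thesis using that[of u s v w] uv e by auto
  qed
qed

end

section \<open>Numbering the vertices of a cycle\<close>

definition cyc_adj :: "nat \<Rightarrow> nat \<Rightarrow> nat \<Rightarrow> bool" where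
  "cyc_adj l i j \<longleftrightarrow> j = (i + 1) mod l \<or> i = (j + 1) mod l"

definition cycle_numbering :: "nat \<Rightarrow> (nat \<Rightarrow> 'v) \<Rightarrow> 'v set \<Rightarrow> ('v \<Rightarrow> 'v \<Rightarrow> bool) \<Rightarrow> bool" where
  "cycle_numbering l \<phi> L R \<longleftrightarrow> bij_betw \<phi> {..<l} L \<and> (\<forall>i<l. \<forall>j<l. i \<noteq> j \<longrightarrow> (R (\<phi> i) (\<phi> j) \<longleftrightarrow> cyc_adj l i j))"

lemma mod_pred: "(i + (n - 1)) mod n = (if i = 0 then n - 1 else i - 1)" if "i < n" for i n :: nat
proof (cases i)
  case (Suc k)
  then have "i + (n - 1) = k + n" using that by simp
  then show ?thesis using Suc that by simp
qed (use that in auto)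

lemma mod_succ: "(i + 1) mod n = (if i + 1 = n then 0 else i + 1)" if "i < n" for i n :: nat
  using that by auto

lemma cyc_adj_iff: "cyc_adj n i j \<longleftrightarrow> j = (i + 1) mod n \<or> j = (i + (n - 1)) mod n" if "i < n" "j < n"
  unfolding cyc_adj_def mod_succ[OF that(1)] mod_succ[OF that(2)] mod_pred[OF that(1)]
  using that by auto

lemma cyclic_subset_all:
  fixes i k l :: nat
  assumes I: "i \<in> I" "i < l" and step: "\<And>i. i \<in> I \<Longrightarrow> i < l \<Longrightarrow> (i + 1) mod l \<in> I" and k: "k < l"
  shows "k \<in> I"
proof -
  have "(i + n) mod l \<in> I" for n :: nat
  proof (induction n)
    case (Suc n)
    have "((i + n) mod l + 1) mod l = (i + Suc n) mod l" by (simp add: mod_Suc_eq)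
    then show ?case using step[OF Suc] I(2) by simp
  qed (use I in simp)
  from this[of "k + l - i"] show ?thesis using I(2) k by simp
qed

text \<open>
  Along the numbering, a proper nonempty set is left at least once and entered at least once; these
  are the two edges of the cut condition.
\<close>

lemma long_cycle_if_numbering:
  assumes \<phi>: "cycle_numbering l \<phi> L R" and l: "7 \<le> l"
    and sym: "\<And>u v. R u v \<Longrightarrow> R v u" and irrefl: "\<And>u. \<not> R u u"
  shows "long_cycle L R"
proof -
  have bij: "bij_betw \<phi> {..<l} L" and R: "\<And>i j. i < l \<Longrightarrow> j < l \<Longrightarrow> i \<noteq> j \<Longrightarrow> R (\<phi> i) (\<phi> j) \<longleftrightarrow> cyc_adj l i j"
    using \<phi> by (auto simp: cycle_numbering_def)
  have L: "L = \<phi> ` {..<l}" and inj: "inj_on \<phi> {..<l}" using bij by (auto simp: bij_betw_def)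
  have cut: "\<exists>s\<in>S. \<exists>s'\<in>S. \<exists>w\<in>L - S. \<exists>w'\<in>L - S. R s w \<and> R s' w' \<and> (s, w) \<noteq> (s', w')"
    if S: "S \<subseteq> L" "S \<noteq> {}" "S \<noteq> L" for S
  proof -
    let ?I = "{i. i < l \<and> \<phi> i \<in> S}" and ?J = "{i. i < l \<and> \<phi> i \<notin> S}"
    obtain a b where a: "a \<in> ?I" and b: "b \<in> ?J" using S L by blast
    obtain i where i: "i \<in> ?I" "(i + 1) mod l \<notin> ?I"
      using cyclic_subset_all[of a ?I l b] a b by auto
    obtain j where j: "j \<in> ?J" "(j + 1) mod l \<notin> ?J"
      using cyclic_subset_all[of b ?J l a] a b by auto
    let ?i = "(i + 1) mod l" and ?j = "(j + 1) mod l"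
    have lt: "?i < l" "?j < l" using l by auto
    have mem: "\<phi> i \<in> S" "\<phi> ?j \<in> S" "\<phi> ?i \<in> L - S" "\<phi> j \<in> L - S" using i j lt L by auto
    have ne: "i \<noteq> ?i" "?j \<noteq> j" using mem by auto
    have "R (\<phi> i) (\<phi> ?i)" "R (\<phi> ?j) (\<phi> j)"
      using R[of i ?i] R[of ?j j] i j lt ne by (auto simp: cyc_adj_def)
    moreover have "(\<phi> i, \<phi> ?i) \<noteq> (\<phi> ?j, \<phi> j)"
    proof
      assume "(\<phi> i, \<phi> ?i) = (\<phi> ?j, \<phi> j)"
      then have "i = ?j" "?i = j" using inj i j lt by (auto dest: inj_onD)
      then have "j = (j + 2) mod l" by (simp add: mod_Suc_eq)
      moreover have "(j + 2) mod l = (if j + 2 < l then j + 2 else j + 2 - l)"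
        using j l by (auto simp: le_mod_geq)
      ultimately show False using l by (auto split: if_splits)
    qed
    ultimately show ?thesis using mem by blast
  qed
  show ?thesis
  proof
    show "cyclic_on L R" unfolding cyclic_on_def
    proof (intro conjI ballI)
      show "connected_on L R" unfolding connected_on_def
      proof (intro allI impI)
        fix S assume S: "closed_in L R S"
        show "S = {} \<or> S = L"
        proof (rule ccontr)
          assume "\<not> ?thesis"
          then obtain s w where "s \<in> S" "w \<in> L - S" "R s w" using cut[of S] S by (auto simp: closed_in_def)
          then show False using S by (auto simp: closed_in_def nbrs_def)
        qed
      qed
      fix u assume "u \<in> L"
      then obtain i where i: "i < l" "u = \<phi> i" using L by auto
      let ?p = "(i + (l - 1)) mod l" and ?s = "(i + 1) mod l"
      have ps: "?p < l" "?s < l" "?p \<noteq> ?s" "?p \<noteq> i" "?s \<noteq> i"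
        unfolding mod_pred[OF i(1)] mod_succ[OF i(1)] using i l by auto
      have "cyc_adj l i j \<longleftrightarrow> j = ?p \<or> j = ?s" if "j < l" for j
        using cyc_adj_iff[OF i(1) that] by blast
      then have "nbrs L R u = {\<phi> ?p, \<phi> ?s}"
        using R[OF i(1)] irrefl i ps unfolding nbrs_def L by auto
      moreover have "\<phi> ?p \<noteq> \<phi> ?s" using inj ps by (auto dest: inj_onD)
      ultimately show "card (nbrs L R u) = 2" by simp
    qed
    show "7 \<le> card L" using l inj unfolding L by (simp add: card_image)
  qed (use sym irrefl cut in blast)+
qed

text \<open>
  A longest path closes up. Its last vertex has no neighbour outside the path, and the inner vertices
  have both their neighbours next to them, so the second neighbour of the last vertex is the first one.
\<close>

lemma numbering_if_cyclic:
  assumes cyc: "cyclic_on L R" and L: "finite L" "L \<noteq> {}"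
    and sym: "\<And>u v. R u v \<Longrightarrow> R v u" and irrefl: "\<And>u. \<not> R u u"
  obtains \<phi> where "cycle_numbering (card L) \<phi> L R"
proof -
  define path where "path xs \<longleftrightarrow> distinct xs \<and> set xs \<subseteq> L \<and> successively R xs \<and> xs \<noteq> []" for xs
  have bound: "length xs \<le> card L" if "path xs" for xs
    using that L(1) by (metis card_mono distinct_card path_def)
  obtain v where "v \<in> L" using L by blast
  then have "path [v]" by (simp add: path_def)
  then obtain xs where xs: "path xs" "\<And>ys. path ys \<Longrightarrow> length ys \<le> length xs"
    using ex_has_greatest_nat[of path "[v]" length "card L + 1"] bound by (metis le_imp_less_Suc Suc_eq_plus1)
  have dist: "distinct xs" and sub: "set xs \<subseteq> L" and ne: "xs \<noteq> []" using xs(1) by (auto simp: path_def)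
  have nth: "xs ! i = xs ! j \<longleftrightarrow> i = j" if "i < length xs" "j < length xs" for i j
    using that dist by (simp add: nth_eq_iff_index_eq)
  have suc: "R (xs ! i) (xs ! Suc i)" if "Suc i < length xs" for i
    using xs(1) that by (simp add: path_def successively_conv_nth)
  have two: "card (nbrs L R u) = 2" if "u \<in> L" for u using cyc that by (simp add: cyclic_on_def)
  have nb3: "a = b \<or> a = c \<or> b = c" if "u \<in> L" "a \<in> L" "b \<in> L" "c \<in> L" "R u a" "R u b" "R u c" for u a b c
    using card_2_subset[OF two[OF that(1)], of a b] that by (auto simp: nbrs_def)
  let ?n = "length xs"
  have inL: "xs ! i \<in> L" if "i < ?n" for i using sub that by auto
  have last_in: "xs ! (?n - 1) \<in> L" using inL ne by simp
  have stay: "a \<in> set xs" if a: "a \<in> L" "R (xs ! (?n - 1)) a" for a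
  proof (rule ccontr)
    assume "a \<notin> set xs"
    moreover have "R (last xs) a" using a(2) ne by (simp add: last_conv_nth)
    ultimately have "path (xs @ [a])" using xs(1) a by (auto simp: path_def successively_append_iff)
    then show False using xs(2) by fastforce
  qed
  obtain a b where ab: "a \<in> L" "b \<in> L" "a \<noteq> b" "R (xs ! (?n - 1)) a" "R (xs ! (?n - 1)) b"
  proof -
    obtain a b where "nbrs L R (xs ! (?n - 1)) = {a, b}" "a \<noteq> b" using two[OF last_in] by (auto simp: card_2_iff)
    then have "a \<in> nbrs L R (xs ! (?n - 1))" "b \<in> nbrs L R (xs ! (?n - 1))" by simp_all
    then show ?thesis using that \<open>a \<noteq> b\<close> by (auto simp: nbrs_def)
  qed
  have hd: "c = 0 \<or> c = ?n - 2" if c: "c < ?n" "R (xs ! (?n - 1)) (xs ! c)" for c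
  proof (rule ccontr)
    assume n: "\<not> ?thesis"
    moreover have "c \<noteq> ?n - 1" using c irrefl by metis
    ultimately have c': "0 < c" "Suc c < ?n" "Suc c \<noteq> ?n - 1" using c by auto
    have "R (xs ! c) (xs ! Suc c)" "R (xs ! c) (xs ! (c - 1))" "R (xs ! c) (xs ! (?n - 1))"
      using suc[OF c'(2)] sym[OF suc[of "c - 1"]] sym[OF c(2)] c' by auto
    then show False
      using nb3[of "xs ! c" "xs ! Suc c" "xs ! (c - 1)" "xs ! (?n - 1)"] inL c' nth by auto
  qed
  obtain ia ib where "a = xs ! ia" "ia < ?n" "b = xs ! ib" "ib < ?n"
    using stay[OF ab(1,4)] stay[OF ab(2,5)] by (auto simp: in_set_conv_nth)
  then have "{ia, ib} = {0, ?n - 2}" "ia \<noteq> ib" "ia \<noteq> ?n - 1" "ib \<noteq> ?n - 1" 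
    using hd[of ia] hd[of ib] ab irrefl by auto
  then have n3: "3 \<le> ?n" and wrap: "R (xs ! (?n - 1)) (xs ! 0)"
    using ab \<open>a = xs ! ia\<close> \<open>b = xs ! ib\<close> ne by (auto simp: doubleton_eq_iff numeral_3_eq_3 Suc_le_eq)
  have nxt: "R (xs ! i) (xs ! ((i + 1) mod ?n))" if "i < ?n" for i
  proof (cases "Suc i = ?n")
    case True
    then have "i = ?n - 1" by simp
    then show ?thesis using wrap True by simp
  next
    case False then show ?thesis using suc[of i] that by simp
  qed
  have nbrs: "nbrs L R (xs ! i) = {xs ! ((i + 1) mod ?n), xs ! ((i + (?n - 1)) mod ?n)}" if i: "i < ?n" for i
  proof (rule card_2_subset[OF two[OF inL[OF i]]])
    have p: "(i + (?n - 1)) mod ?n < ?n" "(i + 1) mod ?n < ?n" using i by (intro mod_less_divisor; linarith)+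
    have p': "((i + (?n - 1)) mod ?n + 1) mod ?n = i" "(i + 1) mod ?n \<noteq> (i + (?n - 1)) mod ?n"
      unfolding mod_succ[OF p(1)] mod_pred[OF i] mod_succ[OF i] using i n3 by auto
    show "xs ! ((i + 1) mod ?n) \<in> nbrs L R (xs ! i)" using nxt[OF i] inL p by (auto simp: nbrs_def)
    show "xs ! ((i + (?n - 1)) mod ?n) \<in> nbrs L R (xs ! i)"
      using sym[OF nxt[OF p(1)]] inL[OF p(1)] unfolding p'(1) by (simp add: nbrs_def)
    show "xs ! ((i + 1) mod ?n) \<noteq> xs ! ((i + (?n - 1)) mod ?n)" using p p'(2) nth by simp
  qed
  have all: "set xs = L"
  proof (rule connected_onD)
    show "connected_on L R" using cyc by (simp add: cyclic_on_def)
    fix u v assume "u \<in> set xs" "v \<in> L" "R u v"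
    then obtain i where "i < ?n" "v \<in> nbrs L R (xs ! i)" by (auto simp: in_set_conv_nth nbrs_def)
    moreover from this have "(i + 1) mod ?n < ?n" "(i + (?n - 1)) mod ?n < ?n"
      by (intro mod_less_divisor; linarith)+
    ultimately show "v \<in> set xs" using nbrs[of i] by auto
  qed (use sub ne in auto)
  have n: "?n = card L" using all dist by (metis distinct_card)
  have "cycle_numbering ?n ((!) xs) L R" unfolding cycle_numbering_def
  proof (intro conjI allI impI)
    show "bij_betw ((!) xs) {..<?n} L" using bij_betw_nth[OF dist refl] all by simp
    fix i j assume ij: "i < ?n" "j < ?n" "i \<noteq> j"
    have "R (xs ! i) (xs ! j) \<longleftrightarrow> xs ! j \<in> nbrs L R (xs ! i)" using inL ij by (auto simp: nbrs_def)
    also have "\<dots> \<longleftrightarrow> j = (i + 1) mod ?n \<or> j = (i + (?n - 1)) mod ?n"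
    proof -
      have "(i + 1) mod ?n < ?n" "(i + (?n - 1)) mod ?n < ?n"
        using ij by (intro mod_less_divisor; linarith)+
      then show ?thesis unfolding nbrs[OF ij(1)] using nth[OF ij(2)] by simp
    qed
    also have "\<dots> \<longleftrightarrow> cyc_adj ?n i j"
      using cyc_adj_iff[OF ij(1,2)] by simp
    finally show "R (xs ! i) (xs ! j) \<longleftrightarrow> cyc_adj ?n i j" .
  qed
  then show ?thesis using that n by simp
qed

section \<open>Leaves of a spine word\<close>

definition word_leaves :: "spine_word \<Rightarrow> (nat \<times> nat) set" where
  "word_leaves W = {(i, r). i < length W \<and> r \<in> W ! i}"

text \<open>A leaf \<open>z\<^sub>i\<^sub>,\<^sub>r\<close> is the pair \<open>(i, r)\<close>. Distinctness of \<open>u\<close> and \<open>v\<close> is implied, because \<open>r + r\<close> is never 5.\<close>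

definition leaf_adj :: "nat \<times> nat \<Rightarrow> nat \<times> nat \<Rightarrow> bool" where
  "leaf_adj u v \<longleftrightarrow> snd u + snd v + (fst u - fst v) + (fst v - fst u) = 5"

definition proper_word :: "spine_word \<Rightarrow> bool" where
  "proper_word W \<longleftrightarrow> (\<forall>A\<in>set W. A \<subseteq> {1, 2, 3})"

abbreviation word_nbrs :: "spine_word \<Rightarrow> nat \<times> nat \<Rightarrow> (nat \<times> nat) set" where
  "word_nbrs W \<equiv> nbrs (word_leaves W) leaf_adj"

abbreviation cyclic_word :: "spine_word \<Rightarrow> bool" where
  "cyclic_word W \<equiv> cyclic_on (word_leaves W) leaf_adj"

definition shift :: "nat \<Rightarrow> nat \<times> nat \<Rightarrow> nat \<times> nat" where
  "shift n v = (fst v + n, snd v)"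

text \<open>The distance of a leaf of \<open>U\<close> from the spine vertex that follows \<open>U\<close> when \<open>U\<close> is continued.\<close>

definition height :: "spine_word \<Rightarrow> nat \<times> nat \<Rightarrow> nat" where
  "height U u = snd u + (length U - fst u)"

lemma proper_word_simps [simp]:
  "proper_word []" "proper_word (A # W) \<longleftrightarrow> A \<subseteq> {1,2,3} \<and> proper_word W"
  "proper_word (U @ V) \<longleftrightarrow> proper_word U \<and> proper_word V"
  by (auto simp: proper_word_def)

lemma proper_wordD: "proper_word W \<Longrightarrow> u \<in> word_leaves W \<Longrightarrow> snd u \<in> {1,2,3}"
  unfolding proper_word_def word_leaves_def using nth_mem by fastforce

lemma word_leaves_Nil [simp]: "word_leaves [] = {}"
  by (simp add: word_leaves_def)

lemma finite_word_leaves: "proper_word W \<Longrightarrow> finite (word_leaves W)"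
  using proper_wordD by (intro finite_subset[of "word_leaves W" "{..<length W} \<times> {1,2,3}"])
    (force simp: word_leaves_def)+

lemma leaf_adj_sym: "leaf_adj u v \<longleftrightarrow> leaf_adj v u"
  by (auto simp: leaf_adj_def)

lemma leaf_adj_irrefl [simp]: "\<not> leaf_adj u u"
  by (simp add: leaf_adj_def) presburger

lemma inj_shift: "inj (shift n)"
  by (auto simp: shift_def inj_def prod_eq_iff)

lemma leaf_adj_shift [simp]: "leaf_adj (shift n u) (shift n v) \<longleftrightarrow> leaf_adj u v"
  by (simp add: leaf_adj_def shift_def)

lemma word_leaves_append:
  "word_leaves (U @ V) = word_leaves U \<union> shift (length U) ` word_leaves V"
proof -
  have "(i, r) \<in> shift (length U) ` word_leaves V"
    if "length U \<le> i" "i < length U + length V" "r \<in> V ! (i - length U)" for i r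
    using that by (intro image_eqI[of _ _ "(i - length U, r)"]) (auto simp: shift_def word_leaves_def)
  then show ?thesis
    by (auto simp: word_leaves_def shift_def nth_append split: if_splits)
qed

lemma word_leaves_Cons:
  "word_leaves (A # W) = Pair 0 ` A \<union> (\<lambda>v. (Suc (fst v), snd v)) ` word_leaves W"
  using word_leaves_append[of "[A]" W] by (auto simp: word_leaves_def shift_def)

lemma shift_notin_word_leaves: "shift (length U) v \<notin> word_leaves U"
  by (auto simp: shift_def word_leaves_def)

lemma leaf_adj_cross:
  assumes "u \<in> word_leaves U"
  shows "leaf_adj u (shift (length U) v) \<longleftrightarrow> height U u + fst v + snd v = 5"
  using assms by (auto simp: leaf_adj_def shift_def height_def word_leaves_def)

lemma height_append_old:
  "u \<in> word_leaves U \<Longrightarrow> height (U @ V) u = height U u + length V"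
  by (auto simp: height_def word_leaves_def)

lemma height_append_new: "height (U @ V) (shift (length U) v) = height V v"
  by (auto simp: height_def shift_def)

section \<open>Replacing a prefix by a single symbol\<close>

text \<open>
  The leaves of \<open>U\<close> form a path from \<open>p\<close> to \<open>q\<close>. Later leaves are at distance at least 1 from the spine
  vertex after \<open>U\<close>, so a leaf of height at least 5 has no later neighbour and only \<open>p\<close> and \<open>q\<close> can be
  continued. The heights 4 and 3 are those of the leaves of the word \<open>23\<close>; every block reproduces them.
\<close>

definition two_ended_at :: "spine_word \<Rightarrow> nat \<times> nat \<Rightarrow> nat \<times> nat \<Rightarrow> bool" where
  "two_ended_at U p q \<longleftrightarrow> proper_word U \<and> connected_on (word_leaves U) leaf_adj \<and>
     p \<in> word_leaves U \<and> q \<in> word_leaves U \<and> height U p = 4 \<and> height U q = 3 \<and>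
     card (word_nbrs U p) = 1 \<and> card (word_nbrs U q) = 1 \<and>
     (\<forall>u \<in> word_leaves U - {p, q}. card (word_nbrs U u) = 2 \<and> 5 \<le> height U u)"

definition two_ended :: "spine_word \<Rightarrow> bool" where
  "two_ended U \<longleftrightarrow> (\<exists>p q. two_ended_at U p q)"

text \<open>
  The leaves of \<open>V\<close> at distance \<open>k\<close> from its first spine vertex. For \<open>k = 1\<close> they are the neighbours of
  the end of height 4 of a two-ended prefix, for \<open>k = 2\<close> those of the end of height 3.
\<close>

definition ports :: "nat \<Rightarrow> spine_word \<Rightarrow> (nat \<times> nat) set" where
  "ports k V = {v \<in> word_leaves V. fst v + snd v = k}"

lemma finite_nbrs: "finite L \<Longrightarrow> finite (nbrs L R u)"
  by (simp add: nbrs_def)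

lemma card_nbrs_new:
  assumes U: "two_ended_at U p q" and V: "proper_word V" "v \<in> word_leaves V"
  shows "card (word_nbrs (U @ V) (shift (length U) v)) =
     card (word_nbrs V v) + of_bool (v \<in> ports 1 V) + of_bool (v \<in> ports 2 V)"
proof -
  let ?O = "{u \<in> word_leaves U. height U u + fst v + snd v = 5}"
  have cross: "leaf_adj (shift (length U) v) u \<longleftrightarrow> height U u + fst v + snd v = 5" if "u \<in> word_leaves U" for u
    using leaf_adj_cross[OF that] leaf_adj_sym by blast
  have split: "word_nbrs (U @ V) (shift (length U) v) = ?O \<union> shift (length U) ` word_nbrs V v"
    using cross by (auto simp: nbrs_def word_leaves_append)
  have pos: "fst v + snd v \<ge> 1" using proper_wordD[OF V] by auto
  have O: "?O = (if v \<in> ports 1 V then {p} else if v \<in> ports 2 V then {q} else {})"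
  proof (intro set_eqI)
    fix u
    have "u \<in> word_leaves U \<Longrightarrow> u = p \<or> u = q \<or> 5 \<le> height U u"
      using U by (auto simp: two_ended_at_def)
    moreover have "p \<in> word_leaves U" "q \<in> word_leaves U" "height U p = 4" "height U q = 3"
      using U by (auto simp: two_ended_at_def)
    ultimately show "u \<in> ?O \<longleftrightarrow> u \<in> (if v \<in> ports 1 V then {p} else if v \<in> ports 2 V then {q} else {})"
      using pos V(2) by (auto simp: ports_def)
  qed
  have "card (?O \<union> shift (length U) ` word_nbrs V v) = card ?O + card (shift (length U) ` word_nbrs V v)"
    using finite_word_leaves[of U] finite_word_leaves[OF V(1)] U shift_notin_word_leaves[of U]
    by (intro card_Un_disjoint) (auto simp: two_ended_at_def intro: finite_nbrs)
  also have "card (shift (length U) ` word_nbrs V v) = card (word_nbrs V v)"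
    by (intro card_image inj_on_subset[OF inj_shift]) auto
  finally show ?thesis unfolding split O by (auto simp: ports_def)
qed

lemma card_nbrs_old:
  assumes "proper_word U" "proper_word V" "u \<in> word_leaves U"
  shows "card (word_nbrs (U @ V) u) =
     card (word_nbrs U u) + (if height U u \<le> 4 then card (ports (5 - height U u) V) else 0)"
proof -
  let ?N = "{v \<in> word_leaves V. height U u + fst v + snd v = 5}"
  have split: "word_nbrs (U @ V) u = word_nbrs U u \<union> shift (length U) ` ?N"
    using leaf_adj_cross[OF assms(3)] by (auto simp: nbrs_def word_leaves_append)
  have pos: "1 \<le> snd v" if "v \<in> word_leaves V" for v
    using proper_wordD[OF assms(2) that] by auto
  have N: "?N = (if height U u \<le> 4 then ports (5 - height U u) V else {})"
  proof (intro set_eqI)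
    fix v show "v \<in> ?N \<longleftrightarrow> v \<in> (if height U u \<le> 4 then ports (5 - height U u) V else {})"
      using pos[of v] by (auto simp: ports_def)
  qed
  have "card (word_nbrs U u \<union> shift (length U) ` ?N) = card (word_nbrs U u) + card (shift (length U) ` ?N)"
    using finite_word_leaves[OF assms(1)] finite_word_leaves[OF assms(2)] shift_notin_word_leaves[of U]
    by (intro card_Un_disjoint) (auto intro: finite_nbrs simp: nbrs_def)
  also have "card (shift (length U) ` ?N) = card ?N"
    by (intro card_image inj_on_subset[OF inj_shift]) auto
  finally show ?thesis unfolding split N by simp
qed

text \<open>
  The leaves of \<open>U\<close> are connected among themselves, so a closed set contains all of them or none. The
  resulting condition mentions \<open>V\<close> only, which is what makes two-ended prefixes interchangeable.
\<close>

lemma connected_on_append: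
  assumes U: "two_ended_at U p q" and V: "proper_word V"
  shows "connected_on (word_leaves (U @ V)) leaf_adj \<longleftrightarrow>
    (\<forall>S. closed_in (word_leaves V) leaf_adj S \<longrightarrow>
       (S \<inter> (ports 1 V \<union> ports 2 V) = {} \<longrightarrow> S = {}) \<and>
       (ports 1 V \<union> ports 2 V \<subseteq> S \<longrightarrow> S = word_leaves V))" (is "?L \<longleftrightarrow> ?R")
proof
  let ?sh = "shift (length U)" and ?P = "ports 1 V \<union> ports 2 V"
  have pq: "p \<in> word_leaves U" "q \<in> word_leaves U" "height U p = 4" "height U q = 3"
    and hi: "\<And>u. u \<in> word_leaves U \<Longrightarrow> u \<noteq> p \<Longrightarrow> u \<noteq> q \<Longrightarrow> 5 \<le> height U u"
    and conn: "connected_on (word_leaves U) leaf_adj"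
    using U by (auto simp: two_ended_at_def)
  have cross: "u \<in> {p, q} \<and> v \<in> ?P" if "u \<in> word_leaves U" "v \<in> word_leaves V" "leaf_adj u (?sh v)" for u v
  proof -
    have "height U u + fst v + snd v = 5" "1 \<le> snd v"
      using leaf_adj_cross[OF that(1)] that(3) proper_wordD[OF V that(2)] by auto
    moreover have "u = p \<or> u = q \<or> 5 \<le> height U u" using hi that(1) by blast
    ultimately show ?thesis using pq(3,4) that(2) by (auto simp: ports_def)
  qed
  have port: "leaf_adj p (?sh v) \<longleftrightarrow> v \<in> ports 1 V" "leaf_adj q (?sh v) \<longleftrightarrow> v \<in> ports 2 V"
    if "v \<in> word_leaves V" for v
    using leaf_adj_cross[OF pq(1), of v] leaf_adj_cross[OF pq(2), of v] pq that by (auto simp: ports_def)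
  have split: "word_leaves (U @ V) = word_leaves U \<union> ?sh ` word_leaves V"
    by (rule word_leaves_append)
  {
    assume ?L
    then have all: "T = {} \<or> T = word_leaves (U @ V)"
      if "T \<subseteq> word_leaves (U @ V)" "\<And>u v. u \<in> T \<Longrightarrow> v \<in> word_leaves (U @ V) \<Longrightarrow> leaf_adj u v \<Longrightarrow> v \<in> T" for T
      using that unfolding connected_on_def closed_in_def nbrs_def by blast
    show ?R
    proof (intro allI impI conjI)
      fix S assume S: "closed_in (word_leaves V) leaf_adj S" and np: "S \<inter> ?P = {}"
      have "?sh ` S = {} \<or> ?sh ` S = word_leaves (U @ V)"
      proof (rule all)
        show "?sh ` S \<subseteq> word_leaves (U @ V)" using S by (auto simp: closed_in_def split)
      next
        fix u v assume u: "u \<in> ?sh ` S" and v: "v \<in> word_leaves (U @ V)" and a: "leaf_adj u v"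
        from u obtain u' where u': "u = ?sh u'" "u' \<in> S" by auto
        then have "u' \<in> word_leaves V" using S by (auto simp: closed_in_def)
        with cross[of v u'] a u' np have "v \<notin> word_leaves U" by (auto simp: leaf_adj_sym)
        then obtain v' where v': "v = ?sh v'" "v' \<in> word_leaves V" using v split by auto
        with a u' S show "v \<in> ?sh ` S" by (auto simp: closed_in_def nbrs_def)
      qed
      moreover have "p \<notin> ?sh ` S" using pq(1) shift_notin_word_leaves[of U] by blast
      ultimately show "S = {}" using pq(1) by (auto simp: split)
    next
      fix S assume S: "closed_in (word_leaves V) leaf_adj S" and sp: "?P \<subseteq> S"
      have "word_leaves U \<union> ?sh ` S = {} \<or> word_leaves U \<union> ?sh ` S = word_leaves (U @ V)"
      proof (rule all)
        show "word_leaves U \<union> ?sh ` S \<subseteq> word_leaves (U @ V)" using S by (auto simp: closed_in_def split)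
      next
        fix u v assume u: "u \<in> word_leaves U \<union> ?sh ` S" and v: "v \<in> word_leaves (U @ V)" and a: "leaf_adj u v"
        show "v \<in> word_leaves U \<union> ?sh ` S"
        proof (cases "v \<in> word_leaves U")
          case False
          then obtain v' where v': "v = ?sh v'" "v' \<in> word_leaves V" using v split by auto
          show ?thesis
          proof (cases "u \<in> word_leaves U")
            case True then show ?thesis using cross[of u v'] v' a sp by auto
          next
            case False
            then obtain u' where "u = ?sh u'" "u' \<in> S" using u by auto
            then show ?thesis using S v' a by (auto simp: closed_in_def nbrs_def)
          qed
        qed simp
      qed
      then have eq: "word_leaves U \<union> ?sh ` S = word_leaves U \<union> ?sh ` word_leaves V" using pq(1) split by auto
      show "S = word_leaves V"
      proof
        show "word_leaves V \<subseteq> S"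
        proof
          fix v assume "v \<in> word_leaves V"
          then have "?sh v \<in> word_leaves U \<union> ?sh ` S" using eq by blast
          then show "v \<in> S" using shift_notin_word_leaves[of U v] inj_shift[of "length U"] by (auto dest: injD)
        qed
      qed (use S in \<open>auto simp: closed_in_def\<close>)
    qed
  }
  assume R: ?R
  show ?L unfolding connected_on_def
  proof (intro allI impI)
    fix T assume T: "closed_in (word_leaves (U @ V)) leaf_adj T"
    then have cl: "v \<in> T" if "u \<in> T" "v \<in> word_leaves (U @ V)" "leaf_adj u v" for u v
      using that by (auto simp: closed_in_def nbrs_def)
    let ?S = "{v \<in> word_leaves V. ?sh v \<in> T}"
    have "closed_in (word_leaves U) leaf_adj (T \<inter> word_leaves U)"
      using cl by (auto simp: closed_in_def nbrs_def split)
    then have "T \<inter> word_leaves U = {} \<or> T \<inter> word_leaves U = word_leaves U"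
      using conn by (auto simp: connected_on_def)
    moreover have S: "closed_in (word_leaves V) leaf_adj ?S"
      unfolding closed_in_def nbrs_def
    proof (intro conjI ballI subsetI)
      fix v w assume "v \<in> ?S" "w \<in> {w \<in> word_leaves V. leaf_adj v w}"
      then show "w \<in> ?S" using cl[of "?sh v" "?sh w"] by (auto simp: split)
    qed auto
    moreover have "?S = {}" if "T \<inter> word_leaves U = {}"
    proof -
      have "?S \<inter> ?P = {}" using cl[of "?sh _" p] cl[of "?sh _" q] port pq that leaf_adj_sym split by blast
      with R S show ?thesis by blast
    qed
    moreover have "?S = word_leaves V" if "T \<inter> word_leaves U = word_leaves U"
    proof -
      have "p \<in> T" "q \<in> T" using that pq by auto
      then have "?sh v \<in> T" if "v \<in> ?P" for v
        using port[of v] cl[of p "?sh v"] cl[of q "?sh v"] that by (auto simp: split ports_def)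
      then have "?P \<subseteq> ?S" by (auto simp: ports_def)
      with R S show ?thesis by blast
    qed
    moreover have "T \<subseteq> word_leaves U \<union> ?sh ` word_leaves V" using T split by (auto simp: closed_in_def)
    ultimately show "T = {} \<or> T = word_leaves (U @ V)" unfolding split by blast
  qed
qed

definition completes :: "spine_word \<Rightarrow> bool" where
  "completes V \<longleftrightarrow> cyclic_word ([S23] @ V)"

lemma two_ended_S23: "two_ended_at [S23] (0, 3) (0, 2)"
proof -
  have L: "word_leaves [S23] = {(0,2),(0,3)}" by (auto simp: word_leaves_Cons)
  have N: "word_nbrs [S23] (0,3) = {(0,2)}" "word_nbrs [S23] (0,2) = {(0,3)}"
    by (auto simp: nbrs_def L leaf_adj_def)
  have "connected_on (word_leaves [S23]) leaf_adj"
    unfolding connected_on_def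
  proof (intro allI impI)
    fix S assume "closed_in (word_leaves [S23]) leaf_adj S"
    then have "S \<subseteq> {(0,2),(0,3)}" "(0,2) \<in> S \<longleftrightarrow> (0,3) \<in> S"
      using N by (auto simp: closed_in_def L)
    then show "S = {} \<or> S = word_leaves [S23]" unfolding L by blast
  qed
  moreover have "card (word_nbrs [S23] (0,3)) = 1" "card (word_nbrs [S23] (0,2)) = 1"
    unfolding N by simp_all
  ultimately show ?thesis by (auto simp: two_ended_at_def L height_def)
qed

text \<open>
  Connectedness and the degrees of \<open>U @ V\<close> depend on \<open>V\<close> only, as long as \<open>U\<close> is two-ended. The word
  \<open>23\<close> is the simplest such prefix.
\<close>

lemma cyclic_word_append:
  assumes "two_ended U" "proper_word V"
  shows "cyclic_word (U @ V) \<longleftrightarrow> completes V"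
proof -
  obtain p q where U: "two_ended_at U p q" using assms(1) by (auto simp: two_ended_def)
  have "cyclic_word (U @ V) \<longleftrightarrow>
    (\<forall>S. closed_in (word_leaves V) leaf_adj S \<longrightarrow>
       (S \<inter> (ports 1 V \<union> ports 2 V) = {} \<longrightarrow> S = {}) \<and>
       (ports 1 V \<union> ports 2 V \<subseteq> S \<longrightarrow> S = word_leaves V)) \<and>
    card (ports 1 V) = 1 \<and> card (ports 2 V) = 1 \<and>
    (\<forall>v\<in>word_leaves V. card (word_nbrs V v) + of_bool (v \<in> ports 1 V) + of_bool (v \<in> ports 2 V) = 2)"
    if U: "two_ended_at U p q" for U p q
  proof -
    have pq: "p \<in> word_leaves U" "q \<in> word_leaves U" "height U p = 4" "height U q = 3" "proper_word U"
      "card (word_nbrs U p) = 1" "card (word_nbrs U q) = 1"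
      and hi: "\<And>u. u \<in> word_leaves U \<Longrightarrow> u \<noteq> p \<Longrightarrow> u \<noteq> q \<Longrightarrow> 5 \<le> height U u \<and> card (word_nbrs U u) = 2"
      using U by (auto simp: two_ended_at_def)
    have "(\<forall>u\<in>word_leaves U. card (word_nbrs (U @ V) u) = 2) \<longleftrightarrow> card (ports 1 V) = 1 \<and> card (ports 2 V) = 1"
    proof -
      have "card (word_nbrs (U @ V) p) = 1 + card (ports 1 V)" "card (word_nbrs (U @ V) q) = 1 + card (ports 2 V)"
        using card_nbrs_old[OF pq(5) assms(2)] pq by auto
      moreover have "card (word_nbrs (U @ V) u) = 2" if "u \<in> word_leaves U" "u \<noteq> p" "u \<noteq> q" for u
        using card_nbrs_old[OF pq(5) assms(2) that(1)] hi[OF that] by auto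
      ultimately show ?thesis using pq(1,2) by (metis add_left_cancel one_add_one)
    qed
    moreover have "(\<forall>u\<in>word_leaves (U @ V). P u) \<longleftrightarrow>
        (\<forall>u\<in>word_leaves U. P u) \<and> (\<forall>v\<in>word_leaves V. P (shift (length U) v))" for P
      by (auto simp: word_leaves_append)
    ultimately show ?thesis
      unfolding cyclic_on_def connected_on_append[OF U assms(2)]
      using card_nbrs_new[OF U assms(2)] by simp
  qed
  from this[OF U] this[OF two_ended_S23] show ?thesis by (simp add: completes_def)
qed

text \<open>
  The same exchange of prefixes, for a word whose leaves form a path. As \<open>b\<close> has at least two symbols,
  the former ends are lifted from heights 4 and 3 to at least 5.
\<close>

lemma two_ended_append:
  assumes U: "two_ended U" and b: "two_ended ([S23] @ b)" "2 \<le> length b"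
  shows "two_ended (U @ b)"
proof -
  obtain p q where U: "two_ended_at U p q" using assms(1) by (auto simp: two_ended_def)
  obtain p' q' where B: "two_ended_at ([S23] @ b) p' q'" using b by (auto simp: two_ended_def)
  have pb: "proper_word b" using B by (auto simp: two_ended_at_def)
  let ?sh = "shift (length U)" and ?one = "shift (length [S23])"
  have new: "u \<in> ?one ` word_leaves b" if "u \<in> word_leaves ([S23] @ b)" "height ([S23] @ b) u \<le> 4" for u
  proof (rule ccontr)
    assume "\<not> ?thesis"
    with that have u: "u \<in> word_leaves [S23]" by (auto simp: word_leaves_append simp del: append_Cons)
    then have "height [S23] u \<ge> 3" by (auto simp: word_leaves_Cons height_def)
    with height_append_old[OF u, of b] that(2) b(2) show False by linarith
  qed
  obtain p1 q1 where p1: "p' = ?one p1" "p1 \<in> word_leaves b" and q1: "q' = ?one q1" "q1 \<in> word_leaves b"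
    using new[of p'] new[of q'] B by (auto simp: two_ended_at_def)
  have h: "height (U @ b) (?sh v) = height ([S23] @ b) (?one v)" for v
    by (simp only: height_append_new)
  have c: "card (word_nbrs (U @ b) (?sh v)) = card (word_nbrs ([S23] @ b) (?one v))" if "v \<in> word_leaves b" for v
    by (simp only: card_nbrs_new[OF U pb that] card_nbrs_new[OF two_ended_S23 pb that])
  have "card (word_nbrs (U @ b) u) = 2 \<and> 5 \<le> height (U @ b) u" if u: "u \<in> word_leaves U" for u
  proof -
    have one: "card (ports 1 b) = 1" "card (ports 2 b) = 1"
    proof -
      have 23: "(0,3) \<in> word_leaves [S23]" "(0,2) \<in> word_leaves [S23]" "proper_word [S23]"
        "height [S23] (0,3) = 4" "height [S23] (0,2) = 3"
        "card (word_nbrs [S23] (0,3)) = 1" "card (word_nbrs [S23] (0,2)) = 1"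
        using two_ended_S23 by (auto simp: two_ended_at_def)
      have "u \<in> word_leaves ([S23] @ b)" "u \<noteq> p'" "u \<noteq> q'" if "u \<in> word_leaves [S23]" for u
        using that p1 q1 shift_notin_word_leaves[of "[S23]" p1] shift_notin_word_leaves[of "[S23]" q1] by (auto simp: word_leaves_append simp del: append_Cons)
      then have "card (word_nbrs ([S23] @ b) (0,3)) = 2" "card (word_nbrs ([S23] @ b) (0,2)) = 2"
        using B 23 by (auto simp: two_ended_at_def simp del: append_Cons)
      then show "card (ports 1 b) = 1" "card (ports 2 b) = 1"
        using card_nbrs_old[OF 23(3) pb 23(1)] card_nbrs_old[OF 23(3) pb 23(2)] 23 by auto
    qed
    have "proper_word U" using U by (simp add: two_ended_at_def)
    from card_nbrs_old[OF this pb u] height_append_old[OF u, of b]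
    have count: "card (word_nbrs (U @ b) u) = card (word_nbrs U u) + (if height U u \<le> 4 then card (ports (5 - height U u) b) else 0)"
      and up: "height (U @ b) u = height U u + length b" by auto
    consider "u = p" | "u = q" | "card (word_nbrs U u) = 2" "5 \<le> height U u"
      using U u unfolding two_ended_at_def by blast
    then show ?thesis
      by cases (use count up one b(2) U in \<open>auto simp: two_ended_at_def\<close>)
  qed
  moreover have "card (word_nbrs (U @ b) (?sh v)) = 2 \<and> 5 \<le> height (U @ b) (?sh v)"
    if v: "v \<in> word_leaves b" "v \<noteq> p1" "v \<noteq> q1" for v
  proof -
    have "?one v \<noteq> p'" "?one v \<noteq> q'" using v p1 q1 inj_shift by (auto dest: injD)
    moreover have "?one v \<in> word_leaves ([S23] @ b)" using v by (simp add: word_leaves_append del: append_Cons)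
    ultimately show ?thesis unfolding h c[OF v(1)] using B by (simp add: two_ended_at_def del: append_Cons)
  qed
  moreover have "connected_on (word_leaves (U @ b)) leaf_adj"
    using connected_on_append[OF U pb] connected_on_append[OF two_ended_S23 pb] B by (simp add: two_ended_at_def)
  ultimately have "two_ended_at (U @ b) (?sh p1) (?sh q1)"
    using U B pb h[of p1] h[of q1] c[OF p1(2)] c[OF q1(2)] p1 q1 word_leaves_append[of U b]
    unfolding two_ended_at_def proper_word_simps by fastforce
  then show ?thesis unfolding two_ended_def by blast
qed

section \<open>Closing a path\<close>

lemma word_eqI:
  assumes "word_leaves W = word_leaves F" "length W = length F"
  shows "W = F"
proof (rule nth_equalityI[OF assms(2)])
  fix i assume "i < length W"
  have "r \<in> W ! i \<longleftrightarrow> r \<in> F ! i" for r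
    using assms \<open>i < length W\<close> by (auto simp: word_leaves_def set_eq_iff)
  then show "W ! i = F ! i" by auto
qed

lemma path_two_nbrs:
  assumes "successively leaf_adj ps" "distinct ps" "u \<in> set ps" "u \<noteq> hd ps" "u \<noteq> last ps"
  shows "\<exists>v\<in>set ps. \<exists>w\<in>set ps. v \<noteq> w \<and> leaf_adj u v \<and> leaf_adj u w"
proof -
  obtain i where i: "i < length ps" "u = ps ! i" using assms(3) by (auto simp: in_set_conv_nth)
  have i0: "0 < i" using i assms(4) by (cases i) (auto simp: hd_conv_nth)
  have "i \<noteq> length ps - 1" using i assms(5) by (metis last_conv_nth list.size(3) not_less_zero)
  then have i1: "Suc i < length ps" using i by linarith
  have adj: "leaf_adj (ps ! j) (ps ! Suc j)" if "Suc j < length ps" for j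
    using assms(1) that by (simp add: successively_conv_nth)
  have a: "leaf_adj u (ps ! Suc i)" "leaf_adj u (ps ! (i - 1))"
    using adj[OF i1] adj[of "i - 1"] i i0 leaf_adj_sym[of "ps ! (i - 1)" "ps ! i"] by simp_all
  have "ps ! Suc i \<noteq> ps ! (i - 1)" using assms(2) i1 i0 by (simp add: nth_eq_iff_index_eq)
  with a i i1 show ?thesis by (metis less_imp_diff_less nth_mem)
qed

text \<open>
  The leaf \<open>c\<close> continues the path at its end \<open>e\<close>. Its second neighbour \<open>x\<close> is not on the path, where inner
  leaves are saturated and \<open>e'\<close> is excluded, so by the last assumption \<open>x\<close> is adjacent to \<open>e'\<close> too.
  Then the path, \<open>c\<close> and \<open>x\<close> form a ring, which is everything.
\<close>

lemma path_closes_aux: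
  assumes W: "cyclic_word W"
    and ps: "distinct ps" "successively leaf_adj ps" "2 \<le> length ps" "set ps \<subseteq> word_leaves W"
    and ends: "{e, e'} = {hd ps, last ps}"
    and c: "c \<in> word_leaves W" "c \<notin> set ps" "leaf_adj e c" "\<not> leaf_adj e' c"
    and far: "\<And>x. x \<in> word_leaves W \<Longrightarrow> x \<notin> set ps \<Longrightarrow> leaf_adj c x \<Longrightarrow> leaf_adj e' x"
  obtains x where "x \<in> word_leaves W" "x \<notin> set ps" "leaf_adj c x"
    "word_leaves W = insert c (insert x (set ps))"
proof -
  have card2: "card (word_nbrs W u) = 2" if "u \<in> word_leaves W" for u
    using W that by (auto simp: cyclic_on_def)
  obtain y where y: "y \<in> word_nbrs W c" "y \<noteq> e"
  proof -
    have "\<not> word_nbrs W c \<subseteq> {e}" using card2[OF c(1)] by (metis card_mono finite.simps card.empty card_insert_disjoint finite.emptyI not_less_eq_eq numeral_2_eq_2 empty_iff le_refl)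
    with that show ?thesis by blast
  qed
  have inner: "word_nbrs W u \<subseteq> set ps" if u: "u \<in> set ps" "u \<noteq> e" "u \<noteq> e'" for u
  proof -
    have "u \<noteq> hd ps" "u \<noteq> last ps" using ends u by (auto simp: doubleton_eq_iff)
    then obtain v w where "v \<in> set ps" "w \<in> set ps" "v \<noteq> w" "leaf_adj u v" "leaf_adj u w"
      using path_two_nbrs[OF ps(2,1) u(1)] by blast
    moreover have "card (word_nbrs W u) = 2" using ps(4) u(1) by (intro card2) auto
    moreover from this have "finite (word_nbrs W u)" using card.infinite by fastforce
    moreover have "{v, w} \<subseteq> word_nbrs W u" if "v \<in> set ps" "w \<in> set ps" "leaf_adj u v" "leaf_adj u w" for v w
      using ps(4) that by (auto simp: nbrs_def)
    ultimately have "{v, w} = word_nbrs W u" by (intro card_subset_eq) auto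
    with \<open>v \<in> set ps\<close> \<open>w \<in> set ps\<close>
    show ?thesis by (metis empty_subsetI insert_subset)
  qed
  have ny: "y \<notin> set ps"
  proof
    assume "y \<in> set ps"
    moreover have "y \<noteq> e'" using y(1) c(4) by (auto simp: nbrs_def leaf_adj_sym)
    ultimately have "c \<in> set ps" using inner[of y] y c(1) by (auto simp: nbrs_def leaf_adj_sym)
    then show False using c(2) by simp
  qed
  have y': "y \<in> word_leaves W" "leaf_adj c y" using y by (auto simp: nbrs_def)
  have e'y: "leaf_adj e' y" by (rule far[OF y'(1) ny y'(2)])
  have "insert c (insert y (set ps)) = word_leaves W"
  proof (rule cyclic_on_ring[OF W])
    let ?S = "insert c (insert y (set ps))"
    show "?S \<subseteq> word_leaves W" "?S \<noteq> {}" using c y' ps by auto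
    have hd: "\<exists>v\<in>set ps. leaf_adj (hd ps) v"
      using ps(2,3) by (cases ps; cases "tl ps") auto
    have last: "\<exists>v\<in>set ps. leaf_adj (last ps) v"
    proof -
      have "leaf_adj (ps ! (length ps - 2)) (ps ! Suc (length ps - 2))"
        using ps(2,3) by (simp add: successively_conv_nth)
      moreover have "ps ! Suc (length ps - 2) = last ps"
        using ps(3) by (subst last_conv_nth) (auto simp: Suc_diff_Suc numeral_2_eq_2)
      moreover have "ps ! (length ps - 2) \<in> set ps" using ps(3) by (intro nth_mem) auto
      ultimately show ?thesis using leaf_adj_sym by metis
    qed
    fix u assume "u \<in> ?S"
    have e: "\<exists>v\<in>set ps. leaf_adj e v" "\<exists>v\<in>set ps. leaf_adj e' v"
      using hd last ends by (auto simp: doubleton_eq_iff)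
    have eps: "e \<in> set ps" "e' \<in> set ps"
    proof -
      have "{hd ps, last ps} \<subseteq> set ps" using ps(3) by (cases ps) auto
      then show "e \<in> set ps" "e' \<in> set ps" unfolding ends[symmetric] by auto
    qed
    have ne: "e \<noteq> e'" using c(3,4) by auto
    consider "u = c" | "u = y" | "u = e" | "u = e'" | "u \<in> set ps" "u \<noteq> hd ps" "u \<noteq> last ps"
      using \<open>u \<in> ?S\<close> ends by (auto simp: doubleton_eq_iff)
    then show "\<exists>v\<in>?S. \<exists>w\<in>?S. v \<noteq> w \<and> leaf_adj u v \<and> leaf_adj u w"
    proof cases
      case 1
      then have "leaf_adj u e" "leaf_adj u y" using c(3) y'(2) leaf_adj_sym[of e c] by simp_all
      then show ?thesis using eps(1) y(2) by (intro bexI[of _ e] bexI[of _ y]) auto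
    next
      case 2
      then have "leaf_adj u c" "leaf_adj u e'" using e'y y'(2) leaf_adj_sym[of e' y] leaf_adj_sym[of c y] by simp_all
      then show ?thesis using eps(2) c(2) by (intro bexI[of _ c] bexI[of _ e']) auto
    next
      case 3
      obtain v where "v \<in> set ps" "leaf_adj e v" using e(1) by blast
      then show ?thesis using 3 c by (intro bexI[of _ v] bexI[of _ c]) auto
    next
      case 4
      obtain v where "v \<in> set ps" "leaf_adj e' v" using e(2) by blast
      then show ?thesis using 4 ny e'y by (intro bexI[of _ v] bexI[of _ y]) auto
    next
      case 5 then show ?thesis using path_two_nbrs[OF ps(2,1) 5] by blast
    qed
  qed
  then show ?thesis using that[OF y'(1) ny y'(2)] by simp
qed

text \<open>
  The ends of the path have heights 3 and 2 over position \<open>k\<close>, so \<open>(k, 2)\<close> is adjacent to the first end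
  and \<open>(k, 3)\<close> to the last, and a neighbour of either of them at or after position \<open>k\<close> is also a
  neighbour of the opposite end. So if one of the two leaves is present, one more leaf completes the
  cycle. The last symbol of the word holds at least two leaves, hence these two are \<open>(k, 2)\<close> and \<open>(k, 3)\<close>.
\<close>

lemma path_closes:
  assumes W: "cyclic_word W" "proper_word W" "W \<noteq> []" "2 \<le> card (last W)"
    and ps: "distinct ps" "successively leaf_adj ps" "2 \<le> length ps" "set ps \<subseteq> word_leaves W"
    and before: "\<And>u. u \<in> word_leaves W \<Longrightarrow> fst u < k \<Longrightarrow> u \<in> set ps"
    and upto: "\<And>u. u \<in> set ps \<Longrightarrow> fst u < k \<or> u = (k, 1)"
    and ends: "snd (hd ps) + k = fst (hd ps) + 3" "snd (last ps) + k = fst (last ps) + 2"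
    and k: "(k, 2) \<in> word_leaves W \<or> (k, 3) \<in> word_leaves W"
  shows "word_leaves W = insert (k, 2) (insert (k, 3) (set ps)) \<and> length W = Suc k"
proof -
  define p q where "p = hd ps" and "q = last ps"
  have "ps \<noteq> []" using ps(3) by auto
  then have pq: "p \<in> set ps" "q \<in> set ps" by (auto simp: p_def q_def)
  have pk: "fst p \<le> k" "snd p + k = fst p + 3" and qk: "fst q \<le> k" "snd q + k = fst q + 2"
    using upto[OF pq(1)] upto[OF pq(2)] ends by (auto simp: p_def q_def)
  have notin: "(k, 2) \<notin> set ps" "(k, 3) \<notin> set ps" using upto by force+
  have new: "k \<le> fst x" if "x \<in> word_leaves W" "x \<notin> set ps" for x
    using before[of x] that by (meson not_le)
  have "\<exists>c x. word_leaves W = insert c (insert x (set ps)) \<and>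
     (c = (k, 2) \<and> x \<in> {(k, 3), (k + 1, 2), (k + 2, 1)} \<or> c = (k, 3) \<and> x \<in> {(k, 2), (k + 1, 1)})"
  proof (cases "(k, 2) \<in> word_leaves W")
    case True
    obtain x where x: "x \<in> word_leaves W" "x \<notin> set ps" "leaf_adj (k, 2) x"
      "word_leaves W = insert (k, 2) (insert x (set ps))"
    proof (rule path_closes_aux[OF W(1) ps, of p q "(k, 2)"])
      show "leaf_adj q x" if "x \<in> word_leaves W" "x \<notin> set ps" "leaf_adj (k, 2) x" for x
        using new[OF that(1,2)] that(3) qk by (auto simp: leaf_adj_def)
    qed (use True notin pk qk in \<open>auto simp: leaf_adj_def p_def q_def\<close>)
    have "x \<in> {(k, 3), (k + 1, 2), (k + 2, 1)}"
      using new[OF x(1,2)] x(3) proper_wordD[OF W(2) x(1)] by (cases x) (auto simp: leaf_adj_def)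
    then show ?thesis using x(4) by (intro exI[of _ "(k, 2)"] exI[of _ x]) simp
  next
    case False
    then have k3: "(k, 3) \<in> word_leaves W" using k by simp
    obtain x where x: "x \<in> word_leaves W" "x \<notin> set ps" "leaf_adj (k, 3) x"
      "word_leaves W = insert (k, 3) (insert x (set ps))"
    proof (rule path_closes_aux[OF W(1) ps, of q p "(k, 3)"])
      show "leaf_adj p x" if "x \<in> word_leaves W" "x \<notin> set ps" "leaf_adj (k, 3) x" for x
        using new[OF that(1,2)] that(3) pk by (auto simp: leaf_adj_def)
    qed (use k3 notin pk qk in \<open>auto simp: leaf_adj_def p_def q_def\<close>)
    have "x \<in> {(k, 2), (k + 1, 1)}"
      using new[OF x(1,2)] x(3) proper_wordD[OF W(2) x(1)] by (cases x) (auto simp: leaf_adj_def)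
    then show ?thesis using x(4) by (intro exI[of _ "(k, 3)"] exI[of _ x]) simp
  qed
  then obtain c x where cx: "word_leaves W = insert c (insert x (set ps))"
     "c = (k, 2) \<and> x \<in> {(k, 3), (k + 1, 2), (k + 2, 1)} \<or> c = (k, 3) \<and> x \<in> {(k, 2), (k + 1, 1)}" by blast
  define m where "m = length W - 1"
  have "card (W ! m) \<ge> 2" using W(3,4) by (simp add: m_def last_conv_nth)
  then obtain r s where "r \<in> W ! m" "s \<in> W ! m" "r \<noteq> s"
    by (metis card_le_Suc0_iff_eq card.infinite not_less_eq_eq numeral_2_eq_2 zero_le)
  then have rs: "(m, r) \<in> word_leaves W" "(m, s) \<in> word_leaves W" "r \<noteq> s"
    using W(3) by (auto simp: word_leaves_def m_def)
  have le_m: "fst u \<le> m" if "u \<in> word_leaves W" for u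
    using that W(3) by (auto simp: word_leaves_def m_def)
  have "m \<le> k"
  proof (rule ccontr)
    assume m: "\<not> m \<le> k"
    have "(m, t) = x" if t: "(m, t) \<in> word_leaves W" for t
    proof -
      have "(m, t) = c \<or> (m, t) = x \<or> (m, t) \<in> set ps" using t unfolding cx(1) by blast
      moreover have "(m, t) \<notin> set ps" using m upto[of "(m, t)"] by auto
      moreover have "fst c = k" using cx(2) by auto
      ultimately show ?thesis using m by auto
    qed
    from this[OF rs(1)] this[OF rs(2)] show False using rs(3) by (metis prod.inject)
  qed
  moreover have "c \<in> word_leaves W" "x \<in> word_leaves W" unfolding cx(1) by blast+
  then have "fst c \<le> m" "fst x \<le> m" by (auto intro: le_m)
  moreover have "fst c = k" using cx(2) by auto
  ultimately have "m = k" "fst x \<le> k" by linarith+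
  from this(2) have "{c, x} = {(k, 2), (k, 3)}" using cx(2) by auto
  then have "insert c (insert x (set ps)) = insert (k, 2) (insert (k, 3) (set ps))" by blast
  moreover have "length W = Suc k" using \<open>m = k\<close> W(3) by (cases W) (simp_all add: m_def)
  ultimately show ?thesis using cx(1) by simp
qed

text \<open>
  Exact counts as propositional formulas: with them a degree condition becomes a premise for
  propositional resolution.
\<close>

fun none_of :: "bool list \<Rightarrow> bool" where
  "none_of [] = True" | "none_of (b # bs) = (\<not> b \<and> none_of bs)"
fun one_of :: "bool list \<Rightarrow> bool" where
  "one_of [] = False" | "one_of (b # bs) = ((b \<and> none_of bs) \<or> (\<not> b \<and> one_of bs))"
fun two_of :: "bool list \<Rightarrow> bool" where
  "two_of [] = False" | "two_of (b # bs) = ((b \<and> one_of bs) \<or> (\<not> b \<and> two_of bs))"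

lemma two_of_iff: "two_of bs \<longleftrightarrow> length (filter (\<lambda>b. b) bs) = 2"
proof -
  have n: "none_of bs \<longleftrightarrow> length (filter (\<lambda>b. b) bs) = 0" for bs by (induction bs) auto
  have o: "one_of bs \<longleftrightarrow> length (filter (\<lambda>b. b) bs) = 1" for bs by (induction bs) (auto simp: n)
  show ?thesis by (induction bs) (auto simp: o)
qed

declare none_of.simps [simp del] one_of.simps [simp del] two_of.simps [simp del]

text \<open>Subtraction truncates, but a truncated candidate is too close to be adjacent.\<close>

definition nearby :: "nat \<times> nat \<Rightarrow> (nat \<times> nat) list" where
  "nearby u = (case u of (i, r) \<Rightarrow> remdups (filter (leaf_adj u)
     [(i + (4 - r), 1), (i + (3 - r), 2), (i + (2 - r), 3), (i - (4 - r), 1), (i - (3 - r), 2), (i - (2 - r), 3)]))"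

lemma two_nearby:
  assumes W: "cyclic_word W" "proper_word W" and u: "u \<in> word_leaves W"
  shows "two_of (map (\<lambda>v. v \<in> word_leaves W) (nearby u))"
proof -
  have "v \<in> set (nearby u)" if "v \<in> word_nbrs W u" for v
  proof -
    have "snd u \<in> {1,2,3}" "snd v \<in> {1,2,3}" "leaf_adj u v"
      using proper_wordD[OF W(2)] u that by (auto simp: nbrs_def)
    moreover obtain i r j s where uv: "u = (i, r)" "v = (j, s)" by (cases u; cases v)
    moreover have "j = i + (5 - r - s) \<or> j = i - (5 - r - s)" "r + s \<le> 5"
      using \<open>leaf_adj u v\<close> unfolding uv leaf_adj_def by auto
    ultimately have "v \<in> set [(i + (4 - r), 1), (i + (3 - r), 2), (i + (2 - r), 3), (i - (4 - r), 1), (i - (3 - r), 2), (i - (2 - r), 3)]"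
      by (elim disjE insertE) simp_all
    with \<open>leaf_adj u v\<close> show ?thesis
      unfolding nearby_def uv prod.case set_remdups set_filter by blast
  qed
  moreover have "leaf_adj u v" if "v \<in> set (nearby u)" for v
    using that by (cases u) (simp only: nearby_def prod.case set_remdups set_filter mem_Collect_eq)
  ultimately have "word_nbrs W u = set (filter (\<lambda>v. v \<in> word_leaves W) (nearby u))"
    unfolding nbrs_def set_filter by blast
  moreover have "distinct (nearby u)" by (cases u) (simp only: nearby_def prod.case distinct_remdups)
  ultimately have "length (filter (\<lambda>v. v \<in> word_leaves W) (nearby u)) = 2"
    using W(1) u by (auto simp: cyclic_on_def distinct_card simp del: set_filter)
  then show ?thesis by (simp add: two_of_iff filter_map comp_def)
qed

text \<open>A Hamiltonian path shows connectedness and turns degrees into a computation on its list of leaves.\<close>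

lemma path_word_facts:
  assumes W: "proper_word W" and xs: "distinct xs" "set xs = word_leaves W" "successively leaf_adj xs"
  shows connected_onI_path: "connected_on (word_leaves W) leaf_adj"
    and card_nbrs_path: "card (word_nbrs W u) = length (filter (leaf_adj u) xs)"
proof -
  have suc: "leaf_adj (xs ! i) (xs ! Suc i)" if "Suc i < length xs" for i
    using xs(3) that by (simp add: successively_conv_nth)
  show "connected_on (word_leaves W) leaf_adj" unfolding connected_on_def
  proof (intro allI impI)
    fix S assume S: "closed_in (word_leaves W) leaf_adj S"
    have step: "xs ! i \<in> S \<longleftrightarrow> xs ! Suc i \<in> S" if "Suc i < length xs" for i
    proof -
      have "u \<in> S \<longleftrightarrow> v \<in> S" if "leaf_adj u v" "u \<in> word_leaves W" "v \<in> word_leaves W" for u v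
        using S that leaf_adj_sym unfolding closed_in_def nbrs_def by blast
      then show ?thesis using suc[OF that] that xs(2) nth_mem by (metis Suc_lessD)
    qed
    have "xs ! i \<in> S \<longleftrightarrow> xs ! 0 \<in> S" if "i < length xs" for i
      using that by (induction i) (use step in auto)
    then have "\<forall>x\<in>set xs. x \<in> S \<longleftrightarrow> xs ! 0 \<in> S" by (metis in_set_conv_nth)
    then show "S = {} \<or> S = word_leaves W" using S xs(2) by (auto simp: closed_in_def)
  qed
  have "word_nbrs W u = set (filter (leaf_adj u) xs)" by (auto simp: nbrs_def xs(2)[symmetric])
  then show "card (word_nbrs W u) = length (filter (leaf_adj u) xs)"
    using xs(1) by (simp add: distinct_card del: set_filter)
qed

lemma card_word_leaves: "\<forall>A\<in>set W. finite A \<Longrightarrow> card (word_leaves W) = spine_size W"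
proof -
  have "word_leaves W = (SIGMA i:{..<length W}. W ! i)" by (auto simp: word_leaves_def)
  then show "\<forall>A\<in>set W. finite A \<Longrightarrow> ?thesis" by (simp add: spine_size_def)
qed

lemma spine_size_eq_sum_list: "spine_size W = sum_list (map card W)"
  by (simp add: spine_size_def sum_list_sum_nth atLeast0LessThan)

lemma set_eq_word_leavesI:
  assumes "proper_word W" "distinct xs" "\<forall>u\<in>set xs. fst u < length W \<and> snd u \<in> W ! fst u"
    "length xs = sum_list (map card W)"
  shows "set xs = word_leaves W"
proof (rule card_subset_eq)
  show "finite (word_leaves W)" by (rule finite_word_leaves[OF assms(1)])
  show "set xs \<subseteq> word_leaves W" using assms(3) by (auto simp: word_leaves_def)
  have "\<forall>A\<in>set W. finite A" using assms(1) by (auto simp: proper_word_def intro: finite_subset)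
  then show "card (set xs) = card (word_leaves W)" using assms by (simp add: distinct_card card_word_leaves spine_size_eq_sum_list)
qed

lemma cyclic_wordI:
  assumes "proper_word W" "distinct xs" "\<forall>u\<in>set xs. fst u < length W \<and> snd u \<in> W ! fst u"
    "length xs = sum_list (map card W)" "successively leaf_adj xs"
    and "\<forall>u\<in>set xs. length (filter (leaf_adj u) xs) = 2"
  shows "cyclic_word W"
  using path_word_facts[OF assms(1,2) set_eq_word_leavesI[OF assms(1-4)] assms(5)] set_eq_word_leavesI[OF assms(1-4)] assms(6)
  by (simp add: cyclic_on_def)

lemma two_endedI:
  assumes "proper_word W" "distinct xs" "\<forall>u\<in>set xs. fst u < length W \<and> snd u \<in> W ! fst u"
    "length xs = sum_list (map card W)" "successively leaf_adj xs"
    and "\<forall>u\<in>set xs. u \<noteq> p \<and> u \<noteq> q \<longrightarrow> length (filter (leaf_adj u) xs) = 2 \<and> 5 \<le> height W u"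
    and "p \<in> set xs" "q \<in> set xs" "length (filter (leaf_adj p) xs) = 1" "length (filter (leaf_adj q) xs) = 1"
    and "height W p = 4" "height W q = 3"
  shows "two_ended W"
  unfolding two_ended_def two_ended_at_def
  using path_word_facts[OF assms(1,2) set_eq_word_leavesI[OF assms(1-4)] assms(5)] set_eq_word_leavesI[OF assms(1-4)] assms
  by (intro exI[of _ p] exI[of _ q]) auto

section \<open>Exploring a word from its left end\<close>

text \<open>The lists are Hamiltonian paths of the leaf graphs; their ends are the leaves of heights 4 and 3.\<close>

lemma two_ended_blocks:
  "b \<in> blocks_B \<Longrightarrow> two_ended ([S23] @ b)"
  "b \<in> blocks_L \<Longrightarrow> two_ended b"
proof -
  have 1: "two_ended [S23, S1, S1, S0]"
    by (rule two_endedI[of _ "[(1, 1), (0, 3), (0, 2), (2, 1)]" "(1, 1)" "(2, 1)"])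
      (simp_all add: leaf_adj_def height_def)
  have 2: "two_ended [S23, S12, S0]"
    by (rule two_endedI[of _ "[(1, 1), (0, 3), (0, 2), (1, 2)]" "(1, 2)" "(1, 1)"])
      (simp_all add: leaf_adj_def height_def)
  have 3: "two_ended [S23, S1, S1, S1, S1, S12, S1, S1, S1, S1, S0]"
    by (rule two_endedI[of _ "[(8, 1), (5, 1), (2, 1), (0, 2), (0, 3), (1, 1), (4, 1), (7, 1), (5, 2), (3, 1), (6, 1), (9, 1)]" "(8, 1)" "(9, 1)"])
      (simp_all add: leaf_adj_def height_def)
  have 4: "two_ended [S23, S1, S13, S1, S0]"
    by (rule two_endedI[of _ "[(2, 1), (0, 2), (0, 3), (1, 1), (2, 3), (3, 1)]" "(2, 1)" "(3, 1)"])
      (simp_all add: leaf_adj_def height_def)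
  have 5: "two_ended [S23, S1, S1, S1, S13, S1, S1, S1, S0]"
    by (rule two_endedI[of _ "[(6, 1), (3, 1), (4, 3), (5, 1), (2, 1), (0, 2), (0, 3), (1, 1), (4, 1), (7, 1)]" "(6, 1)" "(7, 1)"])
      (simp_all add: leaf_adj_def height_def)
  have 6: "two_ended [S123, S13, S1, S1, S1, S0]"
    by (rule two_endedI[of _ "[(3, 1), (0, 1), (1, 3), (2, 1), (0, 2), (0, 3), (1, 1), (4, 1)]" "(3, 1)" "(4, 1)"])
      (simp_all add: leaf_adj_def height_def)
  have 7: "two_ended [S123, S1, S12, S1, S1, S1, S1, S0]"
    by (rule two_endedI[of _ "[(5, 1), (2, 1), (0, 2), (0, 3), (1, 1), (4, 1), (2, 2), (0, 1), (3, 1), (6, 1)]" "(5, 1)" "(6, 1)"])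
      (simp_all add: leaf_adj_def height_def)
  show "b \<in> blocks_B \<Longrightarrow> two_ended ([S23] @ b)" using 1 2 3 4 5 by (auto simp: blocks_B_def)
  show "b \<in> blocks_L \<Longrightarrow> two_ended b" using 6 7 by (auto simp: blocks_L_def)
qed

text \<open>
  The shortest words of each kind, those without a block between their two ends. The lists go once
  around the cycle and start with the two leaves that close it in the last symbol.
\<close>

lemma cyclic_finals:
  "b \<in> blocks_B \<Longrightarrow> cyclic_word ([S23] @ hat b)" "b \<in> blocks_R \<Longrightarrow> cyclic_word ([S23] @ b)"
  "b \<in> blocks_L \<Longrightarrow> cyclic_word (hat b)" "b \<in> blocks_D \<Longrightarrow> cyclic_word b"
proof -
  have 1: "cyclic_word [S23, S1, S1, S23]"
    by (rule cyclic_wordI[of _ "[(3, 3), (3, 2), (1, 1), (0, 3), (0, 2), (2, 1)]"])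
      (simp_all add: leaf_adj_def)
  have 2: "cyclic_word [S23, S12, S23]"
    by (rule cyclic_wordI[of _ "[(2, 3), (2, 2), (1, 2), (0, 2), (0, 3), (1, 1)]"])
      (simp_all add: leaf_adj_def)
  have 3: "cyclic_word [S23, S1, S1, S1, S1, S12, S1, S1, S1, S1, S23]"
    by (rule cyclic_wordI[of _ "[(10, 3), (10, 2), (8, 1), (5, 1), (2, 1), (0, 2), (0, 3), (1, 1), (4, 1), (7, 1), (5, 2), (3, 1), (6, 1), (9, 1)]"])
      (simp_all add: leaf_adj_def)
  have 4: "cyclic_word [S23, S1, S13, S1, S23]"
    by (rule cyclic_wordI[of _ "[(4, 3), (4, 2), (2, 1), (0, 2), (0, 3), (1, 1), (2, 3), (3, 1)]"])
      (simp_all add: leaf_adj_def)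
  have 5: "cyclic_word [S23, S1, S1, S1, S13, S1, S1, S1, S23]"
    by (rule cyclic_wordI[of _ "[(8, 3), (8, 2), (6, 1), (3, 1), (4, 3), (5, 1), (2, 1), (0, 2), (0, 3), (1, 1), (4, 1), (7, 1)]"])
      (simp_all add: leaf_adj_def)
  have 6: "cyclic_word [S23, S1, S1, S1, S13, S123]"
    by (rule cyclic_wordI[of _ "[(5, 3), (5, 2), (3, 1), (4, 3), (5, 1), (2, 1), (0, 2), (0, 3), (1, 1), (4, 1)]"])
      (simp_all add: leaf_adj_def)
  have 7: "cyclic_word [S23, S1, S1, S1, S1, S12, S1, S123]"
    by (rule cyclic_wordI[of _ "[(7, 3), (7, 2), (5, 1), (2, 1), (0, 2), (0, 3), (1, 1), (4, 1), (7, 1), (5, 2), (3, 1), (6, 1)]"])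
      (simp_all add: leaf_adj_def)
  have 8: "cyclic_word [S123, S13, S1, S1, S1, S23]"
    by (rule cyclic_wordI[of _ "[(5, 3), (5, 2), (3, 1), (0, 1), (1, 3), (2, 1), (0, 2), (0, 3), (1, 1), (4, 1)]"])
      (simp_all add: leaf_adj_def)
  have 9: "cyclic_word [S123, S1, S12, S1, S1, S1, S1, S23]"
    by (rule cyclic_wordI[of _ "[(7, 3), (7, 2), (5, 1), (2, 1), (0, 2), (0, 3), (1, 1), (4, 1), (2, 2), (0, 1), (3, 1), (6, 1)]"])
      (simp_all add: leaf_adj_def)
  have 10: "cyclic_word [S123, S13, S123]"
    by (rule cyclic_wordI[of _ "[(2, 3), (2, 2), (0, 1), (1, 3), (2, 1), (0, 2), (0, 3), (1, 1)]"])
      (simp_all add: leaf_adj_def)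
  have 11: "cyclic_word [S123, S1, S12, S1, S123]"
    by (rule cyclic_wordI[of _ "[(4, 3), (4, 2), (2, 1), (0, 2), (0, 3), (1, 1), (4, 1), (2, 2), (0, 1), (3, 1)]"])
      (simp_all add: leaf_adj_def)
  show "b \<in> blocks_B \<Longrightarrow> cyclic_word ([S23] @ hat b)" using 1 2 3 4 5 by (auto simp: blocks_B_def hat_def)
  show "b \<in> blocks_R \<Longrightarrow> cyclic_word ([S23] @ b)" using 6 7 by (auto simp: blocks_R_def)
  show "b \<in> blocks_L \<Longrightarrow> cyclic_word (hat b)" using 8 9 by (auto simp: blocks_L_def hat_def)
  show "b \<in> blocks_D \<Longrightarrow> cyclic_word b" using 10 11 by (auto simp: blocks_D_def)
qed

text \<open>
  A spine ends at a vertex with at least two pendant paths. Without this condition the same tree could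
  be drawn in several ways, since the last pendant path could be counted as part of the spine.
\<close>

definition admissible :: "spine_word \<Rightarrow> bool" where
  "admissible W \<longleftrightarrow> cyclic_word W \<and> proper_word W \<and> W \<noteq> [] \<and> 2 \<le> card (last W)"

text \<open>
  The leaves \<open>P\<close> at the positions from \<open>i\<close> on begin like the word \<open>U\<close>. The recursion unfolds into literals
  for propositional reasoning.
\<close>

fun matches :: "nat \<Rightarrow> spine_word \<Rightarrow> (nat \<times> nat \<Rightarrow> bool) \<Rightarrow> bool" where
  "matches i [] P \<longleftrightarrow> True"
| "matches i (A # U) P \<longleftrightarrow> (P (i, 1) \<longleftrightarrow> 1 \<in> A) \<and> (P (i, 2) \<longleftrightarrow> 2 \<in> A) \<and> (P (i, 3) \<longleftrightarrow> 3 \<in> A) \<and> matches (i + 1) U P"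

lemma matches_iff:
  "matches i U P \<longleftrightarrow> (\<forall>j<length U. \<forall>r\<in>{1,2,3}. P (i + j, r) \<longleftrightarrow> r \<in> U ! j)"
proof (induction i U P rule: matches.induct)
  case (2 i A U P)
  have "(\<forall>j<length (A # U). Q j) \<longleftrightarrow> Q 0 \<and> (\<forall>j<length U. Q (Suc j))" for Q
    by (auto simp: less_Suc_eq_0_disj)
  then show ?case using 2 by simp
qed simp

lemma matches_prefix:
  assumes W: "proper_word W" and U: "proper_word U" and m: "matches 0 U (\<lambda>u. u \<in> word_leaves W)"
    and more: "(length U, 1) \<in> word_leaves W"
  obtains V where "W = U @ V" "V \<noteq> []"
proof -
  have len: "length U < length W" using more by (auto simp: word_leaves_def)
  have "take (length U) W = U"
  proof (rule nth_equalityI)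
    fix i assume "i < length (take (length U) W)"
    then have i: "i < length U" "i < length W" using len by auto
    have "W ! i \<subseteq> {1,2,3}" "U ! i \<subseteq> {1,2,3}"
      using W U i unfolding proper_word_def by simp_all
    moreover have "r \<in> W ! i \<longleftrightarrow> r \<in> U ! i" if "r \<in> {1,2,3}" for r
      using m that i unfolding matches_iff word_leaves_def by auto
    ultimately have "W ! i = U ! i" by blast
    then show "take (length U) W ! i = U ! i" using i by simp
  qed (use len in simp)
  then have "W = U @ drop (length U) W" by (metis append_take_drop_id)
  moreover have "drop (length U) W \<noteq> []" using len by simp
  ultimately show ?thesis using that by blast
qed

text \<open>
  Closing a path for a concrete word \<open>F\<close>: a word that agrees with \<open>F\<close> before position \<open>k\<close>, has the
  leaf \<open>(k, 1)\<close> if \<open>F\<close> does, and has a leaf of length 2 or 3 at \<open>k\<close>, is \<open>F\<close>. The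
  list \<open>xs\<close> runs around the cycle of \<open>F\<close>; without its first two leaves it is the path that gets closed.
\<close>

lemma matches_closing_word:
  assumes W: "admissible W" and F: "proper_word F" "length F = Suc k"
    and xs: "distinct xs" "successively leaf_adj xs" "\<forall>u\<in>set xs. fst u < length F \<and> snd u \<in> F ! fst u"
      "length xs = sum_list (map card F)" "take 2 xs = [(k, 3), (k, 2)]" "4 \<le> length xs" "leaf_adj (last xs) (hd xs)"
    and m: "matches 0 (butlast F) (\<lambda>u. u \<in> word_leaves W)" "1 \<in> last F \<longrightarrow> (k, 1) \<in> word_leaves W"
    and k: "(k, 2) \<in> word_leaves W \<or> (k, 3) \<in> word_leaves W"
  shows "W = F"
proof -
  define ps where "ps = drop 2 xs"
  have xs_eq: "xs = (k, 3) # (k, 2) # ps"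
    using append_take_drop_id[of 2 xs] xs(5) by (simp add: ps_def)
  have setF: "set xs = word_leaves F" by (rule set_eq_word_leavesI[OF F(1) xs(1,3,4)])
  have lastF: "last F = F ! k" using F(2) by (cases F rule: rev_cases) (auto simp: nth_append)
  have agree: "u \<in> word_leaves W \<longleftrightarrow> u \<in> word_leaves F" if "fst u < k" "snd u \<in> {1,2,3}" for u
    using m(1) F(2) that unfolding matches_iff word_leaves_def
    by (cases u) (auto simp: nth_butlast)
  have pW: "proper_word W" using W by (simp add: admissible_def)
  have before: "u \<in> word_leaves W \<longleftrightarrow> u \<in> word_leaves F" if u: "fst u < k" for u
  proof (cases "snd u \<in> {1,2,3}")
    case True then show ?thesis by (rule agree[OF u])
  next
    case False
    have "u \<notin> word_leaves W" by (rule notI, drule proper_wordD[OF pW]) (rule notE[OF False])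
    moreover have "u \<notin> word_leaves F" by (rule notI, drule proper_wordD[OF F(1)]) (rule notE[OF False])
    ultimately show ?thesis by simp
  qed
  have leavesF: "word_leaves F = insert (k, 2) (insert (k, 3) (set ps))"
    unfolding setF[symmetric] xs_eq by (simp add: insert_commute)
  have dist: "distinct ps" "(k, 2) \<notin> set ps" "(k, 3) \<notin> set ps"
    using xs(1) unfolding xs_eq by simp_all
  have upto: "fst u < k \<or> u = (k, 1)" if u: "u \<in> set ps" for u
  proof -
    obtain i r where ir: "u = (i, r)" by (cases u)
    have uF: "u \<in> word_leaves F" unfolding leavesF using u by simp
    then have "i \<le> k" using F(2) by (simp add: ir word_leaves_def)
    moreover have "r \<in> {1,2,3}" using proper_wordD[OF F(1) uF] by (simp add: ir)
    moreover have "u \<noteq> (k, 2)" "u \<noteq> (k, 3)" using u dist by metis+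
    ultimately show ?thesis unfolding ir by (elim insertE) auto
  qed
  have "word_leaves W = insert (k, 2) (insert (k, 3) (set ps)) \<and> length W = Suc k"
  proof (rule path_closes)
    show "cyclic_word W" "proper_word W" "W \<noteq> []" "2 \<le> card (last W)" using W by (auto simp: admissible_def)
    show "distinct ps" by (rule dist(1))
    show "2 \<le> length ps" using xs(6) unfolding xs_eq by simp
    show "successively leaf_adj ps" using xs(2) unfolding xs_eq by (cases ps) simp_all
    show "set ps \<subseteq> word_leaves W"
    proof
      fix u assume u: "u \<in> set ps"
      then have uF: "u \<in> word_leaves F" unfolding leavesF by simp
      from upto[OF u] show "u \<in> word_leaves W"
      proof
        assume u1: "u = (k, 1)"
        then have "1 \<in> last F" using uF lastF by (simp add: word_leaves_def)
        then show ?thesis using m(2) u1 by simp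
      next
        assume "fst u < k"
        then show ?thesis using before uF by simp
      qed
    qed
    show "u \<in> set ps" if "u \<in> word_leaves W" "fst u < k" for u
    proof -
      have "u \<in> insert (k, 2) (insert (k, 3) (set ps))" using before that leavesF by simp
      then show ?thesis using that(2) by (elim insertE) simp_all
    qed
    have ne: "ps \<noteq> []" using xs(6) unfolding xs_eq by auto
    then have "hd ps \<in> set ps" "last ps \<in> set ps" by simp_all
    then have "fst (hd ps) \<le> k" "fst (last ps) \<le> k" by (auto dest!: upto)
    moreover have "leaf_adj (k, 2) (hd ps)" "leaf_adj (last ps) (k, 3)"
      using xs(2,7) ne unfolding xs_eq by (cases ps; simp)+
    ultimately show "snd (hd ps) + k = fst (hd ps) + 3" "snd (last ps) + k = fst (last ps) + 2"
      by (auto simp: leaf_adj_def)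
  qed (use k upto in simp_all)
  then show ?thesis using F(2) leavesF by (intro word_eqI) simp_all
qed

text \<open>The degrees of the leaves up to position 11 suffice for the exploration of words from the left.\<close>

lemma two_nearby_numerals:
  assumes "admissible W"
  shows "\<forall>i\<in>{0,1,2,3,4,5,6,7,8,9,10,11}. \<forall>r\<in>{1,2,3}. (i, r) \<in> word_leaves W \<longrightarrow>
    two_of (map (\<lambda>v. v \<in> word_leaves W) (nearby (i, r)))"
  using two_nearby assms unfolding admissible_def by blast

text \<open>
  The exploration from the left is a propositional problem about which leaves are present. The facts \<open>c1\<close>
  to \<open>c7\<close> express that a path which can be closed at position \<open>k\<close> is closed only in a complete word; the
  degree conditions leave no other continuation than a block, after which some leaf follows because
  the end of height 4 still lacks a neighbour.
\<close>

lemma admissible_S23: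
  assumes W: "admissible W" and start: "matches 0 [S23] (\<lambda>u. u \<in> word_leaves W)"
    and final: "W \<notin> (\<lambda>b. S23 # b) ` (hat ` blocks_B \<union> blocks_R)"
  shows "\<exists>b\<in>blocks_B. \<exists>V. V \<noteq> [] \<and> W = S23 # b @ V"
proof -
  let ?P = "\<lambda>u. u \<in> word_leaves W"
  have final: "W \<notin> {[S23, S1, S1, S23],
      [S23, S12, S23],
      [S23, S1, S1, S1, S1, S12, S1, S1, S1, S1, S23],
      [S23, S1, S13, S1, S23],
      [S23, S1, S1, S1, S13, S1, S1, S1, S23],
      [S23, S1, S1, S1, S13, S123],
      [S23, S1, S1, S1, S1, S12, S1, S123]}"
    using final by (auto simp: blocks_B_def blocks_R_def blocks_L_def blocks_D_def hat_def)
  have c1: "\<not> (matches 0 [S23, S1, S1] ?P \<and> (?P (3, 2) \<or> ?P (3, 3)))"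
    using matches_closing_word[OF W, of "[S23, S1, S1, S23]" 3 "[(3, 3), (3, 2), (1, 1), (0, 3), (0, 2), (2, 1)]"] final
    by (auto simp: leaf_adj_def simp del: matches.simps)
  have c2: "\<not> (matches 0 [S23, S12] ?P \<and> (?P (2, 2) \<or> ?P (2, 3)))"
    using matches_closing_word[OF W, of "[S23, S12, S23]" 2 "[(2, 3), (2, 2), (1, 2), (0, 2), (0, 3), (1, 1)]"] final
    by (auto simp: leaf_adj_def simp del: matches.simps)
  have c3: "\<not> (matches 0 [S23, S1, S1, S1, S1, S12, S1, S1, S1, S1] ?P \<and> (?P (10, 2) \<or> ?P (10, 3)))"
    using matches_closing_word[OF W, of "[S23, S1, S1, S1, S1, S12, S1, S1, S1, S1, S23]" 10 "[(10, 3), (10, 2), (8, 1), (5, 1), (2, 1), (0, 2), (0, 3), (1, 1), (4, 1), (7, 1), (5, 2), (3, 1), (6, 1), (9, 1)]"] final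
    by (auto simp: leaf_adj_def simp del: matches.simps)
  have c4: "\<not> (matches 0 [S23, S1, S13, S1] ?P \<and> (?P (4, 2) \<or> ?P (4, 3)))"
    using matches_closing_word[OF W, of "[S23, S1, S13, S1, S23]" 4 "[(4, 3), (4, 2), (2, 1), (0, 2), (0, 3), (1, 1), (2, 3), (3, 1)]"] final
    by (auto simp: leaf_adj_def simp del: matches.simps)
  have c5: "\<not> (matches 0 [S23, S1, S1, S1, S13, S1, S1, S1] ?P \<and> (?P (8, 2) \<or> ?P (8, 3)))"
    using matches_closing_word[OF W, of "[S23, S1, S1, S1, S13, S1, S1, S1, S23]" 8 "[(8, 3), (8, 2), (6, 1), (3, 1), (4, 3), (5, 1), (2, 1), (0, 2), (0, 3), (1, 1), (4, 1), (7, 1)]"] final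
    by (auto simp: leaf_adj_def simp del: matches.simps)
  have c6: "\<not> (matches 0 [S23, S1, S1, S1, S13] ?P \<and> ?P (5, 1) \<and> (?P (5, 2) \<or> ?P (5, 3)))"
    using matches_closing_word[OF W, of "[S23, S1, S1, S1, S13, S123]" 5 "[(5, 3), (5, 2), (3, 1), (4, 3), (5, 1), (2, 1), (0, 2), (0, 3), (1, 1), (4, 1)]"] final
    by (auto simp: leaf_adj_def simp del: matches.simps)
  have c7: "\<not> (matches 0 [S23, S1, S1, S1, S1, S12, S1] ?P \<and> ?P (7, 1) \<and> (?P (7, 2) \<or> ?P (7, 3)))"
    using matches_closing_word[OF W, of "[S23, S1, S1, S1, S1, S12, S1, S123]" 7 "[(7, 3), (7, 2), (5, 1), (2, 1), (0, 2), (0, 3), (1, 1), (4, 1), (7, 1), (5, 2), (3, 1), (6, 1)]"] final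
    by (auto simp: leaf_adj_def simp del: matches.simps)
  have "matches 0 (S23 # [S1, S1, S0]) ?P \<and> ?P (length (S23 # [S1, S1, S0]), 1) \<or>
      matches 0 (S23 # [S12, S0]) ?P \<and> ?P (length (S23 # [S12, S0]), 1) \<or>
      matches 0 (S23 # [S1, S1, S1, S1, S12, S1, S1, S1, S1, S0]) ?P \<and> ?P (length (S23 # [S1, S1, S1, S1, S12, S1, S1, S1, S1, S0]), 1) \<or>
      matches 0 (S23 # [S1, S13, S1, S0]) ?P \<and> ?P (length (S23 # [S1, S13, S1, S0]), 1) \<or>
      matches 0 (S23 # [S1, S1, S1, S13, S1, S1, S1, S0]) ?P \<and> ?P (length (S23 # [S1, S1, S1, S13, S1, S1, S1, S0]), 1)"
    using two_nearby_numerals[OF W] start c1 c2 c3 c4 c5 c6 c7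
    by (simp add: nearby_def leaf_adj_def,
        simp only: One_nat_def[symmetric] Suc_1 Suc_numeral add_num_simps two_of.simps one_of.simps none_of.simps,
        satx)
  then have "\<exists>b\<in>blocks_B. matches 0 (S23 # b) ?P \<and> ?P (length (S23 # b), 1)"
    unfolding blocks_B_def by (simp del: matches.simps list.size)
  then obtain b where b: "b \<in> blocks_B" "matches 0 (S23 # b) ?P" "?P (length (S23 # b), 1)" by blast
  have "proper_word W" "proper_word (S23 # b)" using W b(1) by (auto simp: admissible_def blocks_B_def)
  then obtain V where "W = (S23 # b) @ V" "V \<noteq> []" using b(2,3) by (rule matches_prefix)
  then show ?thesis using b(1) by auto
qed

text \<open>The same exploration for the other possible first symbol.\<close>

lemma admissible_S123:
  assumes W: "admissible W" and start: "matches 0 [S123] (\<lambda>u. u \<in> word_leaves W)"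
    and final: "W \<notin> hat ` blocks_L \<union> blocks_D"
  shows "\<exists>b\<in>blocks_L. \<exists>V. V \<noteq> [] \<and> W = b @ V"
proof -
  let ?P = "\<lambda>u. u \<in> word_leaves W"
  have final: "W \<notin> {[S123, S13, S1, S1, S1, S23],
      [S123, S1, S12, S1, S1, S1, S1, S23],
      [S123, S13, S123],
      [S123, S1, S12, S1, S123]}"
    using final by (auto simp: blocks_B_def blocks_R_def blocks_L_def blocks_D_def hat_def)
  have c1: "\<not> (matches 0 [S123, S13, S1, S1, S1] ?P \<and> (?P (5, 2) \<or> ?P (5, 3)))"
    using matches_closing_word[OF W, of "[S123, S13, S1, S1, S1, S23]" 5 "[(5, 3), (5, 2), (3, 1), (0, 1), (1, 3), (2, 1), (0, 2), (0, 3), (1, 1), (4, 1)]"] final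
    by (auto simp: leaf_adj_def simp del: matches.simps)
  have c2: "\<not> (matches 0 [S123, S1, S12, S1, S1, S1, S1] ?P \<and> (?P (7, 2) \<or> ?P (7, 3)))"
    using matches_closing_word[OF W, of "[S123, S1, S12, S1, S1, S1, S1, S23]" 7 "[(7, 3), (7, 2), (5, 1), (2, 1), (0, 2), (0, 3), (1, 1), (4, 1), (2, 2), (0, 1), (3, 1), (6, 1)]"] final
    by (auto simp: leaf_adj_def simp del: matches.simps)
  have c3: "\<not> (matches 0 [S123, S13] ?P \<and> ?P (2, 1) \<and> (?P (2, 2) \<or> ?P (2, 3)))"
    using matches_closing_word[OF W, of "[S123, S13, S123]" 2 "[(2, 3), (2, 2), (0, 1), (1, 3), (2, 1), (0, 2), (0, 3), (1, 1)]"] final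
    by (auto simp: leaf_adj_def simp del: matches.simps)
  have c4: "\<not> (matches 0 [S123, S1, S12, S1] ?P \<and> ?P (4, 1) \<and> (?P (4, 2) \<or> ?P (4, 3)))"
    using matches_closing_word[OF W, of "[S123, S1, S12, S1, S123]" 4 "[(4, 3), (4, 2), (2, 1), (0, 2), (0, 3), (1, 1), (4, 1), (2, 2), (0, 1), (3, 1)]"] final
    by (auto simp: leaf_adj_def simp del: matches.simps)
  have "matches 0 ([S123, S13, S1, S1, S1, S0]) ?P \<and> ?P (length ([S123, S13, S1, S1, S1, S0]), 1) \<or>
      matches 0 ([S123, S1, S12, S1, S1, S1, S1, S0]) ?P \<and> ?P (length ([S123, S1, S12, S1, S1, S1, S1, S0]), 1)"
    using two_nearby_numerals[OF W] start c1 c2 c3 c4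
    by (simp add: nearby_def leaf_adj_def,
        simp only: One_nat_def[symmetric] Suc_1 Suc_numeral add_num_simps two_of.simps one_of.simps none_of.simps,
        satx)
  then have "\<exists>b\<in>blocks_L. matches 0 (b) ?P \<and> ?P (length (b), 1)"
    unfolding blocks_L_def by (simp del: matches.simps list.size)
  then obtain b where b: "b \<in> blocks_L" "matches 0 (b) ?P" "?P (length (b), 1)" by blast
  have "proper_word W" "proper_word (b)" using W b(1) by (auto simp: admissible_def blocks_L_def)
  then obtain V where "W = (b) @ V" "V \<noteq> []" using b(2,3) by (rule matches_prefix)
  then show ?thesis using b(1) by auto
qed

text \<open>For the first symbols \<open>12\<close> and \<open>13\<close> the degree conditions alone are contradictory.\<close>

lemma not_admissible_S12:
  assumes W: "admissible W" and start: "matches 0 [S12] (\<lambda>u. u \<in> word_leaves W)"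
  shows "False"
proof -
  let ?P = "\<lambda>u. u \<in> word_leaves W"
  have "False"
    using two_nearby_numerals[OF W] start 
    by (simp add: nearby_def leaf_adj_def,
        simp only: One_nat_def[symmetric] Suc_1 Suc_numeral add_num_simps two_of.simps one_of.simps none_of.simps,
        satx)
  then show ?thesis .
qed

lemma not_admissible_S13:
  assumes W: "admissible W" and start: "matches 0 [S13] (\<lambda>u. u \<in> word_leaves W)"
  shows "False"
proof -
  let ?P = "\<lambda>u. u \<in> word_leaves W"
  have "False"
    using two_nearby_numerals[OF W] start 
    by (simp add: nearby_def leaf_adj_def,
        simp only: One_nat_def[symmetric] Suc_1 Suc_numeral add_num_simps two_of.simps one_of.simps none_of.simps,
        satx)
  then show ?thesis .
qed

section \<open>The language of cyclic words\<close>

lemma lang_starI: "set ws \<subseteq> K \<Longrightarrow> concat ws \<in> lang_star K"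
  by (auto simp: lang_star_def)

lemma lang_star_append: "b \<in> K \<Longrightarrow> u \<in> lang_star K \<Longrightarrow> b @ u \<in> lang_star K"
  unfolding lang_star_def by (force intro: exI[of _ "b # _"])

lemma Nil_in_lang_star: "[] \<in> lang_star K"
  using lang_starI[of "[]"] by simp

lemma lang_concI: "u \<in> K \<Longrightarrow> v \<in> L \<Longrightarrow> u @ v \<in> K \<odot> L"
  by (auto simp: lang_conc_def)

abbreviation tails :: "spine_word set" where
  "tails \<equiv> lang_star blocks_B \<odot> (hat ` blocks_B \<union> blocks_R)"

lemma proper_blocks:
  "b \<in> blocks_L \<Longrightarrow> proper_word (hat b)" "b \<in> blocks_D \<Longrightarrow> proper_word b"
  by (auto simp: blocks_L_def blocks_D_def hat_def)

text \<open>A two-ended prefix can be cut off and replaced by \<open>23\<close>, which makes induction on the length possible.\<close>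

lemma admissible_replace_prefix:
  assumes "admissible (U @ V)" "two_ended U" "V \<noteq> []"
  shows "admissible (S23 # V)"
proof -
  have "proper_word V" using assms(1) by (simp add: admissible_def)
  then have "cyclic_word (S23 # V)"
    using cyclic_word_append[OF assms(2)] assms(1) by (simp add: admissible_def completes_def)
  then show ?thesis using assms by (simp add: admissible_def)
qed

lemma admissible_S23_tails: "admissible (S23 # V) \<Longrightarrow> V \<in> tails"
proof (induction "length V" arbitrary: V rule: less_induct)
  case less
  show ?case
  proof (cases "V \<in> hat ` blocks_B \<union> blocks_R")
    case True
    then show ?thesis using lang_concI[OF Nil_in_lang_star, of V] by simp
  next
    case False
    have "matches 0 [S23] (\<lambda>u. u \<in> word_leaves (S23 # V))"
      by (auto simp: word_leaves_def)
    moreover have "S23 # V \<notin> (\<lambda>b. S23 # b) ` (hat ` blocks_B \<union> blocks_R)" using False by blast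
    ultimately obtain b V' where b: "b \<in> blocks_B" "V' \<noteq> []" "V = b @ V'"
      using admissible_S23[OF less.prems] by auto
    have "two_ended (S23 # b)" using two_ended_blocks(1)[OF b(1)] by simp
    then have "admissible (S23 # V')" using admissible_replace_prefix[of "S23 # b" V'] less.prems b by simp
    moreover have "length V' < length V" using b by (auto simp: blocks_B_def)
    ultimately have "V' \<in> tails" using less.hyps by blast
    then obtain u v where "u \<in> lang_star blocks_B" "v \<in> hat ` blocks_B \<union> blocks_R" "V' = u @ v"
      by (auto simp: lang_conc_def)
    then show ?thesis using lang_concI[OF lang_star_append[OF b(1)], of u v] b by simp
  qed
qed

lemma tails_iff: "V \<in> tails \<longleftrightarrow> V \<in> lang_star blocks_B \<odot> hat ` blocks_B \<or> V \<in> lang_star blocks_B \<odot> blocks_R"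
  by (auto simp: lang_conc_def)

lemma lang_conc_Cons: "S23 # V \<in> {[S23]} \<odot> L \<longleftrightarrow> V \<in> L"
  by (auto simp: lang_conc_def)

lemma two_of_three:
  assumes "A \<subseteq> {1,2,3::nat}" "2 \<le> card A"
  shows "A = S12 \<or> A = S13 \<or> A = S23 \<or> A = S123"
proof -
  have "\<not> A \<subseteq> {x}" for x using assms(2) card_mono[of "{x}" A] by auto
  then have n: "1 \<in> A \<or> 2 \<in> A" "1 \<in> A \<or> 3 \<in> A" "2 \<in> A \<or> 3 \<in> A"
    using assms(1) by blast+
  show ?thesis
  proof (cases "1 \<in> A \<and> 2 \<in> A \<and> 3 \<in> A")
    case True then have "A = S123" using assms(1) by blast
    then show ?thesis by simp
  next
    case False
    with n consider "1 \<in> A" "2 \<in> A" "3 \<notin> A" | "1 \<in> A" "2 \<notin> A" "3 \<in> A" | "1 \<notin> A" "2 \<in> A" "3 \<in> A"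
      by blast
    then show ?thesis
    proof cases
      case 1 then have "A = S12" using assms(1) by blast
      then show ?thesis by simp
    next
      case 2 then have "A = S13" using assms(1) by blast
      then show ?thesis by simp
    next
      case 3 then have "A = S23" using assms(1) by blast
      then show ?thesis by simp
    qed
  qed
qed

theorem admissible_in_language:
  assumes W: "admissible W" and hd: "2 \<le> card (hd W)"
  shows "W \<in> lang_N \<union> lang_X"
proof -
  have A: "hd W \<subseteq> {1,2,3}" using W by (cases W) (auto simp: admissible_def)
  have m: "matches 0 [hd W] (\<lambda>u. u \<in> word_leaves W)"
    using W by (cases W) (auto simp: admissible_def word_leaves_def)
  consider "hd W = S12" | "hd W = S13" | "hd W = S23" | "hd W = S123"
    using two_of_three[OF A hd] by blast
  then show ?thesis
  proof cases
    case 1 then show ?thesis using not_admissible_S12[OF W] m by simp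
  next
    case 2 then show ?thesis using not_admissible_S13[OF W] m by simp
  next
    case 3
    then obtain V where V: "W = S23 # V" using W by (cases W) (auto simp: admissible_def)
    then have "V \<in> tails" using admissible_S23_tails W by simp
    then show ?thesis unfolding tails_iff lang_N_def lang_X_def V using lang_conc_Cons by blast
  next
    case 4
    show ?thesis
    proof (cases "W \<in> hat ` blocks_L \<union> blocks_D")
      case True then show ?thesis unfolding lang_X_def by blast
    next
      case False
      then obtain b V where b: "b \<in> blocks_L" "V \<noteq> []" "W = b @ V"
        using admissible_S123[OF W] m 4 by auto
      then have "V \<in> tails"
        using admissible_replace_prefix[of b V] two_ended_blocks(2) W admissible_S23_tails by simp
      then show ?thesis unfolding tails_iff lang_X_def b(3) using lang_concI[OF b(1)] by blast
    qed
  qed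
qed

lemma two_ended_lang_star:
  assumes "two_ended U" "u \<in> lang_star blocks_B"
  shows "two_ended (U @ u)"
proof -
  obtain ws where "u = concat ws" "set ws \<subseteq> blocks_B" using assms(2) by (auto simp: lang_star_def)
  moreover have "two_ended (U @ concat ws)" if "set ws \<subseteq> blocks_B" for ws
    using that assms(1)
  proof (induction ws arbitrary: U)
    case (Cons b ws)
    then have "b \<in> blocks_B" by simp
    then have "2 \<le> length b" by (auto simp: blocks_B_def)
    then have "two_ended (U @ b)" using two_ended_append[OF Cons.prems(2)] two_ended_blocks(1)[OF \<open>b \<in> blocks_B\<close>] by blast
    then show ?case using Cons.IH[of "U @ b"] Cons.prems by simp
  qed simp
  ultimately show ?thesis by simp
qed

lemma two_ended_proper: "two_ended U \<Longrightarrow> proper_word U"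
  by (auto simp: two_ended_def two_ended_at_def)

lemma cyclic_tails:
  assumes U: "two_ended U" and V: "V \<in> tails"
  shows "cyclic_word (U @ V)" "proper_word (U @ V)" "2 \<le> card (last (U @ V))" "V \<noteq> []"
proof -
  obtain u v where uv: "u \<in> lang_star blocks_B" "v \<in> hat ` blocks_B \<union> blocks_R" "V = u @ v"
    using V by (auto simp: lang_conc_def)
  have Uu: "two_ended (U @ u)" by (rule two_ended_lang_star[OF U uv(1)])
  have v: "proper_word v" "2 \<le> card (last v)" "v \<noteq> []"
    using uv(2) by (auto simp: blocks_B_def blocks_R_def hat_def)
  have "completes v" using uv(2) cyclic_finals(1,2) unfolding completes_def by blast
  then show "cyclic_word (U @ V)" using cyclic_word_append[OF Uu v(1)] uv(3) by simp
  show "proper_word (U @ V)" using two_ended_proper[OF Uu] v uv(3) by simp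
  show "2 \<le> card (last (U @ V))" "V \<noteq> []" using v uv(3) by auto
qed

theorem language_cyclic:
  assumes "W \<in> lang_N \<union> lang_X"
  shows "cyclic_word W \<and> proper_word W \<and> 2 \<le> length W \<and> 2 \<le> card (hd W) \<and> 2 \<le> card (last W)"
proof -
  consider (tail) U V where "W = U @ V" "U = [S23] \<or> U \<in> blocks_L" "V \<in> tails"
    | (hatL) b where "b \<in> blocks_L" "W = hat b" | (D) "W \<in> blocks_D"
    using assms unfolding lang_N_def lang_X_def tails_iff lang_conc_def by blast
  then show ?thesis
  proof cases
    case tail
    have U: "two_ended U" using tail(2) two_ended_blocks(2) two_ended_S23 by (auto simp: two_ended_def)
    have "U \<noteq> []" "2 \<le> card (hd U)" using tail(2) by (auto simp: blocks_L_def)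
    then show ?thesis using cyclic_tails[OF U tail(3)] tail(1) by (cases U; cases V) auto
  next
    case hatL
    have "cyclic_word W" "proper_word W" using hatL cyclic_finals(3) proper_blocks(1) by simp_all
    moreover have "2 \<le> length W \<and> 2 \<le> card (hd W) \<and> 2 \<le> card (last W)"
      using hatL by (auto simp: blocks_L_def hat_def)
    ultimately show ?thesis by simp
  next
    case D
    have "cyclic_word W" "proper_word W" using D cyclic_finals(4) proper_blocks(2) by simp_all
    moreover have "2 \<le> length W \<and> 2 \<le> card (hd W) \<and> 2 \<le> card (last W)"
      using D by (auto simp: blocks_D_def)
    ultimately show ?thesis by simp
  qed
qed

section \<open>Trees as relations\<close>

definition rdist :: "'v rel \<Rightarrow> 'v \<Rightarrow> 'v \<Rightarrow> nat" where
  "rdist E u v = (LEAST n. (u, v) \<in> E ^^ n)"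

text \<open>
  A tree as a symmetric relation. Acyclicity is stated in the form that every edge is a bridge, because
  the proofs work with the two sides of an edge, and because this form is invariant under isomorphism.
\<close>

locale rel_tree =
  fixes V :: "'v set" and E :: "'v rel"
  assumes finite_V: "finite V" and V_nonempty: "V \<noteq> {}" and E_sub: "E \<subseteq> V \<times> V"
    and sym_E: "(x, y) \<in> E \<Longrightarrow> (y, x) \<in> E" and irrefl_E: "(x, x) \<notin> E"
    and connected_V: "u \<in> V \<Longrightarrow> v \<in> V \<Longrightarrow> (u, v) \<in> E\<^sup>*"
    and bridge: "(x, y) \<in> E \<Longrightarrow> (x, y) \<notin> (E - {(x, y), (y, x)})\<^sup>*"
begin

abbreviation d :: "'v \<Rightarrow> 'v \<Rightarrow> nat" where "d \<equiv> rdist E"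

text \<open>The branch at \<open>x\<close> that starts with \<open>y\<close>: the component of \<open>y\<close> after removal of the edge.\<close>

definition side :: "'v \<Rightarrow> 'v \<Rightarrow> 'v set" where
  "side x y = {v. (y, v) \<in> (E - {(x, y), (y, x)})\<^sup>*}"

lemma E_V: "(x, y) \<in> E \<Longrightarrow> x \<in> V" "(x, y) \<in> E \<Longrightarrow> y \<in> V"
  using E_sub by auto

lemma E_neq: "(x, y) \<in> E \<Longrightarrow> x \<noteq> y"
  using irrefl_E by auto

lemma cut_sym: "(a, b) \<in> (E - {(x, y), (y, x)})\<^sup>* \<Longrightarrow> (b, a) \<in> (E - {(x, y), (y, x)})\<^sup>*"
proof -
  have "sym (E - {(x, y), (y, x)})" using sym_E by (auto simp: sym_def)
  then show "(a, b) \<in> (E - {(x, y), (y, x)})\<^sup>* \<Longrightarrow> (b, a) \<in> (E - {(x, y), (y, x)})\<^sup>*"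
    by (meson symE sym_rtrancl)
qed

lemma side_self [simp]: "y \<in> side x y"
  by (simp add: side_def)

lemma swap_cut: "E - {(y, x), (x, y)} = E - {(x, y), (y, x)}"
  by auto

lemma side_disjoint:
  assumes "(x, y) \<in> E" shows "side x y \<inter> side y x = {}"
proof (rule ccontr)
  assume "\<not> ?thesis"
  then obtain v where "(y, v) \<in> (E - {(x, y), (y, x)})\<^sup>*" "(x, v) \<in> (E - {(x, y), (y, x)})\<^sup>*"
    by (auto simp: side_def swap_cut)
  then have "(x, y) \<in> (E - {(x, y), (y, x)})\<^sup>*" using cut_sym rtrancl_trans by metis
  then show False using bridge[OF assms] by simp
qed

lemma side_step:
  assumes "a \<in> side x y" "(a, b) \<in> E" "(a, b) \<noteq> (x, y)" "(a, b) \<noteq> (y, x)"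
  shows "b \<in> side x y"
  using assms unfolding side_def by (auto intro: rtrancl_into_rtrancl)

lemma side_union:
  assumes "(x, y) \<in> E" shows "side x y \<union> side y x = V"
proof
  have "v \<in> V" if "(a, v) \<in> (E - S)\<^sup>*" "a \<in> V" for a v S
    using that by (induction rule: rtrancl_induct) (auto dest: E_V)
  then show "side x y \<union> side y x \<subseteq> V" using E_V[OF assms] by (auto simp: side_def)
  show "V \<subseteq> side x y \<union> side y x"
  proof
    fix v assume "v \<in> V"
    then have "(x, v) \<in> E\<^sup>*" using connected_V E_V[OF assms] by blast
    then show "v \<in> side x y \<union> side y x"
    proof (induction rule: rtrancl_induct)
      case (step a b)
      then show ?case
        using side_step[of a x y b] side_step[of a y x b] side_self[of y x] side_self[of x y] by blast
    qed simp
  qed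
qed

lemma side_V: "(x, y) \<in> E \<Longrightarrow> side x y \<subseteq> V"
  using side_union by blast

lemma relpow_finite: "u \<in> V \<Longrightarrow> v \<in> V \<Longrightarrow> (u, v) \<in> E ^^ d u v"
  unfolding rdist_def using connected_V[of u v] by (metis LeastI_ex rtrancl_imp_relpow)

lemma d_le: "(u, v) \<in> E ^^ n \<Longrightarrow> d u v \<le> n"
  unfolding rdist_def by (rule Least_le)

lemma d_self [simp]: "d u u = 0"
  using d_le[of u u 0] by simp

text \<open>Such a walk uses the edge; it is split at the first use.\<close>

lemma walk_crosses:
  assumes "(u, v) \<in> E ^^ n" "(x, y) \<in> E" "u \<in> side y x" "v \<in> side x y"
  shows "\<exists>i j. i + 1 + j = n \<and> (u, x) \<in> E ^^ i \<and> (y, v) \<in> E ^^ j"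
  using assms(1,3)
proof (induction n arbitrary: u)
  case 0
  then show ?case using side_disjoint[OF assms(2)] assms(4) by auto
next
  case (Suc n)
  then obtain w where w: "(u, w) \<in> E" "(w, v) \<in> E ^^ n" by (meson relpow_Suc_E2)
  show ?case
  proof (cases "w \<in> side y x")
    case True
    then obtain i j where "i + 1 + j = n" "(w, x) \<in> E ^^ i" "(y, v) \<in> E ^^ j" using Suc.IH w by blast
    then show ?thesis using w(1) relpow_Suc_I2[OF w(1), of x i] by (intro exI[of _ "Suc i"] exI[of _ j]) simp
  next
    case False
    then have "(u, w) = (x, y) \<or> (u, w) = (y, x)" using side_step[OF Suc.prems(2) w(1)] by blast
    moreover have "u \<noteq> y" using Suc.prems(2) side_disjoint[OF assms(2)] side_self[of y x] by blast
    ultimately have "u = x" "w = y" by auto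
    then show ?thesis using w by (intro exI[of _ 0] exI[of _ n]) simp
  qed
qed

lemma d_cross:
  assumes e: "(x, y) \<in> E" and u: "u \<in> side y x" and v: "v \<in> side x y"
  shows "d u v = d u x + 1 + d y v"
proof (rule antisym)
  have V: "u \<in> V" "v \<in> V" "x \<in> V" "y \<in> V" using u v side_union[OF e] E_V[OF e] by auto
  have "(u, y) \<in> E ^^ Suc (d u x)" using relpow_finite[OF V(1,3)] e by (rule relpow_Suc_I)
  then have "(u, v) \<in> E ^^ (Suc (d u x) + d y v)"
    using relpow_finite[OF V(4,2)] unfolding relpow_add by blast
  then show "d u v \<le> d u x + 1 + d y v" using d_le by fastforce
  obtain i j where "i + 1 + j = d u v" "(u, x) \<in> E ^^ i" "(y, v) \<in> E ^^ j"
    using walk_crosses[OF relpow_finite[OF V(1,2)] e u v] by blast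
  then show "d u x + 1 + d y v \<le> d u v" using d_le[of u x i] d_le[of y v j] by linarith
qed

lemma side_iff:
  assumes "(x, y) \<in> E" "v \<in> V"
  shows "v \<in> side x y \<longleftrightarrow> d x v = d y v + 1"
  using d_cross[OF assms(1) side_self, of v] d_cross[OF sym_E[OF assms(1)] side_self, of v]
    side_union[OF assms(1)] assms(2) by fastforce

lemma d_side: "(x, y) \<in> E \<Longrightarrow> v \<in> side x y \<Longrightarrow> d x v = d y v + 1"
  using side_iff side_V by blast

lemma not_side_self: "(x, y) \<in> E \<Longrightarrow> x \<notin> side x y"
  using side_disjoint[of x y] side_self[of x y] by blast

text \<open>
  A common vertex \<open>v\<close> would be as near to \<open>z\<close> as to \<open>y\<close>; but \<open>z\<close> is on the side of \<open>x\<close> with respect to the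
  edge \<open>xy\<close>, so the way from \<open>z\<close> to \<open>v\<close> is longer by two.
\<close>

lemma sides_disjoint:
  assumes "(x, y) \<in> E" "(x, z) \<in> E" "y \<noteq> z"
  shows "side x y \<inter> side x z = {}"
proof (rule ccontr)
  assume "\<not> ?thesis"
  then obtain v where v: "v \<in> side x y" "v \<in> side x z" by blast
  have "z \<in> side y x"
    using side_step[of x y x z] assms E_neq[OF assms(2)] by auto
  then have "d z v = d z x + 1 + d y v" using d_cross[OF assms(1) _ v(1)] by blast
  moreover have "d x v = d y v + 1" by (rule d_side[OF assms(1) v(1)])
  moreover have "d x v = d z v + 1" by (rule d_side[OF assms(2) v(2)])
  ultimately show False by simp
qed

lemma side_unique: "(x, y) \<in> E \<Longrightarrow> (x, z) \<in> E \<Longrightarrow> v \<in> side x y \<Longrightarrow> v \<in> side x z \<Longrightarrow> y = z"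
  using sides_disjoint by blast

lemma side_exists:
  assumes "x \<in> V" "v \<in> V" "v \<noteq> x"
  obtains y where "(x, y) \<in> E" "v \<in> side x y"
proof -
  have w: "(x, v) \<in> E ^^ d x v" using relpow_finite assms by blast
  then obtain n where n: "d x v = Suc n" using assms(3) by (cases "d x v") auto
  obtain y where y: "(x, y) \<in> E" "(y, v) \<in> E ^^ n" using w unfolding n by (meson relpow_Suc_E2)
  have "v \<in> side x y"
  proof (rule ccontr)
    assume "v \<notin> side x y"
    then have "v \<in> side y x" using side_union[OF y(1)] assms(2) by blast
    then have "d y v = d x v + 1" using d_side[OF sym_E[OF y(1)]] by blast
    then show False using d_le[OF y(2)] n by simp
  qed
  then show ?thesis using that y by blast
qed

lemma side_nested:
  assumes "(x, y) \<in> E" "(y, z) \<in> E" "z \<noteq> x"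
  shows "side y z \<subseteq> side x y" "y \<notin> side y z"
proof -
  show "side y z \<subseteq> side x y"
    using sides_disjoint[OF sym_E[OF assms(1)] assms(2)] assms(3) side_union[OF assms(1)] side_V[OF assms(2)] by blast
  show "y \<notin> side y z" by (rule not_side_self[OF assms(2)])
qed

lemma side_nested_less:
  assumes "(x, y) \<in> E" "(y, z) \<in> E" "z \<noteq> x"
  shows "card (side y z) < card (side x y)"
proof (rule psubset_card_mono)
  show "finite (side x y)" using side_V[OF assms(1)] finite_V by (rule finite_subset)
  show "side y z \<subset> side x y" using side_nested[OF assms] side_self[of y x] by blast
qed

lemma side_unfold:
  assumes "(x, y) \<in> E"
  shows "side x y = insert y (\<Union>z\<in>{z. (y, z) \<in> E \<and> z \<noteq> x}. side y z)"
proof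
  show "insert y (\<Union>z\<in>{z. (y, z) \<in> E \<and> z \<noteq> x}. side y z) \<subseteq> side x y"
    using side_nested(1)[OF assms] by auto
  show "side x y \<subseteq> insert y (\<Union>z\<in>{z. (y, z) \<in> E \<and> z \<noteq> x}. side y z)"
  proof
    fix v assume v: "v \<in> side x y"
    show "v \<in> insert y (\<Union>z\<in>{z. (y, z) \<in> E \<and> z \<noteq> x}. side y z)"
    proof (cases "v = y")
      case False
      have "v \<in> V" using v side_V[OF assms] by blast
      then obtain z where z: "(y, z) \<in> E" "v \<in> side y z" using side_exists[of y v] False E_V[OF assms] by metis
      moreover have "z \<noteq> x" using z(2) v side_disjoint[OF assms] by auto
      ultimately show ?thesis by blast
    qed simp
  qed
qed

lemma V_unfold:
  assumes "y \<in> V" shows "V = insert y (\<Union>z\<in>{z. (y, z) \<in> E}. side y z)"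
proof
  show "insert y (\<Union>z\<in>{z. (y, z) \<in> E}. side y z) \<subseteq> V" using side_V assms by auto
  show "V \<subseteq> insert y (\<Union>z\<in>{z. (y, z) \<in> E}. side y z)"
  proof
    fix v assume v: "v \<in> V"
    show "v \<in> insert y (\<Union>z\<in>{z. (y, z) \<in> E}. side y z)"
    proof (cases "v = y")
      case False
      then obtain z where "(y, z) \<in> E" "v \<in> side y z" using side_exists[OF assms v] by metis
      then show ?thesis by blast
    qed simp
  qed
qed

lemma leave_side:
  assumes "(y, z) \<in> E" "a \<in> side y z" "(a, b) \<in> E" "b \<notin> side y z"
  shows "a = z \<and> b = y"
  using side_step[OF assms(2,3)] assms not_side_self[OF assms(1)] by auto

lemma d_sym: assumes "u \<in> V" "v \<in> V" shows "d u v = d v u"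
proof -
  have "(b, a) \<in> E ^^ n" if "(a, b) \<in> E ^^ n" for a b n
    using that
  proof (induction n arbitrary: b)
    case (Suc n)
    then obtain c where "(a, c) \<in> E ^^ n" "(c, b) \<in> E" by auto
    then show ?case using Suc.IH[of c] sym_E by (meson relpow_Suc_I2)
  qed simp
  then show ?thesis using relpow_finite assms d_le by (meson antisym)
qed

lemma d_zero: "u \<in> V \<Longrightarrow> v \<in> V \<Longrightarrow> d u v = 0 \<Longrightarrow> u = v"
  using relpow_finite[of u v] by simp

definition lf :: "'v set" where
  "lf = {v \<in> V. card (E `` {v}) = 1}"

lemma lf_V: "v \<in> lf \<Longrightarrow> v \<in> V" by (simp add: lf_def)

lemma lf_nbr: "v \<in> lf \<Longrightarrow> (v, p) \<in> E \<Longrightarrow> (v, q) \<in> E \<Longrightarrow> p = q"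
proof -
  assume v: "v \<in> lf" "(v, p) \<in> E" "(v, q) \<in> E"
  then obtain x where x: "E `` {v} = {x}" by (auto simp: lf_def card_1_singleton_iff)
  have "p \<in> E `` {v}" "q \<in> E `` {v}" using v by blast+
  then show ?thesis unfolding x by simp
qed

lemma lf_obtain_nbr: assumes "v \<in> lf" obtains p where "(v, p) \<in> E" "E `` {v} = {p}"
  using assms by (auto simp: lf_def card_1_singleton_iff)

lemma side_lf:
  assumes "(x, y) \<in> E" "y \<in> lf" shows "side x y = {y}"
  using side_unfold[OF assms(1)] lf_nbr[OF assms(2)] sym_E[OF assms(1)] by auto

lemma lfI: "(x, y) \<in> E \<Longrightarrow> (\<And>z. (y, z) \<in> E \<Longrightarrow> z = x) \<Longrightarrow> y \<in> lf"
proof -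
  assume "(x, y) \<in> E" "\<And>z. (y, z) \<in> E \<Longrightarrow> z = x"
  then have "E `` {y} = {x}" "y \<in> V" using sym_E E_V by auto
  then show ?thesis by (simp add: lf_def)
qed

lemma side_has_leaf: "(x, y) \<in> E \<Longrightarrow> side x y \<inter> lf \<noteq> {}"
proof (induction "card (side x y)" arbitrary: x y rule: less_induct)
  case less
  show ?case
  proof (cases "\<exists>z. (y, z) \<in> E \<and> z \<noteq> x")
    case True
    then obtain z where z: "(y, z) \<in> E" "z \<noteq> x" by blast
    then show ?thesis using less.hyps[OF side_nested_less[OF less.prems z] z(1)] side_nested(1)[OF less.prems z] by blast
  next
    case False
    then have "y \<in> lf" using lfI[OF less.prems] by blast
    then show ?thesis using side_self[of y x] by blast
  qed
qed

lemma leaf_branch: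
  assumes "v \<in> lf" "(v, p) \<in> E" "w \<in> V" "w \<noteq> v"
  shows "d v w = d p w + 1"
proof -
  have "w \<notin> side p v" using side_lf[OF sym_E[OF assms(2)] assms(1)] assms(4) by blast
  then show ?thesis using side_iff[OF assms(2,3)] side_union[OF assms(2)] assms(3) by blast
qed

end

section \<open>The branches at a vertex\<close>

text \<open>
  The leaf graph as it looks from a vertex \<open>x\<close> of the tree: \<open>br\<close> is the branch at \<open>x\<close> that contains a leaf and
  \<open>\<delta>\<close> its distance from \<open>x\<close>. So edges between different branches join depths 1 and 4 or depths 2 and 3.
  The last two axioms reflect that a leaf next to \<open>x\<close> is a branch of its own, and that leaves with the
  same neighbour in the tree would lie on a 4-cycle.
\<close>

locale branches = long_cycle L R for L :: "'v set" and R :: "'v \<Rightarrow> 'v \<Rightarrow> bool" +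
  fixes br :: "'v \<Rightarrow> 'b" and \<delta> :: "'v \<Rightarrow> nat"
  assumes adj: "u \<in> L \<Longrightarrow> v \<in> L \<Longrightarrow> br u \<noteq> br v \<Longrightarrow> R u v \<longleftrightarrow> \<delta> u + \<delta> v = 5"
    and pos: "u \<in> L \<Longrightarrow> 1 \<le> \<delta> u"
    and one: "u \<in> L \<Longrightarrow> v \<in> L \<Longrightarrow> \<delta> u = 1 \<Longrightarrow> \<delta> v = 1 \<or> br v = br u \<Longrightarrow> u = v"
    and two: "u \<in> L \<Longrightarrow> v \<in> L \<Longrightarrow> \<delta> u = 2 \<Longrightarrow> \<delta> v = 2 \<Longrightarrow> br u = br v \<Longrightarrow> u = v"
begin

abbreviation branch :: "'b \<Rightarrow> 'v set" where
  "branch j \<equiv> {u \<in> L. br u = j}"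

definition nontrivial :: "'b \<Rightarrow> bool" where
  "nontrivial j \<longleftrightarrow> (\<exists>u v. u \<in> branch j \<and> v \<in> branch j \<and> u \<noteq> v)"

lemma exit_cases:
  assumes j: "nontrivial j" and u: "u \<in> branch j" "v \<in> L" "br v \<noteq> j" "R u v"
  shows "\<delta> u = 2 \<and> \<delta> v = 3 \<or> \<delta> u = 3 \<and> \<delta> v = 2 \<or> \<delta> u = 4 \<and> \<delta> v = 1"
proof -
  have "\<delta> u \<noteq> 1"
  proof
    assume 1: "\<delta> u = 1"
    obtain a b where "a \<in> branch j" "b \<in> branch j" "a \<noteq> b" using j by (auto simp: nontrivial_def)
    then show False using one[of u a] one[of u b] 1 u by auto
  qed
  moreover have "\<delta> u + \<delta> v = 5" "1 \<le> \<delta> u" "1 \<le> \<delta> v" using adj[of u v] pos u by auto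
  ultimately show ?thesis by arith
qed

lemma depth_one:
  assumes "nontrivial j" "u \<in> branch j"
  shows "\<delta> u \<noteq> 1"
proof
  assume 1: "\<delta> u = 1"
  obtain a b where "a \<in> branch j" "b \<in> branch j" "a \<noteq> b" using assms(1) by (auto simp: nontrivial_def)
  then show False using one[of u a] one[of u b] 1 assms(2) by auto
qed

lemma adj_one:
  assumes "t \<in> L" "\<delta> t = 1" "v \<in> L"
  shows "R t v \<longleftrightarrow> \<delta> v = 4"
proof (cases "br v = br t")
  case True
  then have "t = v" using one assms by blast
  then show ?thesis using assms irrefl by simp
next
  case False then show ?thesis using adj[of t v] assms by auto
qed

lemma adj_23:
  assumes "u \<in> L" "\<delta> u = 2" "w \<in> L" "\<delta> w = 3" "br u \<noteq> br w"
  shows "R u w" "R w u"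
  using adj[of u w] adj[of w u] assms by auto

text \<open>
  The edges between depths 2 and 3 form the path \<open>w2 u1 w3 u2 w1\<close>, and there are no other leaves of these
  depths. So \<open>w3\<close> has both neighbours outside its branch, and the rest of branch \<open>k\<close> can be left only from
  depth 4 to the leaf at depth 1. As it is left by two edges, both neighbours of that leaf are in \<open>k\<close>,
  and together with it the rest of \<open>k\<close> is a closed set without \<open>w3\<close>.
\<close>

lemma third_branch_without_depth_2:
  assumes u: "u1 \<in> branch i" "\<delta> u1 = 2" "u2 \<in> branch j" "\<delta> u2 = 2"
    and w: "w1 \<in> branch i" "\<delta> w1 = 3" "w2 \<in> branch j" "\<delta> w2 = 3" "w3 \<in> branch k" "\<delta> w3 = 3"
    and ijk: "i \<noteq> j" "i \<noteq> k" "j \<noteq> k" and k: "nontrivial k"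
    and only: "\<And>u. u \<in> L \<Longrightarrow> \<delta> u = 2 \<Longrightarrow> u = u1 \<or> u = u2"
  shows False
proof -
  have R: "R u1 w2" "R u1 w3" "R u2 w1" "R u2 w3" "R w3 u1" "R w3 u2"
    using adj_23[of u1 w2] adj_23[of u1 w3] adj_23[of u2 w1] adj_23[of u2 w3] u w ijk by auto
  have ne: "w2 \<noteq> w3" "w1 \<noteq> w3" "u1 \<noteq> u2" using w u ijk by auto
  have three: "x = w1 \<or> x = w2 \<or> x = w3" if x: "x \<in> L" "\<delta> x = 3" for x
  proof (cases "br x = i")
    case True
    then have "R u2 x" using adj_23[of u2 x] u x ijk by auto
    then show ?thesis using no_three_nbrs[of u2 w1 w3 x] R w u x ne by auto
  next
    case False
    then have "R u1 x" using adj_23[of u1 x] u x by auto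
    then show ?thesis using no_three_nbrs[of u1 w2 w3 x] R w u x ne by auto
  qed
  let ?S = "branch k - {w3}"
  have out: "\<delta> x = 4 \<and> \<delta> y = 1" if xy: "x \<in> ?S" "y \<in> L - ?S" "R x y" for x y
  proof -
    have "y \<noteq> w3"
    proof
      assume "y = w3"
      then have "x = u1 \<or> x = u2" using no_three_nbrs[of w3 u1 u2 x] R w u xy ne sym[OF xy(3)] by auto
      then show False using xy u ijk by auto
    qed
    then have "x \<in> branch k" "y \<in> L" "br y \<noteq> k" using xy by auto
    from exit_cases[OF k this xy(3)] show ?thesis
    proof (elim disjE)
      assume "\<delta> x = 2 \<and> \<delta> y = 3"
      then have "x = u1 \<or> x = u2" using only[of x] xy by auto
      then show ?thesis using xy u ijk by auto
    next
      assume "\<delta> x = 3 \<and> \<delta> y = 2"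
      then have "x = w1 \<or> x = w2 \<or> x = w3" using three[of x] xy by auto
      then show ?thesis using xy w ijk by auto
    qed
  qed
  have "?S \<noteq> {}" using k by (auto simp: nontrivial_def)
  moreover have "?S \<noteq> L" using w by auto
  ultimately obtain s s' y y' where e: "s \<in> ?S" "s' \<in> ?S" "y \<in> L - ?S" "y' \<in> L - ?S" "R s y" "R s' y'" "(s, y) \<noteq> (s', y')"
    using cut[of ?S] by blast
  have d: "\<delta> y = 1" "\<delta> y' = 1" using out[OF e(1,3,5)] out[OF e(2,4,6)] by auto
  have "y = y'" using one[of y y'] d e by auto
  then have s: "s \<noteq> s'" using e(7) by auto
  have "insert y ?S = L"
  proof (rule connected_onD[OF connected])
    fix a b assume ab: "a \<in> insert y ?S" "b \<in> L" "R a b"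
    show "b \<in> insert y ?S"
    proof (cases "a = y")
      case True
      then have "b = s \<or> b = s'"
        using no_three_nbrs[of y s s' b] ab e s sym[OF e(5)] sym[OF e(6)] \<open>y = y'\<close> by auto
      then show ?thesis using e by auto
    next
      case False
      then have "a \<in> ?S" using ab by blast
      show ?thesis
      proof (rule ccontr)
        assume "b \<notin> insert y ?S"
        then have "\<delta> b = 1" using out[OF \<open>a \<in> ?S\<close>, of b] ab by blast
        then have "b = y" using one[of b y] d(1) ab(2) e(3) by auto
        then show False using \<open>b \<notin> insert y ?S\<close> by blast
      qed
    qed
  qed (use e in auto)
  then have "w3 \<in> insert y ?S" using w(5) by blast
  then have "w3 = y" by blast
  then show False using d(1) w(6) by simp
qed

text \<open>
  Branch \<open>i\<close> is left only from its leaf \<open>u\<close> at depth 2 and from depth 4, to the leaf \<open>t\<close> at depth 1. If both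
  neighbours \<open>v\<close>, \<open>v'\<close> of \<open>t\<close> are in \<open>i\<close>, then \<open>i\<close> and \<open>t\<close> are left from \<open>u\<close> only, so \<open>u\<close> can be removed and the
  rest is closed. Otherwise the edge \<open>v t\<close> leaves \<open>i\<close>, and \<open>u\<close> has just one neighbour outside, for with two
  of them \<open>v t\<close> would be a bridge. So there is a single leaf \<open>w\<close> of depth 3 outside \<open>i\<close>. A nontrivial branch
  other than \<open>i\<close> and that of \<open>w\<close> must contain \<open>v'\<close>, which leaves the branch of \<open>w\<close> with the only exit \<open>w\<close>.
\<close>

lemma branch_without_depth_3_exit:
  assumes ijk: "i \<noteq> j" "i \<noteq> k" "j \<noteq> k" and nt: "nontrivial i" "nontrivial j" "nontrivial k"
    and no: "\<And>w u. w \<in> branch i \<Longrightarrow> \<delta> w = 3 \<Longrightarrow> u \<in> L \<Longrightarrow> br u \<noteq> i \<Longrightarrow> \<delta> u \<noteq> 2"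
  shows False
proof -
  have proper: "branch m \<noteq> L" for m
  proof
    assume "branch m = L"
    moreover obtain a b where "a \<in> branch i" "b \<in> branch j" using nt by (auto simp: nontrivial_def)
    ultimately have "br a = m" "br b = m" by auto
    then show False using \<open>a \<in> branch i\<close> \<open>b \<in> branch j\<close> ijk by simp
  qed
  have exit_i: "\<delta> x = 2 \<and> \<delta> y = 3 \<or> \<delta> x = 4 \<and> \<delta> y = 1" if "x \<in> branch i" "y \<in> L" "br y \<noteq> i" "R x y" for x y
    using exit_cases[OF nt(1) that] no[of x y] that by blast
  have exits: "\<exists>s s' w w'. s \<in> branch m \<and> s' \<in> branch m \<and> s \<noteq> s' \<and> w \<in> L \<and> w' \<in> L \<and> br w \<noteq> m \<and> br w' \<noteq> m
      \<and> R s w \<and> R s' w'" if m: "nontrivial m" for m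
  proof -
    obtain a b where ab: "a \<in> branch m" "b \<in> branch m" "a \<noteq> b" using m unfolding nontrivial_def by blast
    obtain s s' w w' where "s \<in> branch m" "s' \<in> branch m" "s \<noteq> s'" "w \<in> L - branch m" "w' \<in> L - branch m" "R s w" "R s' w'"
      using two_exits[OF _ proper[of m] ab] by blast
    then show ?thesis by blast
  qed
  obtain s s' y y' where e: "s \<in> branch i" "s' \<in> branch i" "s \<noteq> s'" "y \<in> L" "y' \<in> L" "br y \<noteq> i" "br y' \<noteq> i"
    "R s y" "R s' y'" using exits[OF nt(1)] by blast
  have "\<delta> s \<noteq> 2 \<or> \<delta> s' \<noteq> 2" using two[of s s'] e by auto
  then obtain v t where v: "v \<in> branch i" "\<delta> v = 4" "t \<in> L" "\<delta> t = 1" "br t \<noteq> i"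
    using exit_i[of s y] exit_i[of s' y'] e by auto
  have "R t v" using adj_one v by auto
  obtain v' where v': "v' \<in> L" "v' \<noteq> v" "R t v'" using two_nbrs[OF v(3)] by metis
  have four: "x = v \<or> x = v'" if "x \<in> L" "\<delta> x = 4" for x
    using no_three_nbrs[of t v v' x] v v' \<open>R t v\<close> adj_one[OF v(3,4), of x] that by auto
  have uniq: "y = t" if "y \<in> L" "\<delta> y = 1" for y using one[of y t] v that by auto
  show False
  proof (cases "br v' = i")
    case True
    let ?S = "insert t (branch i)"
    have out: "\<delta> x = 2" "x \<in> branch i" if "x \<in> ?S" "z \<in> L - ?S" "R x z" for x z
    proof -
      have "x \<noteq> t"
      proof
        assume "x = t"
        then have "\<delta> z = 4" using adj_one[OF v(3,4)] that by auto
        then have "z = v \<or> z = v'" using four[of z] that by auto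
        then show False using that v v' True by auto
      qed
      then show "x \<in> branch i" using that by auto
      moreover have "\<delta> z \<noteq> 1" using uniq[of z] that by auto
      ultimately show "\<delta> x = 2" using exit_i[of x z] that by auto
    qed
    obtain c where c: "c \<in> branch j" using nt by (auto simp: nontrivial_def)
    then have "c \<noteq> t" using depth_one[OF nt(2)] v by auto
    then have "?S \<noteq> L" "?S \<subseteq> L" using c v ijk by auto
    then obtain a a' b b' where ab: "a \<in> ?S" "a' \<in> ?S" "b \<in> L - ?S" "b' \<in> L - ?S" "R a b" "R a' b'" "(a, b) \<noteq> (a', b')"
      using cut[of ?S] by blast
    have a: "a \<in> branch i" "\<delta> a = 2" "a' = a"
      using out[OF ab(1,3,5)] out[OF ab(2,4,6)] two[of a a'] by auto
    then have "b \<noteq> b'" using ab by auto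
    have "?S - {a} = L"
    proof (rule connected_onD[OF connected])
      fix x z assume xz: "x \<in> ?S - {a}" "z \<in> L" "R x z"
      have "z \<noteq> a"
      proof
        assume "z = a"
        then have "x = b \<or> x = b'"
          using no_three_nbrs[of a b b' x] ab a xz sym[OF xz(3)] \<open>b \<noteq> b'\<close> v by auto
        then show False using xz ab by auto
      qed
      moreover have "z \<in> ?S"
      proof (rule ccontr)
        assume "z \<notin> ?S"
        then have "\<delta> x = 2" "x \<in> branch i" using out[of x z] xz by auto
        then have "x = a" using two[of x a] a by auto
        then show False using xz by auto
      qed
      ultimately show "z \<in> ?S - {a}" by auto
    qed (use v a in auto)
    then show False using a by auto
  next
    case False
    have "\<exists>u w. u \<in> branch i \<and> \<delta> u = 2 \<and> w \<in> L \<and> br w \<noteq> i \<and> \<delta> w = 3 \<and> R u w"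
    proof -
      have "\<not> (\<delta> s = 4 \<and> \<delta> s' = 4)" using four[of s] four[of s'] e False by auto
      then show ?thesis using exit_i[of s y] exit_i[of s' y'] e by blast
    qed
    then obtain u w where uw: "u \<in> branch i" "\<delta> u = 2" "w \<in> L" "br w \<noteq> i" "\<delta> w = 3" "R u w" by blast
    \<comment> \<open>A second leaf of depth 3 outside would be the other neighbour of \<open>u\<close>, making \<open>v t\<close> a bridge.\<close>
    have w_only: "x = w" if x: "x \<in> L" "br x \<noteq> i" "\<delta> x = 3" for x
    proof (rule ccontr)
      assume "x \<noteq> w"
      have "R u x" using adj_23[of u x] uw x by auto
      let ?S = "branch i - {u}"
      have out: "a = v \<and> b = t" if ab: "a \<in> ?S" "b \<in> L - ?S" "R a b" for a b
      proof -
        have "b \<noteq> u"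
        proof
          assume "b = u"
          then have "a = w \<or> a = x"
            using no_three_nbrs[of u w x a] uw x ab \<open>R u x\<close> \<open>x \<noteq> w\<close> sym[OF ab(3)] by auto
          then show False using ab uw x by auto
        qed
        then have "\<delta> a = 2 \<and> \<delta> b = 3 \<or> \<delta> a = 4 \<and> \<delta> b = 1" using exit_i[of a b] ab by auto
        moreover have "\<delta> a \<noteq> 2" using two[of a u] ab uw by auto
        ultimately have "\<delta> a = 4" "\<delta> b = 1" by auto
        then show ?thesis using four[of a] uniq[of b] ab False by auto
      qed
      have "v \<in> ?S" using v uw by auto
      moreover have "?S \<noteq> L" using uw by auto
      ultimately obtain a a' b b' where "a \<in> ?S" "a' \<in> ?S" "b \<in> L - ?S" "b' \<in> L - ?S" "R a b" "R a' b'" "(a, b) \<noteq> (a', b')"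
        using cut[of ?S] by blast
      then show False using out[of a b] out[of a' b'] by auto
    qed
    \<comment> \<open>Without \<open>w\<close>, an exit of \<open>m\<close> has depth 2, which only one leaf has, or is a neighbour of \<open>t\<close>.\<close>
    have other: "v' \<in> branch m \<and> (\<exists>x \<in> branch m. \<delta> x = 2)" if m: "nontrivial m" "m \<noteq> i" "m \<noteq> br w" for m
    proof -
      obtain a a' b b' where ab: "a \<in> branch m" "a' \<in> branch m" "a \<noteq> a'" "b \<in> L" "b' \<in> L" "br b \<noteq> m" "br b' \<noteq> m"
        "R a b" "R a' b'" using exits[OF m(1)] by blast
      have c: "x \<in> branch m \<Longrightarrow> z \<in> L \<Longrightarrow> br z \<noteq> m \<Longrightarrow> R x z \<Longrightarrow> \<delta> x = 2 \<or> x = v'" for x z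
        using exit_cases[OF m(1), of x z] w_only[of x] four[of x] m v by auto
      have "\<delta> a = 2 \<or> a = v'" "\<delta> a' = 2 \<or> a' = v'" using c ab by blast+
      moreover have "\<not> (\<delta> a = 2 \<and> \<delta> a' = 2)" using two[of a a'] ab by auto
      ultimately show ?thesis using ab by auto
    qed
    have "br w = j \<or> br w = k" using other[of j] other[of k] nt ijk by auto
    then have K: "nontrivial (br w)" using nt by auto
    have v'K: "br v' \<noteq> br w"
    proof (cases "br w = j")
      case True
      then have "v' \<in> branch k" using other[of k] nt ijk by blast
      then show ?thesis using True ijk by simp
    next
      case False
      then have "v' \<in> branch j" using other[of j] nt ijk by blast
      then show ?thesis using False by simp
    qed
    obtain a a' b b' where ab: "a \<in> branch (br w)" "a' \<in> branch (br w)" "a \<noteq> a'" "b \<in> L" "b' \<in> L"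
      "br b \<noteq> br w" "br b' \<noteq> br w" "R a b" "R a' b'" using exits[OF K] by blast
    have c: "x = w" if x: "x \<in> branch (br w)" "z \<in> L" "br z \<noteq> br w" "R x z" for x z
    proof -
      have "\<not> (\<delta> x = 2 \<and> \<delta> z = 3)"
      proof
        assume d: "\<delta> x = 2 \<and> \<delta> z = 3"
        then have "br z = i" using w_only[of z] x by auto
        then show False using no[of z x] d x uw by auto
      qed
      moreover have "\<delta> x \<noteq> 4" using four[of x] x v v'K uw by auto
      ultimately have "\<delta> x = 3" using exit_cases[OF K x] by auto
      moreover have "x \<in> L" "br x \<noteq> i" using x(1) uw(4) by simp_all
      ultimately show ?thesis using w_only by simp
    qed
    have "a = w" "a' = w" using c[OF ab(1,4,6,8)] c[OF ab(2,5,7,9)] by simp_all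
    then show False using ab(3) by simp
  qed
qed

text \<open>
  Each of the three branches has a leaf of depth 3 with a neighbour elsewhere. A leaf of depth 2 is
  adjacent to those of them in other branches, so it lies in one of the three branches. Three leaves
  of depth 2 would close a 6-cycle, and a single one cannot serve the leaf of depth 3 in its own branch.
\<close>

lemma not_three_nontrivial:
  assumes nt: "nontrivial i" "nontrivial j" "nontrivial k" and ijk: "i \<noteq> j" "i \<noteq> k" "j \<noteq> k"
  shows False
proof -
  have ex: "\<exists>w u. w \<in> branch m \<and> \<delta> w = 3 \<and> u \<in> L \<and> br u \<noteq> m \<and> \<delta> u = 2"
    if "m \<noteq> n" "m \<noteq> l" "n \<noteq> l" "nontrivial m" "nontrivial n" "nontrivial l" for m n l
    using branch_without_depth_3_exit[OF that] by blast
  obtain w1 x1 where 1: "w1 \<in> branch i" "\<delta> w1 = 3" "x1 \<in> L" "br x1 \<noteq> i" "\<delta> x1 = 2" using ex[of i j k] nt ijk by blast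
  obtain w2 x2 where 2: "w2 \<in> branch j" "\<delta> w2 = 3" "x2 \<in> L" "br x2 \<noteq> j" "\<delta> x2 = 2" using ex[of j i k] nt ijk by metis
  obtain w3 x3 where 3: "w3 \<in> branch k" "\<delta> w3 = 3" "x3 \<in> L" "br x3 \<noteq> k" "\<delta> x3 = 2" using ex[of k i j] nt ijk by metis
  have ne: "w1 \<noteq> w2" "w1 \<noteq> w3" "w2 \<noteq> w3" using 1 2 3 ijk by auto
  have where2: "br u = i \<or> br u = j \<or> br u = k" if "u \<in> L" "\<delta> u = 2" for u
  proof (rule ccontr)
    assume "\<not> ?thesis"
    then have "R u w1" "R u w2" "R u w3" using adj_23[of u w1] adj_23[of u w2] adj_23[of u w3] 1 2 3 that by auto
    then show False using no_three_nbrs[of u w1 w2 w3] 1 2 3 that ne by auto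
  qed
  have uq: "u = u'" if "u \<in> L" "u' \<in> L" "\<delta> u = 2" "\<delta> u' = 2" "br u = br u'" for u u' using two that by blast
  show False
  proof (cases "(\<exists>u\<in>branch i. \<delta> u = 2) \<and> (\<exists>u\<in>branch j. \<delta> u = 2) \<and> (\<exists>u\<in>branch k. \<delta> u = 2)")
    case True
    then obtain u1 u2 u3 where u: "u1 \<in> branch i" "\<delta> u1 = 2" "u2 \<in> branch j" "\<delta> u2 = 2" "u3 \<in> branch k" "\<delta> u3 = 2" by blast
    have R: "R u1 w2" "R w2 u1" "R u1 w3" "R w3 u1" "R u2 w1" "R w1 u2" "R u2 w3" "R w3 u2" "R u3 w1" "R w1 u3" "R u3 w2" "R w2 u3"
      using adj_23[of u1 w2] adj_23[of u1 w3] adj_23[of u2 w1] adj_23[of u2 w3] adj_23[of u3 w1] adj_23[of u3 w2] u 1 2 3 ijk by auto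
    have une: "u1 \<noteq> u2" "u1 \<noteq> u3" "u2 \<noteq> u3" using u ijk by auto
    show False
    proof (rule no_small_ring[of "{u1, u2, u3, w1, w2, w3}"])
      have "card {u1, u2, u3, w1, w2, w3} \<le> 6" by (simp add: card_insert_if)
      then show "card {u1, u2, u3, w1, w2, w3} < 7" by simp
      fix x assume "x \<in> {u1, u2, u3, w1, w2, w3}"
      then show "\<exists>v\<in>{u1, u2, u3, w1, w2, w3}. \<exists>w\<in>{u1, u2, u3, w1, w2, w3}. v \<noteq> w \<and> R x v \<and> R x w"
        using R ne une by (elim insertE) auto
    qed (use u 1 2 3 in auto)
  next
    case False
    have i: "\<exists>u\<in>branch j \<union> branch k. \<delta> u = 2" using where2[of x1] 1 by auto
    have j: "\<exists>u\<in>branch i \<union> branch k. \<delta> u = 2" using where2[of x2] 2 by auto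
    have k: "\<exists>u\<in>branch i \<union> branch j. \<delta> u = 2" using where2[of x3] 3 by auto
    have fin: False if "u1 \<in> branch m" "\<delta> u1 = 2" "u2 \<in> branch n" "\<delta> u2 = 2"
      "y1 \<in> branch m" "\<delta> y1 = 3" "y2 \<in> branch n" "\<delta> y2 = 3" "y3 \<in> branch l" "\<delta> y3 = 3" "m \<noteq> n" "m \<noteq> l" "n \<noteq> l" "nontrivial l"
      "{i, j, k} = {m, n, l}" "\<not> (\<exists>u\<in>branch l. \<delta> u = 2)" for u1 u2 y1 y2 y3 m n l
    proof (rule third_branch_without_depth_2[OF that(1-14)])
      fix u assume u: "u \<in> L" "\<delta> u = 2"
      then have "br u \<in> {m, n, l}" using where2[OF u] that(15) by auto
      moreover have "br u \<noteq> l" using that(16) u by auto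
      ultimately show "u = u1 \<or> u = u2" using uq[of u u1] uq[of u u2] u that(1-4) by auto
    qed
    consider "\<not> (\<exists>u\<in>branch i. \<delta> u = 2)" | "\<not> (\<exists>u\<in>branch j. \<delta> u = 2)" | "\<not> (\<exists>u\<in>branch k. \<delta> u = 2)"
      using False by blast
    then show False
    proof cases
      case c: 1
      obtain u2 u3 where "u2 \<in> branch j" "\<delta> u2 = 2" "u3 \<in> branch k" "\<delta> u3 = 2" using c j k by blast
      from fin[OF this 2(1,2) 3(1,2) 1(1,2)] show False using ijk nt c by blast
    next
      case c: 2
      obtain u1 u3 where "u1 \<in> branch i" "\<delta> u1 = 2" "u3 \<in> branch k" "\<delta> u3 = 2" using c i k by blast
      from fin[OF this 1(1,2) 3(1,2) 2(1,2)] show False using ijk nt c by blast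
    next
      case c: 3
      obtain u1 u2 where "u1 \<in> branch i" "\<delta> u1 = 2" "u2 \<in> branch j" "\<delta> u2 = 2" using c i j by blast
      from fin[OF this 1(1,2) 2(1,2) 3(1,2)] show False using ijk nt c by blast
    qed
  qed
qed

end

section \<open>Gluing pendant paths to a spine\<close>

text \<open>Which vertices of a spine tree are adjacent does not depend on the word, only which of them exist does.\<close>

fun spine_adj :: "spine_vertex \<Rightarrow> spine_vertex \<Rightarrow> bool" where
  "spine_adj (Spine i) (Spine j) \<longleftrightarrow> j = i + 1 \<or> i = j + 1"
| "spine_adj (Spine i) (Pendant k r j) \<longleftrightarrow> i = k \<and> j = 1"
| "spine_adj (Pendant k r j) (Spine i) \<longleftrightarrow> i = k \<and> j = 1"
| "spine_adj (Pendant k r j) (Pendant k' r' j') \<longleftrightarrow> k = k' \<and> r = r' \<and> (j' = j + 1 \<or> j = j' + 1)"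

abbreviation spine_verts :: "spine_word \<Rightarrow> spine_vertex set" where
  "spine_verts W \<equiv> pverts (spine_tree W)"

lemma Spine_in_verts [simp]: "Spine i \<in> spine_verts W \<longleftrightarrow> i < length W"
  by (auto simp: spine_tree_def)

lemma Pendant_in_verts [simp]: "Pendant i r j \<in> spine_verts W \<longleftrightarrow> i < length W \<and> r \<in> W ! i \<and> 1 \<le> j \<and> j \<le> r"
  by (auto simp: spine_tree_def)

lemma parcs_spine_tree:
  assumes "proper_word W"
  shows "(a, b) \<in> parcs (spine_tree W) \<longleftrightarrow> a \<in> spine_verts W \<and> b \<in> spine_verts W \<and> spine_adj a b"
proof -
  have "Suc 0 \<le> r" if "i < length W" "r \<in> W ! i" for i r
    using proper_wordD[OF assms, of "(i, r)"] that by (auto simp: word_leaves_def)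
  then show ?thesis by (cases a; cases b) (auto simp: spine_tree_def spine_tree_edges_def)
qed

definition embeds :: "'v rel \<Rightarrow> spine_word \<Rightarrow> (spine_vertex \<Rightarrow> 'v) \<Rightarrow> 'v set \<Rightarrow> bool" where
  "embeds E W f Z \<longleftrightarrow> bij_betw f (spine_verts W) Z \<and>
     (\<forall>a\<in>spine_verts W. \<forall>b\<in>spine_verts W. spine_adj a b \<longleftrightarrow> (f a, f b) \<in> E)"

text \<open>
  A spine vertex \<open>y\<close> is put in front of the tree of \<open>W\<close>, with pendant paths \<open>q r\<close> of length \<open>r\<close> on the vertex
  sets \<open>P r\<close>.
\<close>

lemma embeds_Cons:
  assumes f': "embeds E W f' Z" and y: "y \<notin> Z"
    and q: "\<And>r. r \<in> A \<Longrightarrow> bij_betw (q r) {1..r} (P r)" and yP: "\<And>r. r \<in> A \<Longrightarrow> y \<notin> P r"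
    and disj: "\<And>r. r \<in> A \<Longrightarrow> P r \<inter> Z = {}" "\<And>r s. r \<in> A \<Longrightarrow> s \<in> A \<Longrightarrow> r \<noteq> s \<Longrightarrow> P r \<inter> P s = {}"
    and sym: "\<And>a b. (a, b) \<in> E \<Longrightarrow> (b, a) \<in> E" and irrefl: "(y, y) \<notin> E"
    and yZ: "\<And>a. a \<in> spine_verts W \<Longrightarrow> (y, f' a) \<in> E \<longleftrightarrow> a = Spine 0"
    and yq: "\<And>r j. r \<in> A \<Longrightarrow> j \<in> {1..r} \<Longrightarrow> (y, q r j) \<in> E \<longleftrightarrow> j = 1"
    and qq: "\<And>r i j. r \<in> A \<Longrightarrow> i \<in> {1..r} \<Longrightarrow> j \<in> {1..r} \<Longrightarrow> (q r i, q r j) \<in> E \<longleftrightarrow> j = i + 1 \<or> i = j + 1"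
    and noedge: "\<And>r a b. r \<in> A \<Longrightarrow> a \<in> P r \<Longrightarrow> b \<in> Z \<Longrightarrow> (a, b) \<notin> E"
      "\<And>r s a b. r \<in> A \<Longrightarrow> s \<in> A \<Longrightarrow> r \<noteq> s \<Longrightarrow> a \<in> P r \<Longrightarrow> b \<in> P s \<Longrightarrow> (a, b) \<notin> E"
  shows "\<exists>f. embeds E (A # W) f (insert y ((\<Union>r\<in>A. P r) \<union> Z)) \<and> f (Spine 0) = y"
proof -
  define f where "f v = (case v of Spine i \<Rightarrow> if i = 0 then y else f' (Spine (i - 1))
     | Pendant i r j \<Rightarrow> if i = 0 then q r j else f' (Pendant (i - 1) r j))" for v
  define up where "up v = (case v of Spine i \<Rightarrow> Spine (Suc i) | Pendant i r j \<Rightarrow> Pendant (Suc i) r j)" for v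
  have f_simps [simp]: "f (Spine 0) = y" "f (Pendant 0 r j) = q r j" "f (up v) = f' v" for r j v
    by (auto simp: f_def up_def split: spine_vertex.split)
  have up_spine_adj [simp]: "spine_adj (up a) (up b) \<longleftrightarrow> spine_adj a b" "spine_adj (Spine 0) (up a) \<longleftrightarrow> a = Spine 0"
    "spine_adj (up a) (Spine 0) \<longleftrightarrow> a = Spine 0" "\<not> spine_adj (Pendant 0 r j) (up a)" "\<not> spine_adj (up a) (Pendant 0 r j)" for a b r j
    by (cases a; cases b; auto simp: up_def)+
  have verts: "v \<in> spine_verts (A # W) \<longleftrightarrow>
      v = Spine 0 \<or> (\<exists>r j. v = Pendant 0 r j \<and> r \<in> A \<and> j \<in> {1..r}) \<or> (\<exists>w \<in> spine_verts W. v = up w)" for v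
  proof (cases v)
    case (Spine i)
    have "(\<exists>w \<in> spine_verts W. v = up w) \<longleftrightarrow> (\<exists>k. i = Suc k \<and> k < length W)"
    proof
      assume "\<exists>w \<in> spine_verts W. v = up w"
      then obtain w where "w \<in> spine_verts W" "v = up w" by blast
      then show "\<exists>k. i = Suc k \<and> k < length W" using Spine by (cases w) (auto simp: up_def)
    next
      assume "\<exists>k. i = Suc k \<and> k < length W"
      then obtain k where "i = Suc k" "k < length W" by blast
      then show "\<exists>w \<in> spine_verts W. v = up w" using Spine by (intro bexI[of _ "Spine k"]) (auto simp: up_def)
    qed
    then show ?thesis using Spine by (cases i) auto
  next
    case (Pendant i r j)
    have "(\<exists>w \<in> spine_verts W. v = up w) \<longleftrightarrow> (\<exists>k. i = Suc k \<and> k < length W \<and> r \<in> W ! k \<and> 1 \<le> j \<and> j \<le> r)"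
    proof
      assume "\<exists>k. i = Suc k \<and> k < length W \<and> r \<in> W ! k \<and> 1 \<le> j \<and> j \<le> r"
      then obtain k where "i = Suc k" "Pendant k r j \<in> spine_verts W" by auto
      then show "\<exists>w \<in> spine_verts W. v = up w" using Pendant by (intro bexI[of _ "Pendant k r j"]) (auto simp: up_def)
    next
      assume "\<exists>w \<in> spine_verts W. v = up w"
      then obtain w where "w \<in> spine_verts W" "v = up w" by blast
      then show "\<exists>k. i = Suc k \<and> k < length W \<and> r \<in> W ! k \<and> 1 \<le> j \<and> j \<le> r"
        using Pendant by (cases w) (auto simp: up_def)
    qed
    then show ?thesis using Pendant by (cases i) auto
  qed
  have f'Z: "f' a \<in> Z" if "a \<in> spine_verts W" for a using f' that by (auto simp: embeds_def bij_betw_def)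
  have f'E: "spine_adj a b \<longleftrightarrow> (f' a, f' b) \<in> E" if "a \<in> spine_verts W" "b \<in> spine_verts W" for a b
    using f' that by (auto simp: embeds_def)
  have f'inj: "a = b" if "a \<in> spine_verts W" "b \<in> spine_verts W" "f' a = f' b" for a b
    using f' that by (auto simp: embeds_def bij_betw_def dest: inj_onD)
  have qP: "q r j \<in> P r" if "r \<in> A" "j \<in> {1..r}" for r j using q[OF that(1)] that(2) by (auto simp: bij_betw_def)
  have qinj: "i = j" if "r \<in> A" "i \<in> {1..r}" "j \<in> {1..r}" "q r i = q r j" for r i j
    using q[OF that(1)] that by (auto simp: bij_betw_def dest: inj_onD)
  have q2: "r = s \<and> i = j" if "r \<in> A" "s \<in> A" "i \<in> {1..r}" "j \<in> {1..s}" "q r i = q s j" for r s i j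
  proof -
    have "r = s" using disj(2)[OF that(1,2)] qP[OF that(1,3)] qP[OF that(2,4)] that(5) by auto
    then show ?thesis using qinj that by blast
  qed
  have sym': "(a, b) \<in> E \<longleftrightarrow> (b, a) \<in> E" for a b using sym by blast
  have yq_ne: "y \<noteq> q r j" if "r \<in> A" "j \<in> {1..r}" for r j using yP[OF that(1)] qP[OF that] by auto
  have yf_ne: "y \<noteq> f' a" if "a \<in> spine_verts W" for a using y f'Z[OF that] by auto
  have qf_ne: "q r j \<noteq> f' a" if "r \<in> A" "j \<in> {1..r}" "a \<in> spine_verts W" for r j a
    using qP[OF that(1,2)] f'Z[OF that(3)] disj(1)[OF that(1)] by auto
  have "inj_on f (spine_verts (A # W))"
  proof (rule inj_onI)
    fix a b assume ab: "a \<in> spine_verts (A # W)" "b \<in> spine_verts (A # W)" "f a = f b"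
    from ab(1)[unfolded verts] show "a = b"
    proof (elim disjE exE bexE conjE)
      assume a: "a = Spine 0"
      from ab(2)[unfolded verts] show ?thesis
        by (elim disjE exE bexE conjE) (use a ab(3) yq_ne yf_ne in simp_all)
    next
      fix r i assume a: "a = Pendant 0 r i" "r \<in> A" "i \<in> {1..r}"
      from ab(2)[unfolded verts] show ?thesis
      proof (elim disjE exE bexE conjE)
        assume "b = Spine 0" then show ?thesis using a ab(3) yq_ne[OF a(2,3)] by simp
      next
        fix s j assume b: "b = Pendant 0 s j" "s \<in> A" "j \<in> {1..s}"
        then show ?thesis using a ab(3) q2[OF a(2) b(2) a(3) b(3)] by simp
      next
        fix w assume w: "w \<in> spine_verts W" "b = up w"
        then show ?thesis using a ab(3) qf_ne[OF a(2,3) w(1)] by simp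
      qed
    next
      fix v assume a: "v \<in> spine_verts W" "a = up v"
      from ab(2)[unfolded verts] show ?thesis
      proof (elim disjE exE bexE conjE)
        assume "b = Spine 0" then show ?thesis using a ab(3) yf_ne[OF a(1)] by simp
      next
        fix s j assume b: "b = Pendant 0 s j" "s \<in> A" "j \<in> {1..s}"
        then show ?thesis using a ab(3) qf_ne[OF b(2,3) a(1)] by simp
      next
        fix w assume w: "w \<in> spine_verts W" "b = up w"
        then show ?thesis using a ab(3) f'inj[OF a(1) w(1)] by simp
      qed
    qed
  qed
  moreover have "f ` spine_verts (A # W) = insert y ((\<Union>r\<in>A. P r) \<union> Z)"
  proof -
    have "P r = q r ` {1..r}" if "r \<in> A" for r using q[OF that] by (simp add: bij_betw_def)
    then have PU: "(\<Union>r\<in>A. P r) = {q r j | r j. r \<in> A \<and> j \<in> {1..r}}" by blast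
    have Z: "Z = f' ` spine_verts W" using f' by (simp add: embeds_def bij_betw_def)
    have S: "spine_verts (A # W) = insert (Spine 0) ({Pendant 0 r j | r j. r \<in> A \<and> j \<in> {1..r}} \<union> up ` spine_verts W)"
      using verts by blast
    have "f ` {Pendant 0 r j | r j. r \<in> A \<and> j \<in> {1..r}} = {q r j | r j. r \<in> A \<and> j \<in> {1..r}}"
    proof (intro set_eqI iffI)
      fix v assume "v \<in> {q r j | r j. r \<in> A \<and> j \<in> {1..r}}"
      then obtain r j where "v = q r j" "r \<in> A" "j \<in> {1..r}" by blast
      then show "v \<in> f ` {Pendant 0 r j | r j. r \<in> A \<and> j \<in> {1..r}}"
        by (intro image_eqI[of _ _ "Pendant 0 r j"]) simp_all
    next
      fix v assume "v \<in> f ` {Pendant 0 r j | r j. r \<in> A \<and> j \<in> {1..r}}"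
      then obtain r j where "v = f (Pendant 0 r j)" "r \<in> A" "j \<in> {1..r}" by blast
      then show "v \<in> {q r j | r j. r \<in> A \<and> j \<in> {1..r}}" unfolding f_simps by blast
    qed
    then show ?thesis unfolding S PU Z by (simp add: image_Un image_image)
  qed
  moreover have "spine_adj a b \<longleftrightarrow> (f a, f b) \<in> E" if "a \<in> spine_verts (A # W)" "b \<in> spine_verts (A # W)" for a b
    using that(1)[unfolded verts] 
  proof (elim disjE exE bexE conjE)
    assume a: "a = Spine 0"
    from that(2)[unfolded verts] show ?thesis
      by (elim disjE exE bexE conjE) (simp_all add: a irrefl yZ yq)
  next
    fix r i assume a: "a = Pendant 0 r i" "r \<in> A" "i \<in> {1..r}"
    from that(2)[unfolded verts] show ?thesis
    proof (elim disjE exE bexE conjE)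
      assume "b = Spine 0" then show ?thesis using a yq sym' by simp
    next
      fix s j assume b: "b = Pendant 0 s j" "s \<in> A" "j \<in> {1..s}"
      show ?thesis using a b qq[of r i j] noedge(2)[of r s "q r i" "q s j"] qP by (cases "r = s") auto
    next
      fix w assume "w \<in> spine_verts W" "b = up w"
      then show ?thesis using a noedge(1)[OF a(2) qP[OF a(2,3)] f'Z] by simp
    qed
  next
    fix v assume a: "v \<in> spine_verts W" "a = up v"
    from that(2)[unfolded verts] show ?thesis
    proof (elim disjE exE bexE conjE)
      assume "b = Spine 0" then show ?thesis using a yZ sym' by simp
    next
      fix s j assume b: "b = Pendant 0 s j" "s \<in> A" "j \<in> {1..s}"
      then show ?thesis using a noedge(1)[OF b(2) qP[OF b(2,3)] f'Z[OF a(1)]] sym' by simp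
    next
      fix w assume "w \<in> spine_verts W" "b = up w"
      then show ?thesis using a f'E by simp
    qed
  qed
  ultimately have "embeds E (A # W) f (insert y ((\<Union>r\<in>A. P r) \<union> Z))" by (simp add: embeds_def bij_betw_def)
  then show ?thesis by (intro exI[of _ f]) simp
qed

lemma spine_verts_Nil [simp]: "spine_verts [] = {}"
  by (simp add: spine_tree_def)

lemma embeds_Nil: "embeds E [] f {}"
  by (simp add: embeds_def bij_betw_def)

section \<open>Trees whose leaves form a long cycle\<close>

definition (in rel_tree) far5 :: "'v \<Rightarrow> 'v \<Rightarrow> bool" where
  "far5 u v \<longleftrightarrow> u \<in> lf \<and> v \<in> lf \<and> d u v = 5"

locale leaf_cycle = rel_tree V E for V :: "'v set" and E :: "'v rel" +
  assumes long: "long_cycle lf far5"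
begin

interpretation long_cycle lf far5 by (rule long)

text \<open>
  Every branch contains a leaf. A branch with exactly one is a pendant path; a branch with more of them
  has to contain a further part of the spine.
\<close>

definition lone :: "'v \<Rightarrow> 'v \<Rightarrow> 'v \<Rightarrow> bool" where
  "lone x y v \<longleftrightarrow> (x, y) \<in> E \<and> side x y \<inter> lf = {v}"

definition rich :: "'v \<Rightarrow> 'v \<Rightarrow> bool" where
  "rich x y \<longleftrightarrow> (x, y) \<in> E \<and> (\<exists>u v. u \<in> side x y \<inter> lf \<and> v \<in> side x y \<inter> lf \<and> u \<noteq> v)"

lemma lone_or_rich:
  assumes "(x, y) \<in> E" shows "rich x y \<or> (\<exists>v. lone x y v)"
proof -
  obtain v where v: "v \<in> side x y \<inter> lf" using side_has_leaf[OF assms] by blast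
  show ?thesis
  proof (cases "side x y \<inter> lf = {v}")
    case True then show ?thesis using assms by (auto simp: lone_def)
  next
    case False
    then obtain u where "u \<in> side x y \<inter> lf" "u \<noteq> v" using v by blast
    then show ?thesis using assms v unfolding rich_def by blast
  qed
qed

lemma d_through:
  assumes "(x, y) \<in> E" "u \<in> side x y" "v \<in> V" "v \<notin> side x y"
  shows "d u v = d x u + d x v" "d v u = d x u + d x v"
proof -
  have v: "v \<in> side y x" using side_union[OF assms(1)] assms(3,4) by blast
  have V: "x \<in> V" "u \<in> V" using E_V[OF assms(1)] side_V[OF assms(1)] assms(2) by auto
  have "d v u = d v x + 1 + d y u" by (rule d_cross[OF assms(1) v assms(2)])
  then show "d v u = d x u + d x v" using d_side[OF assms(1,2)] d_sym[OF V(1) assms(3)] by simp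
  then show "d u v = d x u + d x v" using d_sym[OF V(2) assms(3)] by simp
qed

lemma d_one: "x \<in> V \<Longrightarrow> v \<in> V \<Longrightarrow> d x v = 1 \<Longrightarrow> (x, v) \<in> E"
  using relpow_finite[of x v] by simp

text \<open>Two leaves at the same vertex have equal distances to all other leaves, hence the same two neighbours.\<close>

lemma twins:
  assumes "u \<in> lf" "v \<in> lf" "(p, u) \<in> E" "(p, v) \<in> E"
  shows "u = v"
proof (rule ccontr)
  assume "u \<noteq> v"
  have u: "d u w = d p w + 1" if "w \<in> V" "w \<noteq> u" for w using leaf_branch[OF assms(1) sym_E[OF assms(3)] that] .
  have v: "d v w = d p w + 1" if "w \<in> V" "w \<noteq> v" for w using leaf_branch[OF assms(2) sym_E[OF assms(4)] that] .
  obtain a b where ab: "a \<in> lf" "b \<in> lf" "a \<noteq> b" "far5 u a" "far5 u b" using two_nbrs[OF assms(1)] by blast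
  have p: "p \<in> V" "u \<in> V" "v \<in> V" using E_V assms by auto
  have "p \<noteq> v" using E_neq[OF assms(4)] .
  have "d v p = 1" using v[OF p(1)] \<open>p \<noteq> v\<close> by simp
  then have "d p v = 1" using d_sym[OF p(1,3)] by simp
  then have "d u v = 2" using u[OF p(3)] \<open>u \<noteq> v\<close> by simp
  then have av: "a \<noteq> v" "b \<noteq> v" using ab by (auto simp: far5_def)
  have au: "a \<noteq> u" "b \<noteq> u" using ab irrefl by auto
  have "d v a = 5" "d v b = 5"
    using u[of a] u[of b] v[of a] v[of b] av au ab by (auto simp: far5_def lf_V)
  then have "far5 v a" "far5 v b" using ab assms by (auto simp: far5_def)
  then show False using no_four_cycle[of u v a b] ab \<open>u \<noteq> v\<close> assms by auto
qed

definition branch_of :: "'v \<Rightarrow> 'v \<Rightarrow> 'v" where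
  "branch_of x v = (THE y. (x, y) \<in> E \<and> v \<in> side x y)"

lemma branch_of_eq: "(x, y) \<in> E \<Longrightarrow> v \<in> side x y \<Longrightarrow> branch_of x v = y"
  unfolding branch_of_def using side_unique[of x] by blast

lemma branches_at:
  assumes x: "x \<in> V" "x \<notin> lf"
  shows "branches lf far5 (branch_of x) (d x)"
proof
  have br: "(x, branch_of x u) \<in> E \<and> u \<in> side x (branch_of x u)" if u: "u \<in> lf" for u
  proof -
    have "u \<noteq> x" using u x by auto
    then obtain y where "(x, y) \<in> E" "u \<in> side x y" using side_exists[OF x(1) lf_V[OF u]] by metis
    then show ?thesis using branch_of_eq by simp
  qed
  fix u v assume u: "u \<in> lf" 
  show "1 \<le> d x u" using br[OF u] d_side by fastforce
  assume v: "v \<in> lf"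
  {
    assume "branch_of x u \<noteq> branch_of x v"
    then have "v \<notin> side x (branch_of x u)" using br[OF u] branch_of_eq[of x "branch_of x u" v] by auto
    then have "d u v = d x u + d x v" using d_through(1)[of x "branch_of x u" u v] br[OF u] lf_V[OF v] by blast
    then show "far5 u v \<longleftrightarrow> d x u + d x v = 5" using u v by (simp add: far5_def)
  }
  {
    assume 1: "d x u = 1" and "d x v = 1 \<or> branch_of x v = branch_of x u"
    have xu: "(x, u) \<in> E" by (rule d_one[OF x(1) lf_V[OF u] 1])
    show "u = v"
    proof (cases "d x v = 1")
      case True
      then show ?thesis using twins[OF u v xu] d_one[OF x(1) lf_V[OF v]] by blast
    next
      case False
      then have "branch_of x v = u" using \<open>d x v = 1 \<or> _\<close> branch_of_eq[OF xu side_self] by simp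
      then show ?thesis using br[OF v] side_lf[OF xu u] by simp
    qed
  }
  {
    assume 2: "d x u = 2" "d x v = 2" "branch_of x u = branch_of x v"
    let ?y = "branch_of x u"
    have y: "(x, ?y) \<in> E" "u \<in> side x ?y" "v \<in> side x ?y" using br[OF u] br[OF v] 2 by auto
    have "d ?y u = 1" "d ?y v = 1" using d_side[OF y(1,2)] d_side[OF y(1,3)] 2 by auto
    then show "u = v" using twins[OF u v] d_one[OF E_V(2)[OF y(1)]] lf_V u v by blast
  }
qed

lemma not_three_rich:
  assumes "rich x i" "rich x j" "rich x k" "i \<noteq> j" "i \<noteq> k" "j \<noteq> k"
  shows False
proof -
  have e: "(x, i) \<in> E" "(x, j) \<in> E" using assms by (auto simp: rich_def)
  have x: "x \<in> V" "x \<notin> lf" using E_V[OF e(1)] lf_nbr[of x, OF _ e] assms(4) by auto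
  interpret branches lf far5 "branch_of x" "d x" by (rule branches_at[OF x])
  have "nontrivial y" if rich: "rich x y" for y
  proof -
    obtain u v where "(x, y) \<in> E" "u \<in> side x y" "v \<in> side x y" "u \<in> lf" "v \<in> lf" "u \<noteq> v"
      using rich by (auto simp: rich_def)
    then show ?thesis using branch_of_eq[of x y] unfolding nontrivial_def by blast
  qed
  then show False using not_three_nontrivial assms by blast
qed

text \<open>
  Both neighbours of \<open>v\<close> are at distance \<open>5 - d x v\<close> from \<open>x\<close>, and at distance 0 or 1 there is room for one
  leaf only.
\<close>

lemma lone_length:
  assumes "lone x y v" shows "d x v \<in> {1, 2, 3}"
proof -
  have e: "(x, y) \<in> E" and v: "v \<in> lf" "v \<in> side x y" and only: "\<And>u. u \<in> side x y \<Longrightarrow> u \<in> lf \<Longrightarrow> u = v"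
    using assms by (auto simp: lone_def)
  obtain a b where ab: "a \<in> lf" "b \<in> lf" "a \<noteq> b" "far5 v a" "far5 v b" using two_nbrs[OF v(1)] by blast
  have "a \<noteq> v" "b \<noteq> v" using ab irrefl by auto
  then have out: "a \<notin> side x y" "b \<notin> side x y" using only ab by blast+
  have x: "x \<in> V" using E_V[OF e] by blast
  have sum: "d x v + d x a = 5" "d x v + d x b = 5"
    using d_through(1)[OF e v(2) lf_V out(1)] d_through(1)[OF e v(2) lf_V out(2)] ab by (auto simp: far5_def)
  have "d x a \<noteq> 0"
  proof
    assume "d x a = 0"
    then have "d x b = 0" using sum by simp
    then show False using d_zero[OF x lf_V] \<open>d x a = 0\<close> ab by metis
  qed
  moreover have "d x a \<noteq> 1"
  proof
    assume "d x a = 1"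
    then have "d x b = 1" using sum by simp
    then show False using twins[OF ab(1,2)] d_one[OF x lf_V] \<open>d x a = 1\<close> ab by blast
  qed
  moreover have "1 \<le> d x v" using d_side[OF e v(2)] by simp
  ultimately show ?thesis using sum by auto
qed

text \<open>Otherwise \<open>v\<close> and \<open>v'\<close> would have the same two neighbours.\<close>

lemma lone_distinct:
  assumes "lone x y v" "lone x y' v'" "d x v = d x v'"
  shows "y = y'"
proof (rule ccontr)
  assume ne: "y \<noteq> y'"
  have e: "(x, y) \<in> E" "(x, y') \<in> E" and v: "v \<in> lf" "v \<in> side x y" "v' \<in> lf" "v' \<in> side x y'"
    and only: "\<And>u. u \<in> side x y \<Longrightarrow> u \<in> lf \<Longrightarrow> u = v" "\<And>u. u \<in> side x y' \<Longrightarrow> u \<in> lf \<Longrightarrow> u = v'"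
    using assms by (auto simp: lone_def)
  have vv': "v' \<notin> side x y" "v \<noteq> v'" using side_unique[OF e] v ne by blast+
  have n: "far5 v' a" if a: "far5 v a" for a
  proof -
    have aL: "a \<in> lf" "d v a = 5" using a by (auto simp: far5_def)
    have "a \<noteq> v" using a irrefl by auto
    then have out: "a \<notin> side x y" using only(1) aL by blast
    have "d v v' = d x v + d x v'" by (rule d_through(1)[OF e(1) v(2) lf_V[OF v(3)] vv'(1)])
    then have "a \<noteq> v'" using aL assms(3) by (auto simp: mult_2[symmetric]) presburger
    then have out': "a \<notin> side x y'" using only(2) aL by blast
    have "d v a = d x v + d x a" by (rule d_through(1)[OF e(1) v(2) lf_V[OF aL(1)] out])
    moreover have "d v' a = d x v' + d x a" by (rule d_through(1)[OF e(2) v(4) lf_V[OF aL(1)] out'])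
    ultimately show ?thesis using aL v assms(3) by (simp add: far5_def)
  qed
  obtain a b where ab: "a \<in> lf" "b \<in> lf" "a \<noteq> b" "far5 v a" "far5 v b" using two_nbrs[OF v(1)] by blast
  then show False using no_four_cycle[of v v' a b] n v vv' by blast
qed

lemma lone_path:
  assumes "lone x y v"
  shows "\<exists>q. bij_betw q {1..d x v} (side x y) \<and> q 1 = y \<and>
    (\<forall>i\<in>{1..d x v}. \<forall>j\<in>{1..d x v}. (q i, q j) \<in> E \<longleftrightarrow> j = i + 1 \<or> i = j + 1)"
  using assms
proof (induction "card (side x y)" arbitrary: x y rule: less_induct)
  case less
  have e: "(x, y) \<in> E" and v: "v \<in> lf" "v \<in> side x y" and only: "\<And>u. u \<in> side x y \<Longrightarrow> u \<in> lf \<Longrightarrow> u = v"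
    using less.prems by (auto simp: lone_def)
  show ?case
  proof (cases "y \<in> lf")
    case True
    then have S: "side x y = {y}" and "v = y" using side_lf[OF e] only[of y] by auto
    then have "d x v = 1" using d_side[OF e v(2)] by simp
    then show ?thesis using S irrefl_E by (intro exI[of _ "\<lambda>_. y"]) (auto simp: bij_betw_def)
  next
    case False
    then obtain z where z: "(y, z) \<in> E" "z \<noteq> x" using lfI[OF e] by blast
    have leafz: "side y t \<inter> lf = {v}" if "(y, t) \<in> E" "t \<noteq> x" for t
      using side_nested(1)[OF e that] side_has_leaf[OF that(1)] only by blast
    have "t = z" if "(y, t) \<in> E" "t \<noteq> x" for t
      using side_unique[OF that(1) z(1), of v] leafz[OF that] leafz[OF z] by blast
    then have "{t. (y, t) \<in> E \<and> t \<noteq> x} = {z}" using z by blast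
    then have S: "side x y = insert y (side y z)" using side_unfold[OF e] by simp
    have lz: "lone y z v" using z leafz[OF z] by (simp add: lone_def)
    have r: "d x v = Suc (d y v)" using d_side[OF e v(2)] by simp
    obtain q where q: "bij_betw q {1..d y v} (side y z)" "q 1 = z"
      "\<And>i j. i \<in> {1..d y v} \<Longrightarrow> j \<in> {1..d y v} \<Longrightarrow> (q i, q j) \<in> E \<longleftrightarrow> j = i + 1 \<or> i = j + 1"
      using less.hyps[OF side_nested_less[OF e z] lz] by blast
    have y: "y \<notin> side y z" by (rule not_side_self[OF z(1)])
    have d1: "1 \<le> d y v" using lone_length[OF lz] by auto
    define p where "p i = (if i = 1 then y else q (i - 1))" for i
    have I: "{1..d x v} = insert 1 (Suc ` {1..d y v})"
      unfolding r by (auto simp: image_iff Suc_le_eq)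
    have "bij_betw p {1..d x v} (side x y)" unfolding I S
    proof (rule bij_betw_imageI)
      show "inj_on p (insert 1 (Suc ` {1..d y v}))"
        using q(1) y unfolding bij_betw_def p_def inj_on_def by fastforce
      show "p ` insert 1 (Suc ` {1..d y v}) = insert y (side y z)"
      proof -
        have "p ` Suc ` {1..d y v} = q ` {1..d y v}"
          unfolding image_image by (rule image_cong) (auto simp: p_def)
        moreover have "q ` {1..d y v} = side y z" using q(1) by (simp add: bij_betw_def)
        moreover have "p 1 = y" by (simp add: p_def)
        ultimately show ?thesis by (simp only: image_insert)
      qed
    qed
    moreover have "(y, q i) \<in> E \<longleftrightarrow> i = 1" if "i \<in> {1..d y v}" for i
    proof
      assume yq: "(y, q i) \<in> E"
      have "q i \<in> side y z" using q(1) that by (auto simp: bij_betw_def)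
      then have "q i = q 1" using side_unique[OF yq z(1) side_self] q(2) by simp
      then show "i = 1" using q(1) that d1 by (auto simp: bij_betw_def dest: inj_onD)
    qed (use q(2) z in simp)
    then have yq: "(y, q i) \<in> E \<longleftrightarrow> i = 1" "(q i, y) \<in> E \<longleftrightarrow> i = 1" if "i \<in> {1..d y v}" for i
      using that sym_E by blast+
    have "(p i, p j) \<in> E \<longleftrightarrow> j = i + 1 \<or> i = j + 1" if ij: "i \<in> {1..d x v}" "j \<in> {1..d x v}" for i j
    proof -
      obtain k m where km: "i = Suc k" "j = Suc m" using ij by (cases i; cases j) auto
      then have kr: "k = 0 \<or> k \<in> {1..d y v}" "m = 0 \<or> m \<in> {1..d y v}" using ij r by auto
      have "p i = (if k = 0 then y else q k)" "p j = (if m = 0 then y else q m)" by (auto simp: p_def km)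
      then show ?thesis using kr yq[of k] yq[of m] q(3)[of k m] irrefl_E unfolding km
        by (cases "k = 0"; cases "m = 0") auto
    qed
    moreover have "p 1 = y" by (simp add: p_def)
    ultimately show ?thesis by blast
  qed
qed

text \<open>The branches in \<open>N\<close> become the pendant paths at \<open>y\<close>; different branches have different lengths.\<close>

lemma assemble:
  assumes y: "y \<in> V" and N: "\<And>t. t \<in> N \<Longrightarrow> lone y t (leaf t)"
    and W: "embeds E W f' Z" "y \<notin> Z" "\<And>t. t \<in> N \<Longrightarrow> side y t \<inter> Z = {}"
      "\<And>a. a \<in> spine_verts W \<Longrightarrow> (y, f' a) \<in> E \<longleftrightarrow> a = Spine 0"
  shows "\<exists>A f. A \<subseteq> {1,2,3} \<and> card A = card N \<and> finite N \<and>
    embeds E (A # W) f (insert y ((\<Union>t\<in>N. side y t) \<union> Z)) \<and> f (Spine 0) = y"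
proof -
  define len where "len t = d y (leaf t)" for t
  have inj: "inj_on len N"
    using N lone_distinct unfolding len_def by (intro inj_onI) blast
  define A where "A = len ` N"
  have A: "A \<subseteq> {1,2,3}" using N lone_length unfolding A_def len_def by blast
  then have fin: "finite N" using inj unfolding A_def by (metis finite.emptyI finite_insert finite_subset finite_imageD)
  have cardA: "card A = card N" unfolding A_def by (rule card_image[OF inj])
  define leg where "leg = inv_into N len"
  have leg: "leg r \<in> N" "len (leg r) = r" if "r \<in> A" for r
    using that inv_into_into[of r len N] f_inv_into_f[of r len N] by (auto simp: leg_def A_def)
  have legE: "(y, leg r) \<in> E" if "r \<in> A" for r using N[OF leg(1)[OF that]] by (simp add: lone_def)
  have leg_ne: "leg r \<noteq> leg s" if "r \<in> A" "s \<in> A" "r \<noteq> s" for r s using leg[OF that(1)] leg[OF that(2)] that(3) by auto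
  have "\<forall>r\<in>A. \<exists>q. bij_betw q {1..r} (side y (leg r)) \<and> q 1 = leg r \<and>
    (\<forall>i\<in>{1..r}. \<forall>j\<in>{1..r}. (q i, q j) \<in> E \<longleftrightarrow> j = i + 1 \<or> i = j + 1)"
  proof
    fix r assume r: "r \<in> A"
    show "\<exists>q. bij_betw q {1..r} (side y (leg r)) \<and> q 1 = leg r \<and>
      (\<forall>i\<in>{1..r}. \<forall>j\<in>{1..r}. (q i, q j) \<in> E \<longleftrightarrow> j = i + 1 \<or> i = j + 1)"
      using lone_path[OF N[OF leg(1)[OF r]]] leg(2)[OF r] unfolding len_def by simp
  qed
  from bchoice[OF this] obtain q where q: "\<And>r. r \<in> A \<Longrightarrow> bij_betw (q r) {1..r} (side y (leg r))" "\<And>r. r \<in> A \<Longrightarrow> q r 1 = leg r"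
    "\<And>r i j. r \<in> A \<Longrightarrow> i \<in> {1..r} \<Longrightarrow> j \<in> {1..r} \<Longrightarrow> (q r i, q r j) \<in> E \<longleftrightarrow> j = i + 1 \<or> i = j + 1"
    by blast
  have no_edge: "(a, b) \<notin> E" if "r \<in> A" "a \<in> side y (leg r)" "b \<notin> side y (leg r)" "b \<noteq> y" for r a b
    using leave_side[OF legE[OF that(1)] that(2) _ that(3)] that(4) by blast
  have "\<exists>f. embeds E (A # W) f (insert y ((\<Union>r\<in>A. side y (leg r)) \<union> Z)) \<and> f (Spine 0) = y"
  proof (rule embeds_Cons[OF W(1,2) q(1)])
    fix r assume r: "r \<in> A"
    show "y \<notin> side y (leg r)" by (rule not_side_self[OF legE[OF r]])
    show "side y (leg r) \<inter> Z = {}" by (rule W(3)[OF leg(1)[OF r]])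
    show "(y, q r j) \<in> E \<longleftrightarrow> j = 1" if j: "j \<in> {1..r}" for j
    proof
      assume yq: "(y, q r j) \<in> E"
      have "q r j \<in> side y (leg r)" using q(1)[OF r] j by (auto simp: bij_betw_def)
      then have "q r j = q r 1" using side_unique[OF yq legE[OF r] side_self] q(2)[OF r] by simp
      then show "j = 1" using q(1)[OF r] j by (auto simp: bij_betw_def dest: inj_onD)
    qed (use q(2)[OF r] legE[OF r] in simp)
    show "(a, b) \<notin> E" if "a \<in> side y (leg r)" "b \<in> Z" for a b
      using no_edge[OF r that(1)] W(2,3) leg(1)[OF r] that by blast
    fix s assume s: "s \<in> A" "r \<noteq> s"
    show disj: "side y (leg r) \<inter> side y (leg s) = {}"
      by (rule sides_disjoint[OF legE[OF r] legE[OF s(1)] leg_ne[OF r s]])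
    show "(a, b) \<notin> E" if "a \<in> side y (leg r)" "b \<in> side y (leg s)" for a b
      using no_edge[OF r that(1)] disj that not_side_self[OF legE[OF s(1)]] by blast
  qed (use q(3) W(4) sym_E irrefl_E in \<open>simp_all\<close>)
  moreover have "(\<Union>r\<in>A. side y (leg r)) = (\<Union>t\<in>N. side y t)"
  proof -
    have "leg ` A = N" unfolding leg_def A_def using inj by (simp add: inv_into_image_cancel)
    then show ?thesis by (metis image_image)
  qed
  ultimately show ?thesis using A cardA fin by auto
qed

lemma lone_leaf: "lone x y v \<Longrightarrow> lone x y (THE v. lone x y v)"
proof -
  assume l: "lone x y v"
  then have "(THE v. lone x y v) = v" unfolding lone_def by auto
  then show ?thesis using l by simp
qed

lemma embeds_side_edge:
  assumes "embeds E W f (side y z)" "f (Spine 0) = z" "(y, z) \<in> E" "a \<in> spine_verts W" "W \<noteq> []"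
  shows "(y, f a) \<in> E \<longleftrightarrow> a = Spine 0"
proof
  assume e: "(y, f a) \<in> E"
  have "f a \<in> side y z" using assms(1,4) by (auto simp: embeds_def bij_betw_def)
  then have "f a = f (Spine 0)" using side_unique[OF e assms(3) side_self] assms(2) by simp
  moreover have "Spine 0 \<in> spine_verts W" using assms(5) by simp
  ultimately show "a = Spine 0" using assms(1,4) by (auto simp: embeds_def bij_betw_def dest: inj_onD)
qed (use assms in simp)

lemma rich_lone_count:
  assumes r: "rich x y" and l: "\<And>t. (y, t) \<in> E \<Longrightarrow> t \<noteq> x \<Longrightarrow> \<exists>v. lone y t v"
    and fin: "finite {t. (y, t) \<in> E \<and> t \<noteq> x}"
  shows "2 \<le> card {t. (y, t) \<in> E \<and> t \<noteq> x}" "card (side x y \<inter> lf) \<le> card {t. (y, t) \<in> E \<and> t \<noteq> x}"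
proof -
  let ?N = "{t. (y, t) \<in> E \<and> t \<noteq> x}"
  obtain u v where e: "(x, y) \<in> E" and uv: "u \<in> side x y \<inter> lf" "v \<in> side x y \<inter> lf" "u \<noteq> v"
    using r by (auto simp: rich_def)
  have "y \<notin> lf" using side_lf[OF e] uv by auto
  then have ex: "\<exists>t\<in>?N. w \<in> side y t" if "w \<in> side x y \<inter> lf" for w
    using that side_unfold[OF e] by auto
  obtain s t where st: "s \<in> ?N" "u \<in> side y s" "t \<in> ?N" "v \<in> side y t" using ex uv by meson
  have "s \<noteq> t"
  proof
    assume "s = t"
    obtain w where "lone y s w" using l st(1) by blast
    then have w: "side y s \<inter> lf = {w}" by (simp add: lone_def)
    have "u \<in> side y s \<inter> lf" "v \<in> side y s \<inter> lf" using st uv \<open>s = t\<close> by simp_all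
    then show False unfolding w using uv(3) by simp
  qed
  then have "card {s, t} = 2" by simp
  moreover have "card {s, t} \<le> card ?N" using st fin by (intro card_mono) auto
  ultimately show "2 \<le> card ?N" by simp
  define leaf where "leaf t = (THE v. lone y t v)" for t
  have "side x y \<inter> lf \<subseteq> leaf ` ?N"
  proof
    fix w assume w: "w \<in> side x y \<inter> lf"
    then obtain t where t: "t \<in> ?N" "w \<in> side y t" using ex by blast
    then obtain v where "lone y t v" using l by blast
    then have "lone y t (leaf t)" unfolding leaf_def by (rule lone_leaf)
    then have "side y t \<inter> lf = {leaf t}" by (simp add: lone_def)
    then have "w = leaf t" using t w by blast
    then show "w \<in> leaf ` ?N" using t by blast
  qed
  then show "card (side x y \<inter> lf) \<le> card ?N" using surj_card_le[OF fin] by blast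
qed

lemma finite_nbrs_E: "finite {t. (y, t) \<in> E \<and> P t}"
  by (rule finite_subset[OF _ finite_V]) (use E_V in blast)

definition hanging_spine :: "spine_word \<Rightarrow> (spine_vertex \<Rightarrow> 'v) \<Rightarrow> 'v set \<Rightarrow> 'v \<Rightarrow> bool" where
  "hanging_spine W f Z y \<longleftrightarrow> embeds E W f Z \<and> f (Spine 0) = y \<and> W \<noteq> [] \<and> proper_word W \<and> 2 \<le> card (last W)"

text \<open>
  Seen from \<open>y\<close> the branch back to \<open>x\<close> is rich, so at most one of the others is. The spine continues into
  that branch, and it ends where all other branches are pendant paths.
\<close>

lemma hanging_part:
  assumes "rich x y" "rich y x"
  shows "\<exists>W f. hanging_spine W f (side x y) y"
  using assms
proof (induction "card (side x y)" arbitrary: x y rule: less_induct)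
  case less
  have e: "(x, y) \<in> E" using less.prems by (simp add: rich_def)
  let ?leaf = "\<lambda>t. THE v. lone y t v"
  have yV: "y \<in> V" using E_V[OF e] by blast
  show ?case
  proof (cases "\<exists>z. rich y z \<and> z \<noteq> x")
    case False
    let ?N = "{t. (y, t) \<in> E \<and> t \<noteq> x}"
    have l: "\<exists>v. lone y t v" if "(y, t) \<in> E" "t \<noteq> x" for t using lone_or_rich that False by blast
    have N: "lone y t (?leaf t)" if "t \<in> ?N" for t using l that lone_leaf by blast
    have "\<exists>A f. A \<subseteq> {1,2,3} \<and> card A = card ?N \<and> finite ?N \<and>
      embeds E [A] f (insert y ((\<Union>t\<in>?N. side y t) \<union> {})) \<and> f (Spine 0) = y"
      by (rule assemble[OF yV N embeds_Nil]) simp_all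
    then obtain A f where A: "A \<subseteq> {1,2,3}" "card A = card ?N" "embeds E [A] f (insert y ((\<Union>t\<in>?N. side y t) \<union> {}))" "f (Spine 0) = y"
      by blast
    moreover have "insert y ((\<Union>t\<in>?N. side y t) \<union> {}) = side x y" using side_unfold[OF e] by simp
    moreover have "2 \<le> card A" using rich_lone_count(1)[OF less.prems(1) l finite_nbrs_E] A(2) by simp
    ultimately have "hanging_spine [A] f (side x y) y" by (simp add: hanging_spine_def)
    then show ?thesis by blast
  next
    case True
    then obtain z where z: "rich y z" "z \<noteq> x" by blast
    then have yz: "(y, z) \<in> E" by (simp add: rich_def)
    have "rich z y" using less.prems(2) side_nested(1)[OF sym_E[OF yz] sym_E[OF e]] z(2) sym_E[OF yz] unfolding rich_def by blast
    then obtain W f' where W: "hanging_spine W f' (side y z) z"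
      using less.hyps[OF side_nested_less[OF e yz z(2)] z(1)] by blast
    let ?N = "{t. (y, t) \<in> E \<and> t \<noteq> x} - {z}"
    have l: "\<exists>v. lone y t v" if "t \<in> ?N" for t
      using lone_or_rich[of y t] not_three_rich[OF less.prems(2) z(1), of t] that z(2) by blast
    have N: "lone y t (?leaf t)" if "t \<in> ?N" for t using l[OF that] lone_leaf by blast
    have "\<exists>A f. A \<subseteq> {1,2,3} \<and> card A = card ?N \<and> finite ?N \<and>
      embeds E (A # W) f (insert y ((\<Union>t\<in>?N. side y t) \<union> side y z)) \<and> f (Spine 0) = y"
    proof (rule assemble[OF yV N])
      show "embeds E W f' (side y z)" using W by (simp add: hanging_spine_def)
      show "y \<notin> side y z" by (rule not_side_self[OF yz])
      show "side y t \<inter> side y z = {}" if "t \<in> ?N" for t using sides_disjoint[OF _ yz] that by blast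
      show "(y, f' a) \<in> E \<longleftrightarrow> a = Spine 0" if "a \<in> spine_verts W" for a
        using embeds_side_edge[OF _ _ yz that] W by (simp add: hanging_spine_def)
    qed
    then obtain A f where A: "A \<subseteq> {1,2,3}" "embeds E (A # W) f (insert y ((\<Union>t\<in>?N. side y t) \<union> side y z))" "f (Spine 0) = y" by blast
    moreover have "insert y ((\<Union>t\<in>?N. side y t) \<union> side y z) = side x y" using side_unfold[OF e] yz z(2) by blast
    ultimately have "hanging_spine (A # W) f (side x y) y" using W by (simp add: hanging_spine_def)
    then show ?thesis by blast
  qed
qed

text \<open>Going from rich branch to rich branch ends, because the branches shrink.\<close>

lemma end_vertex:
  assumes "rich x y"
  shows "\<exists>x' y'. rich x' y' \<and> (\<forall>t. (y', t) \<in> E \<longrightarrow> t \<noteq> x' \<longrightarrow> (\<exists>v. lone y' t v))"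
  using assms
proof (induction "card (side x y)" arbitrary: x y rule: less_induct)
  case less
  have e: "(x, y) \<in> E" using less.prems by (simp add: rich_def)
  show ?case
  proof (cases "\<exists>z. rich y z \<and> z \<noteq> x")
    case True
    then obtain z where z: "rich y z" "z \<noteq> x" by blast
    then have "(y, z) \<in> E" by (simp add: rich_def)
    from less.hyps[OF side_nested_less[OF e this z(2)] z(1)] show ?thesis .
  next
    case False
    then show ?thesis using less.prems lone_or_rich by blast
  qed
qed

lemma richI:
  assumes "(x, y) \<in> E" "2 \<le> card (side x y \<inter> lf)" shows "rich x y"
proof -
  obtain v where v: "v \<in> side x y \<inter> lf" using side_has_leaf[OF assms(1)] by blast
  have "side x y \<inter> lf \<noteq> {v}" using assms(2) by auto
  then show ?thesis using v assms(1) unfolding rich_def by blast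
qed

text \<open>
  An end vertex \<open>y\<close> has pendant paths of different lengths up to 3 and at most one further branch. With
  at least seven leaves in total, this branch is rich and contains the rest of the spine.
\<close>

theorem embeds_spine_tree:
  "\<exists>W f. embeds E W f V \<and> proper_word W \<and> 2 \<le> length W \<and> 2 \<le> card (hd W) \<and> 2 \<le> card (last W)"
proof -
  have fin: "finite lf" using finite_V by (simp add: lf_def)
  have "lf \<noteq> {}" using card by auto
  then obtain v p where v: "v \<in> lf" "(v, p) \<in> E" using lf_obtain_nbr by blast
  have vV: "v \<in> V" using v lf_V by blast
  have "side p v = {v}" by (rule side_lf[OF sym_E[OF v(2)] v(1)])
  then have "side v p \<inter> lf = lf - {v}" using side_union[OF v(2)] side_disjoint[OF v(2)] lf_V by blast
  then have "6 \<le> card (side v p \<inter> lf)" using card fin v(1) by simp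
  then have "rich v p" using richI[OF v(2)] by simp
  then obtain x y where xy: "rich x y" and l: "\<And>t. (y, t) \<in> E \<Longrightarrow> t \<noteq> x \<Longrightarrow> \<exists>v. lone y t v"
    using end_vertex by blast
  have e: "(x, y) \<in> E" using xy by (simp add: rich_def)
  have yV: "y \<in> V" using E_V[OF e] by blast
  let ?N = "{t. (y, t) \<in> E \<and> t \<noteq> x}" and ?leaf = "\<lambda>t. THE v. lone y t v"
  have N: "lone y t (?leaf t)" if "t \<in> ?N" for t using l that lone_leaf by blast
  have assembled: "\<exists>A f. A \<subseteq> {1,2,3} \<and> card A = card ?N \<and> finite ?N \<and>
      embeds E (A # W) f (insert y ((\<Union>t\<in>?N. side y t) \<union> Z)) \<and> f (Spine 0) = y"
    if "embeds E W f' Z" "y \<notin> Z" "\<And>t. t \<in> ?N \<Longrightarrow> side y t \<inter> Z = {}"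
      "\<And>a. a \<in> spine_verts W \<Longrightarrow> (y, f' a) \<in> E \<longleftrightarrow> a = Spine 0" for W f' Z
    using assemble[OF yV N that] by blast
  \<comment> \<open>Assembling the pendant paths alone already bounds their number.\<close>
  obtain A0 where "A0 \<subseteq> {1,2,3::nat}" "card A0 = card ?N" using assembled[OF embeds_Nil] by auto
  then have N3: "card ?N \<le> 3" using card_mono[of "{1,2,3::nat}" A0] by simp
  have count: "2 \<le> card ?N" "card (side x y \<inter> lf) \<le> card ?N" using rich_lone_count[OF xy l finite_nbrs_E] by auto
  have "lf = (side x y \<inter> lf) \<union> (side y x \<inter> lf)" using side_union[OF e] lf_V by blast
  then have "card lf \<le> card (side x y \<inter> lf) + card (side y x \<inter> lf)" by (metis card_Un_le)
  then have "2 \<le> card (side y x \<inter> lf)" using card count(2) N3 by linarith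
  then have yx: "rich y x" using richI[OF sym_E[OF e]] by blast
  obtain W f' where W: "hanging_spine W f' (side y x) x" using hanging_part[OF yx xy] by blast
  obtain A f where A: "A \<subseteq> {1,2,3}" "card A = card ?N" "embeds E (A # W) f (insert y ((\<Union>t\<in>?N. side y t) \<union> side y x))"
  proof -
    have "\<exists>A f. A \<subseteq> {1,2,3} \<and> card A = card ?N \<and> finite ?N \<and>
      embeds E (A # W) f (insert y ((\<Union>t\<in>?N. side y t) \<union> side y x)) \<and> f (Spine 0) = y"
    proof (rule assembled)
      show "embeds E W f' (side y x)" using W by (simp add: hanging_spine_def)
      show "y \<notin> side y x" by (rule not_side_self[OF sym_E[OF e]])
      show "side y t \<inter> side y x = {}" if "t \<in> ?N" for t using sides_disjoint[OF _ sym_E[OF e]] that by blast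
      show "(y, f' a) \<in> E \<longleftrightarrow> a = Spine 0" if "a \<in> spine_verts W" for a
        using embeds_side_edge[OF _ _ sym_E[OF e] that] W by (simp add: hanging_spine_def)
    qed
    then show ?thesis using that by blast
  qed
  have "insert y ((\<Union>t\<in>?N. side y t) \<union> side y x) = insert y (\<Union>t\<in>{t. (y, t) \<in> E}. side y t)"
    using sym_E[OF e] by blast
  also have "\<dots> = V" by (rule V_unfold[OF yV, symmetric])
  finally have "embeds E (A # W) f V" using A(3) by simp
  moreover have "proper_word (A # W)" "2 \<le> length (A # W)" "2 \<le> card (last (A # W))"
    using W A(1) by (auto simp: hanging_spine_def neq_Nil_conv)
  ultimately show ?thesis using A(2) count(1) by (intro exI[of _ "A # W"] exI[of _ f]) simp
qed

end

section \<open>Relational trees and the graph library\<close>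

lemma rtrancl_awalk:
  assumes T: "pair_wf_digraph T" and R: "R \<subseteq> parcs T" and uv: "(u, v) \<in> R\<^sup>*" "u \<in> pverts T"
  shows "\<exists>p. pre_digraph.awalk (with_proj T) u p v \<and> set p \<subseteq> R"
proof -
  interpret pair_wf_digraph T by (rule T)
  show ?thesis using uv
  proof (induction rule: converse_rtrancl_induct)
    case base then show ?case by (intro exI[of _ "[]"]) (simp add: awalk_Nil_iff)
  next
    case (step a b)
    then have "b \<in> pverts T" using R in_arcsD2 by blast
    then obtain p where "awalk b p v" "set p \<subseteq> R" using step by blast
    then show ?case using step(1) R by (intro exI[of _ "(a, b) # p"]) (auto simp: awalk_Cons_iff)
  qed
qed

lemma awalk_relpow:
  assumes T: "pair_wf_digraph T"
  shows "pre_digraph.awalk (with_proj T) u p v \<Longrightarrow> (u, v) \<in> parcs T ^^ length p"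
    and "(u, v) \<in> parcs T ^^ n \<Longrightarrow> u \<in> pverts T \<Longrightarrow> \<exists>p. pre_digraph.awalk (with_proj T) u p v \<and> length p = n"
proof -
  interpret pair_wf_digraph T by (rule T)
  show "(u, v) \<in> parcs T ^^ length p" if "awalk u p v" for u p v
    using that
  proof (induction p arbitrary: u)
    case (Cons e p)
    then have "e \<in> parcs T" "fst e = u" "awalk (snd e) p v" by (auto simp: awalk_Cons_iff)
    then show ?case using Cons.IH relpow_Suc_I2[of u "snd e" "parcs T" v "length p"] by (cases e) auto
  qed (simp add: awalk_Nil_iff)
  show "\<exists>p. awalk u p v \<and> length p = n" if "(u, v) \<in> parcs T ^^ n" "u \<in> pverts T" for u v n
    using that
  proof (induction n arbitrary: u)
    case 0 then show ?case by (intro exI[of _ "[]"]) (simp add: awalk_Nil_iff)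
  next
    case (Suc n)
    then obtain w where w: "(u, w) \<in> parcs T" "(w, v) \<in> parcs T ^^ n" by (meson relpow_Suc_E2)
    then obtain p where "awalk w p v" "length p = n" using Suc.IH in_arcsD2 by blast
    then show ?case using w by (intro exI[of _ "(u, w) # p"]) (auto simp: awalk_Cons_iff)
  qed
qed

text \<open>
  If an edge \<open>xy\<close> were not a bridge, a path from \<open>x\<close> to \<open>y\<close> without the edge would form a cycle with it. The
  path has at least two arcs, so the cycle is not just a pair of opposite arcs.
\<close>

lemma rel_tree_if_undirected_tree:
  assumes T: "undirected_tree T"
  shows "rel_tree (pverts T) (parcs T)"
proof -
  have pg: "pair_graph T" and conn: "connected (with_proj T)"
    and acyc: "\<And>p. pre_digraph.cycle (with_proj T) p \<Longrightarrow> \<not> 3 \<le> length p"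
    using T by (auto simp: undirected_tree_def)
  interpret pair_graph T by (rule pg)
  have wf: "pair_wf_digraph T" by (rule pair_wf_digraph_axioms)
  have sc: "strongly_connected (with_proj T)"
    using symmetric_connected_imp_strongly_connected conn pair_sym_arcs by blast
  have symE: "(y, x) \<in> parcs T" if "(x, y) \<in> parcs T" for x y
    using pair_sym_arcs that by (auto simp: symmetric_def sym_def)
  show ?thesis
  proof
    show "finite (pverts T)" by (rule pair_finite_verts)
    show "pverts T \<noteq> {}" using sc by (simp add: strongly_connected_def)
    show "parcs T \<subseteq> pverts T \<times> pverts T" using in_arcsD1 in_arcsD2 by auto
    show "(y, x) \<in> parcs T" if "(x, y) \<in> parcs T" for x y using symE that .
    show "(x, x) \<notin> parcs T" for x using pair_no_loops[of "(x, x)"] by auto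
    show "(u, v) \<in> (parcs T)\<^sup>*" if uv: "u \<in> pverts T" "v \<in> pverts T" for u v
    proof -
      have "u \<rightarrow>\<^sup>*\<^bsub>with_proj T\<^esub> v" using sc uv by (simp add: strongly_connected_def)
      then obtain p where "awalk u p v" by (auto simp: reachable_awalk)
      then show ?thesis using awalk_relpow(1)[OF wf] relpow_imp_rtrancl by blast
    qed
    fix x y assume xy: "(x, y) \<in> parcs T"
    show "(x, y) \<notin> (parcs T - {(x, y), (y, x)})\<^sup>*"
    proof
      let ?R = "parcs T - {(x, y), (y, x)}"
      assume r: "(x, y) \<in> ?R\<^sup>*"
      obtain p where p: "awalk x p y" "set p \<subseteq> ?R"
        using rtrancl_awalk[OF wf _ r] in_arcsD1[OF xy] by blast
      define q where "q = awalk_to_apath p"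
      have q: "apath x q y" "set q \<subseteq> ?R"
        using apath_awalk_to_apath[OF p(1)] awalk_to_apath_subset[OF p(1)] p(2) by (auto simp: q_def)
      have yx: "(y, x) \<in> parcs T" by (rule symE[OF xy])
      have "x \<noteq> y" using pair_no_loops[OF xy] by auto
      have "2 \<le> length q"
      proof (rule ccontr)
        assume "\<not> ?thesis"
        then consider "q = []" | e where "q = [e]" by (cases q) (auto simp: Suc_le_eq)
        then show False
        proof cases
          case 1 then show False using q(1) \<open>x \<noteq> y\<close> by (simp add: apath_def awalk_Nil_iff)
        next
          case 2
          then have "e = (x, y)" using q(1) by (cases e) (simp add: apath_def awalk_Cons_iff awalk_Nil_iff)
          then show False using q(2) 2 by simp
        qed
      qed
      moreover have "cycle ((y, x) # q)"
        using q(1) yx unfolding cycle_def apath_def by (intro exI[of _ y]) (simp add: awalk_Cons_iff)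
      ultimately show False using acyc[of "(y, x) # q"] by simp
    qed
  qed
qed

text \<open>
  A cycle of length at least 3 uses its first edge once and never backwards, so the remaining arcs show
  that this edge is not a bridge.
\<close>

lemma undirected_tree_if_rel_tree:
  assumes "rel_tree (pverts T) (parcs T)"
  shows "undirected_tree T"
proof -
  interpret rt: rel_tree "pverts T" "parcs T" by (rule assms)
  have pg: "pair_graph T"
  proof
    show "fst e \<in> pverts T" "snd e \<in> pverts T" if "e \<in> parcs T" for e using that rt.E_sub by auto
    show "finite (pverts T)" by (rule rt.finite_V)
    show "finite (parcs T)" by (rule finite_subset[OF rt.E_sub]) (simp add: rt.finite_V)
    show "fst e \<noteq> snd e" if "e \<in> parcs T" for e using that rt.irrefl_E by (cases e) auto
    show "symmetric (with_proj T)" using rt.sym_E by (auto simp: symmetric_def sym_def)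
  qed
  interpret pair_graph T by (rule pg)
  have wf: "pair_wf_digraph T" by (rule pair_wf_digraph_axioms)
  have "connected (with_proj T)"
  proof -
    have "u \<rightarrow>\<^sup>*\<^bsub>with_proj T\<^esub> v" if "u \<in> pverts T" "v \<in> pverts T" for u v
      using rtrancl_awalk[OF wf order_refl rt.connected_V[OF that] that(1)] by (auto simp: reachable_awalk)
    then show ?thesis
      using rt.V_nonempty reachable_mk_symmetricI by (simp add: connected_def strongly_connected_def)
  qed
  moreover have "\<not> (cycle p \<and> 3 \<le> length p)" for p
  proof
    assume p: "cycle p \<and> 3 \<le> length p"
    then obtain u where u: "awalk u p u" "distinct (tl (pawalk_verts u p))" by (auto simp: cycle_def)
    obtain x y q where pq: "p = (x, y) # q" using p by (cases p) auto
    have aw: "awalk y q x" "u = x" "(x, y) \<in> parcs T" using u(1) pq by (auto simp: awalk_Cons_iff)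
    have dist: "distinct (pawalk_verts y q)" using u(2) pq by simp
    have len: "2 \<le> length q" using p pq by simp
    have heads: "pawalk_verts y q = y # map snd q"
      using awalk_verts_conv'[of y q x] aw(1) len by (cases q) (auto simp: awalk_def)
    have tails: "pawalk_verts y q = map fst q @ [x]"
    proof -
      have "q \<noteq> []" using len by auto
      moreover have "snd (last q) = x" using heads aw(1) \<open>q \<noteq> []\<close> by (metis awalk_conv last_ConsR last_map list.map_disc_iff)
      ultimately show ?thesis using awalk_verts_conv[of y q] by simp
    qed
    have "(x, y) \<notin> set q"
    proof
      assume "(x, y) \<in> set q"
      then have "x \<in> set (map fst q)" by force
      then show False using dist tails by simp
    qed
    moreover have "(y, x) \<notin> set q"
    proof
      assume "(y, x) \<in> set q"
      then obtain i where i: "i < length q" "q ! i = (y, x)" by (auto simp: in_set_conv_nth)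
      have "pawalk_verts y q ! i = y" using i tails by (simp add: nth_append)
      moreover have "pawalk_verts y q ! 0 = y" using heads by simp
      ultimately have "i = 0" using dist i heads by (metis length_Cons length_map less_SucI nth_eq_iff_index_eq zero_less_Suc)
      have "pawalk_verts y q ! 1 = x" using heads i \<open>i = 0\<close> len by simp
      moreover have "pawalk_verts y q ! length q = x" using tails by (simp add: nth_append)
      ultimately have "1 = length q" using dist heads len by (metis (no_types, lifting) Suc_le_lessD Suc_1 length_Cons length_map less_Suc_eq nth_eq_iff_index_eq)
      then show False using len by simp
    qed
    ultimately have R: "set q \<subseteq> parcs T - {(y, x), (x, y)}" using aw(1) by (auto simp: awalk_def)
    have "(a, b) \<in> S\<^sup>*" if "set r \<subseteq> S" "pcas a r b" for a b r S
      using that by (induction r arbitrary: a) (auto intro: converse_rtrancl_into_rtrancl)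
    then have "(y, x) \<in> (parcs T - {(y, x), (x, y)})\<^sup>*" using R aw(1) by (auto simp: awalk_def)
    then show False using rt.bridge[OF rt.sym_E[OF aw(3)]] by simp
  qed
  ultimately show ?thesis using pg unfolding undirected_tree_def by blast
qed

lemma graph_dist_eq:
  assumes "rel_tree (pverts T) (parcs T)" "u \<in> pverts T" "v \<in> pverts T"
  shows "graph_dist T u v = ereal (real (rdist (parcs T) u v))"
proof -
  interpret rt: rel_tree "pverts T" "parcs T" by (rule assms)
  interpret pair_graph T using undirected_tree_if_rel_tree[OF assms(1)] by (simp add: undirected_tree_def)
  have wf: "pair_wf_digraph T" by (rule pair_wf_digraph_axioms)
  have cost: "awalk_cost (\<lambda>_. 1) p = real (length p)" for p :: "('a \<times> 'a) list"
    by (induction p) auto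
  show ?thesis unfolding graph_dist_def \<mu>_def cost
  proof (rule antisym)
    obtain p where "awalk u p v" "length p = rdist (parcs T) u v"
      using awalk_relpow(2)[OF wf rt.relpow_finite[OF assms(2,3)] assms(2)] by blast
    then show "(INF p\<in>{p. awalk u p v}. ereal (real (length p))) \<le> ereal (real (rdist (parcs T) u v))"
      by (intro INF_lower2[of p]) auto
    show "ereal (real (rdist (parcs T) u v)) \<le> (INF p\<in>{p. awalk u p v}. ereal (real (length p)))"
      using rt.d_le awalk_relpow(1)[OF wf] by (intro INF_greatest) auto
  qed
qed

lemma leaves_eq: "leaves T = {v \<in> pverts T. card (parcs T `` {v}) = 1}"
proof -
  have "out_arcs (with_proj T) v = Pair v ` (parcs T `` {v})" for v
    by (auto simp: out_arcs_def)
  then have "out_degree (with_proj T) v = card (parcs T `` {v})" for v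
    unfolding out_degree_def by (simp add: card_image inj_on_def)
  then show ?thesis by (simp add: leaves_def)
qed

lemma exact_leaf_root_cycle_iff:
  "exact_leaf_root 5 T (cycle_graph l) \<longleftrightarrow> rel_tree (pverts T) (parcs T) \<and>
    (\<exists>\<phi>. cycle_numbering l \<phi> {v \<in> pverts T. card (parcs T `` {v}) = 1} (\<lambda>u v. rdist (parcs T) u v = 5))"
proof -
  let ?L = "{v \<in> pverts T. card (parcs T `` {v}) = 1}"
  have "(bij_betw \<phi> (pverts (cycle_graph l)) (leaves T) \<and>
       (\<forall>u \<in> pverts (cycle_graph l). \<forall>v \<in> pverts (cycle_graph l). u \<noteq> v \<longrightarrow>
         ((u, v) \<in> parcs (cycle_graph l) \<longleftrightarrow> graph_dist T (\<phi> u) (\<phi> v) = ereal (real 5)))) \<longleftrightarrow>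
     cycle_numbering l \<phi> ?L (\<lambda>u v. rdist (parcs T) u v = 5)"
    if T: "rel_tree (pverts T) (parcs T)" for \<phi>
  proof -
    have V: "pverts (cycle_graph l) = {..<l}" by (simp add: cycle_graph_def)
    have A: "(i, j) \<in> parcs (cycle_graph l) \<longleftrightarrow> cyc_adj l i j" if "i < l" "j < l" for i j
      using that by (simp add: cycle_graph_def cyc_adj_def)
    have D: "graph_dist T (\<phi> i) (\<phi> j) = ereal (real 5) \<longleftrightarrow> rdist (parcs T) (\<phi> i) (\<phi> j) = 5"
      if b: "bij_betw \<phi> {..<l} ?L" and "i < l" "j < l" for i j
    proof -
      have "\<phi> i \<in> pverts T" "\<phi> j \<in> pverts T" using bij_betwE[OF b] that(2,3) by auto
      then show ?thesis using graph_dist_eq[OF T] by simp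
    qed
    show ?thesis unfolding cycle_numbering_def leaves_eq V
    proof (rule conj_cong[OF refl])
      assume b: "bij_betw \<phi> {..<l} ?L"
      show "(\<forall>u\<in>{..<l}. \<forall>v\<in>{..<l}. u \<noteq> v \<longrightarrow> ((u, v) \<in> parcs (cycle_graph l) \<longleftrightarrow> graph_dist T (\<phi> u) (\<phi> v) = ereal (real 5))) \<longleftrightarrow>
        (\<forall>i<l. \<forall>j<l. i \<noteq> j \<longrightarrow> (rdist (parcs T) (\<phi> i) (\<phi> j) = 5 \<longleftrightarrow> cyc_adj l i j))"
        using A D[OF b] by (auto simp: Ball_def)
    qed
  qed
  moreover have "undirected_tree T \<longleftrightarrow> rel_tree (pverts T) (parcs T)"
    using rel_tree_if_undirected_tree undirected_tree_if_rel_tree by blast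
  ultimately show ?thesis unfolding exact_leaf_root_def by (simp cong: conj_cong)
qed

section \<open>Isomorphic trees\<close>

definition rel_iso :: "('v \<Rightarrow> 'w) \<Rightarrow> 'v set \<Rightarrow> 'v rel \<Rightarrow> 'w set \<Rightarrow> 'w rel \<Rightarrow> bool" where
  "rel_iso f V E V' E' \<longleftrightarrow> bij_betw f V V' \<and> E \<subseteq> V \<times> V \<and> E' \<subseteq> V' \<times> V' \<and>
     (\<forall>a\<in>V. \<forall>b\<in>V. (a, b) \<in> E \<longleftrightarrow> (f a, f b) \<in> E')"

lemma relpow_Suc_iff:
  assumes "E \<subseteq> V \<times> V"
  shows "(a, b) \<in> E ^^ Suc n \<longleftrightarrow> (\<exists>c\<in>V. (a, c) \<in> E \<and> (c, b) \<in> E ^^ n)"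
proof
  assume "(a, b) \<in> E ^^ Suc n"
  then obtain c where "(a, c) \<in> E" "(c, b) \<in> E ^^ n" by (meson relpow_Suc_E2)
  then show "\<exists>c\<in>V. (a, c) \<in> E \<and> (c, b) \<in> E ^^ n" using assms by blast
next
  assume "\<exists>c\<in>V. (a, c) \<in> E \<and> (c, b) \<in> E ^^ n"
  then obtain c where "(a, c) \<in> E" "(c, b) \<in> E ^^ n" by blast
  then show "(a, b) \<in> E ^^ Suc n" by (rule relpow_Suc_I2)
qed

lemma rel_iso_relpow:
  assumes f: "rel_iso f V E V' E'" and "a \<in> V" "b \<in> V"
  shows "(a, b) \<in> E ^^ n \<longleftrightarrow> (f a, f b) \<in> E' ^^ n"
  using assms(2)
proof (induction n arbitrary: a)
  case 0
  then show ?case using f assms(3) by (auto simp: rel_iso_def bij_betw_def dest: inj_onD)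
next
  case (Suc n)
  have "(a, b) \<in> E ^^ Suc n \<longleftrightarrow> (\<exists>c\<in>V. (a, c) \<in> E \<and> (c, b) \<in> E ^^ n)"
    by (rule relpow_Suc_iff) (use f in \<open>simp add: rel_iso_def\<close>)
  also have "\<dots> \<longleftrightarrow> (\<exists>c\<in>V. (f a, f c) \<in> E' \<and> (f c, f b) \<in> E' ^^ n)"
    using Suc f by (auto simp: rel_iso_def)
  also have "\<dots> \<longleftrightarrow> (\<exists>c\<in>V'. (f a, c) \<in> E' \<and> (c, f b) \<in> E' ^^ n)"
    using f by (auto simp: rel_iso_def bij_betw_def)
  also have "\<dots> \<longleftrightarrow> (f a, f b) \<in> E' ^^ Suc n"
    by (rule relpow_Suc_iff[symmetric]) (use f in \<open>simp add: rel_iso_def\<close>)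
  finally show ?case .
qed

lemma rel_iso_rtrancl:
  assumes "rel_iso f V E V' E'" "a \<in> V" "b \<in> V"
  shows "(a, b) \<in> E\<^sup>* \<longleftrightarrow> (f a, f b) \<in> E'\<^sup>*"
  using rel_iso_relpow[OF assms] by (simp add: rtrancl_power)

lemma rel_iso_rdist:
  assumes "rel_iso f V E V' E'" "a \<in> V" "b \<in> V"
  shows "rdist E' (f a) (f b) = rdist E a b"
  using rel_iso_relpow[OF assms] by (simp add: rdist_def)

lemma rel_iso_tree:
  assumes f: "rel_iso f V E V' E'" and T: "rel_tree V E"
  shows "rel_tree V' E'"
proof -
  interpret rel_tree V E by (rule T)
  have bij: "bij_betw f V V'" and E': "E' \<subseteq> V' \<times> V'"
    and iff: "\<And>a b. a \<in> V \<Longrightarrow> b \<in> V \<Longrightarrow> (a, b) \<in> E \<longleftrightarrow> (f a, f b) \<in> E'"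
    using f by (auto simp: rel_iso_def)
  have V': "V' = f ` V" and inj: "inj_on f V" using bij by (auto simp: bij_betw_def)
  have pre: "\<exists>a\<in>V. \<exists>b\<in>V. x = f a \<and> y = f b \<and> (a, b) \<in> E" if "(x, y) \<in> E'" for x y
  proof -
    obtain a b where "x = f a" "y = f b" "a \<in> V" "b \<in> V" using E' V' \<open>(x, y) \<in> E'\<close> by blast
    then show ?thesis using iff that by blast
  qed
  show ?thesis
  proof
    show "finite V'" "V' \<noteq> {}" using finite_V V_nonempty V' by auto
    show "E' \<subseteq> V' \<times> V'" by (rule E')
    show "(y, x) \<in> E'" if "(x, y) \<in> E'" for x y using pre[OF that] iff sym_E by blast
    show "(x, x) \<notin> E'" for x
    proof
      assume "(x, x) \<in> E'"
      then obtain a b where "a \<in> V" "b \<in> V" "x = f a" "x = f b" "(a, b) \<in> E" using pre by blast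
      then show False using inj irrefl_E by (metis inj_onD)
    qed
    show "(u, v) \<in> E'\<^sup>*" if "u \<in> V'" "v \<in> V'" for u v
      using that connected_V rel_iso_rtrancl[OF f] V' by auto
    fix x y assume "(x, y) \<in> E'"
    then obtain a b where ab: "a \<in> V" "b \<in> V" "x = f a" "y = f b" "(a, b) \<in> E" using pre by blast
    have "rel_iso f V (E - {(a, b), (b, a)}) V' (E' - {(x, y), (y, x)})"
      unfolding rel_iso_def
    proof (intro conjI ballI)
      fix c d assume cd: "c \<in> V" "d \<in> V"
      have "f c = f a \<longleftrightarrow> c = a" "f c = f b \<longleftrightarrow> c = b" "f d = f a \<longleftrightarrow> d = a" "f d = f b \<longleftrightarrow> d = b"
        using inj cd ab(1,2) by (auto dest: inj_onD)
      then show "(c, d) \<in> E - {(a, b), (b, a)} \<longleftrightarrow> (f c, f d) \<in> E' - {(x, y), (y, x)}"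
        using iff[OF cd] ab by auto
    qed (use bij E' E_sub in auto)
    from rel_iso_rtrancl[OF this ab(1,2)] show "(x, y) \<notin> (E' - {(x, y), (y, x)})\<^sup>*"
      using bridge[OF ab(5)] ab by simp
  qed
qed

lemma rel_iso_inv:
  assumes f: "rel_iso f V E V' E'" shows "rel_iso (inv_into V f) V' E' V E"
proof -
  have bij: "bij_betw f V V'" using f by (simp add: rel_iso_def)
  have "(a, b) \<in> E' \<longleftrightarrow> (inv_into V f a, inv_into V f b) \<in> E" if "a \<in> V'" "b \<in> V'" for a b
  proof -
    have "inv_into V f a \<in> V" "inv_into V f b \<in> V" "f (inv_into V f a) = a" "f (inv_into V f b) = b"
      using bij that by (auto simp: bij_betw_def inv_into_into f_inv_into_f)
    then show ?thesis using f by (auto simp: rel_iso_def)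
  qed
  then show ?thesis using f bij_betw_inv_into[OF bij] by (auto simp: rel_iso_def)
qed

lemma rel_iso_leaves:
  assumes f: "rel_iso f V E V' E'"
  shows "bij_betw f {v \<in> V. card (E `` {v}) = 1} {v \<in> V'. card (E' `` {v}) = 1}"
proof -
  have bij: "bij_betw f V V'" using f by (simp add: rel_iso_def)
  then have inj: "inj_on f V" and V': "V' = f ` V" by (auto simp: bij_betw_def)
  have "card (E' `` {f v}) = card (E `` {v})" if "v \<in> V" for v
  proof -
    have "E' `` {f v} = f ` (E `` {v})" using f that V' unfolding rel_iso_def by blast
    moreover have "E `` {v} \<subseteq> V" using f by (auto simp: rel_iso_def)
    ultimately show ?thesis using inj by (simp add: card_image inj_on_subset)
  qed
  then have "f ` {v \<in> V. card (E `` {v}) = 1} = {v \<in> V'. card (E' `` {v}) = 1}" using V' by auto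
  then show ?thesis using inj by (auto simp: bij_betw_def intro: inj_on_subset)
qed

lemma cycle_numbering_transfer:
  assumes "cycle_numbering l \<phi> L R" "bij_betw f L L'"
    and "\<And>u v. u \<in> L \<Longrightarrow> v \<in> L \<Longrightarrow> R u v \<longleftrightarrow> R' (f u) (f v)"
  shows "cycle_numbering l (f \<circ> \<phi>) L' R'"
proof -
  have "bij_betw \<phi> {..<l} L" using assms(1) by (simp add: cycle_numbering_def)
  moreover from this have "\<phi> i \<in> L" if "i < l" for i using bij_betwE that by auto
  ultimately show ?thesis using assms by (auto simp: cycle_numbering_def intro: bij_betw_trans)
qed

lemma exact_leaf_root_iso:
  assumes f: "rel_iso f (pverts T) (parcs T) (pverts S) (parcs S)"
    and T: "exact_leaf_root 5 T (cycle_graph l)"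
  shows "exact_leaf_root 5 S (cycle_graph l)"
proof -
  obtain \<phi> where \<phi>: "cycle_numbering l \<phi> {v \<in> pverts T. card (parcs T `` {v}) = 1} (\<lambda>u v. rdist (parcs T) u v = 5)"
    and tree: "rel_tree (pverts T) (parcs T)" using T unfolding exact_leaf_root_cycle_iff by blast
  have "cycle_numbering l (f \<circ> \<phi>) {v \<in> pverts S. card (parcs S `` {v}) = 1} (\<lambda>u v. rdist (parcs S) u v = 5)"
    by (rule cycle_numbering_transfer[OF \<phi> rel_iso_leaves[OF f]]) (simp add: rel_iso_rdist[OF f])
  then show ?thesis using rel_iso_tree[OF f tree] unfolding exact_leaf_root_cycle_iff by blast
qed

text \<open>Arcs are pairs of vertices, so an isomorphism is determined by its action on vertices.\<close>

lemma digraph_iso_iff_rel_iso: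
  assumes S: "parcs S \<subseteq> pverts S \<times> pverts S"
  shows "digraph_iso (with_proj T) (with_proj S) \<longleftrightarrow>
    (\<exists>f. rel_iso f (pverts T) (parcs T) (pverts S) (parcs S))"
proof
  assume "digraph_iso (with_proj T) (with_proj S)"
  then obtain h where h: "pre_digraph.digraph_isomorphism (with_proj T) h" and S: "with_proj S = app_iso h (with_proj T)"
    by (auto simp: digraph_iso_def)
  have wf: "wf_digraph (with_proj T)" and inj: "inj_on (iso_verts h) (pverts T)"
    and ends: "\<And>a. a \<in> parcs T \<Longrightarrow> iso_verts h (fst a) = iso_tail h (iso_arcs h a) \<and> iso_verts h (snd a) = iso_head h (iso_arcs h a)"
    using h by (auto simp: pre_digraph.digraph_isomorphism_def)
  have wfp: "pair_wf_digraph T" using wf by (simp add: wf_digraph_wp_iff)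
  have "verts (with_proj S) = verts (app_iso h (with_proj T))" "arcs (with_proj S) = arcs (app_iso h (with_proj T))"
    "tail (with_proj S) = tail (app_iso h (with_proj T))" "head (with_proj S) = head (app_iso h (with_proj T))"
    using S by simp_all
  then have V: "pverts S = iso_verts h ` pverts T" and A: "parcs S = iso_arcs h ` parcs T"
    and tl: "fst = iso_tail h" and hd: "snd = iso_head h" by simp_all
  have arc: "iso_arcs h (a, b) = (iso_verts h a, iso_verts h b)" if "(a, b) \<in> parcs T" for a b
    using ends[OF that] tl hd by (simp add: prod_eq_iff)
  have TV: "parcs T \<subseteq> pverts T \<times> pverts T" using pair_wf_digraph.wellformed'[OF wfp] by auto
  have "(a, b) \<in> parcs T \<longleftrightarrow> (iso_verts h a, iso_verts h b) \<in> parcs S" if ab: "a \<in> pverts T" "b \<in> pverts T" for a b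
  proof
    assume "(iso_verts h a, iso_verts h b) \<in> parcs S"
    then obtain c d where cd: "(c, d) \<in> parcs T" "iso_verts h a = iso_verts h c" "iso_verts h b = iso_verts h d"
      using A arc by auto
    then have "a = c" "b = d" using inj ab TV by (auto dest: inj_onD)
    then show "(a, b) \<in> parcs T" using cd by simp
  qed (use A arc in force)
  then have "rel_iso (iso_verts h) (pverts T) (parcs T) (pverts S) (parcs S)"
    using V inj TV \<open>parcs S \<subseteq> _\<close> by (simp add: rel_iso_def bij_betw_def)
  then show "\<exists>f. rel_iso f (pverts T) (parcs T) (pverts S) (parcs S)" by blast
next
  assume "\<exists>f. rel_iso f (pverts T) (parcs T) (pverts S) (parcs S)"
  then obtain f where f: "rel_iso f (pverts T) (parcs T) (pverts S) (parcs S)" by blast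
  define h where "h = \<lparr> iso_verts = f, iso_arcs = map_prod f f, iso_head = snd, iso_tail = fst \<rparr>"
  have inj: "inj_on f (pverts T)" and V: "pverts S = f ` pverts T" and TV: "parcs T \<subseteq> pverts T \<times> pverts T"
    and iff: "\<And>a b. a \<in> pverts T \<Longrightarrow> b \<in> pverts T \<Longrightarrow> (a, b) \<in> parcs T \<longleftrightarrow> (f a, f b) \<in> parcs S"
    using f by (auto simp: rel_iso_def bij_betw_def)
  have "wf_digraph (with_proj T)" by unfold_locales (use TV in auto)
  moreover have "inj_on (map_prod f f) (parcs T)"
    using map_prod_inj_on[OF inj inj] TV by (rule inj_on_subset)
  ultimately have "pre_digraph.digraph_isomorphism (with_proj T) h"
    using inj by (simp add: pre_digraph.digraph_isomorphism_def h_def)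
  moreover have "parcs S = map_prod f f ` parcs T"
  proof (intro set_eqI iffI)
    fix e assume e: "e \<in> parcs S"
    then obtain a b where "e = (f a, f b)" "a \<in> pverts T" "b \<in> pverts T" using S V by auto
    then show "e \<in> map_prod f f ` parcs T" using iff e by force
  qed (use iff TV in auto)
  then have "with_proj S = app_iso h (with_proj T)"
    using V by (simp add: app_iso_def h_def with_proj_def)
  ultimately show "digraph_iso (with_proj T) (with_proj S)" unfolding digraph_iso_def by blast
qed

section \<open>Spine trees\<close>

definition good_word :: "spine_word \<Rightarrow> bool" where
  "good_word W \<longleftrightarrow> proper_word W \<and> 2 \<le> length W \<and> 2 \<le> card (hd W) \<and> 2 \<le> card (last W)"

lemma spine_adj_sym: "spine_adj a b \<longleftrightarrow> spine_adj b a"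
  by (cases a; cases b) auto

fun parent :: "spine_vertex \<Rightarrow> spine_vertex" where
  "parent (Spine i) = Spine (i - 1)"
| "parent (Pendant i r j) = (if j = 1 then Spine i else Pendant i r (j - 1))"

text \<open>The vertices whose path to \<open>Spine 0\<close> passes through the first argument.\<close>

fun below :: "spine_vertex \<Rightarrow> spine_vertex \<Rightarrow> bool" where
  "below (Spine i) (Spine j) \<longleftrightarrow> i \<le> j"
| "below (Spine i) (Pendant k r j) \<longleftrightarrow> i \<le> k"
| "below (Pendant i r j) (Spine k) \<longleftrightarrow> False"
| "below (Pendant i r j) (Pendant i' r' j') \<longleftrightarrow> i = i' \<and> r = r' \<and> j \<le> j'"

text \<open>The edge to the parent is the only one that leaves the set of vertices below.\<close>

lemma leave_below:
  assumes "a \<in> spine_verts W" "b \<in> spine_verts W" "spine_adj a b" "below v a" "\<not> below v b" "v \<in> spine_verts W"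
  shows "a = v \<and> b = parent v"
  using assms by (cases v; cases a; cases b) auto

lemma spine_adj_parent:
  assumes "spine_adj a b" "a \<in> spine_verts W" "b \<in> spine_verts W"
  shows "b = parent a \<and> a \<noteq> Spine 0 \<or> a = parent b \<and> b \<noteq> Spine 0"
  using assms by (cases a; cases b) auto

lemma below_self: "below v v" by (cases v) auto

lemma not_below_parent: "v \<in> spine_verts W \<Longrightarrow> v \<noteq> Spine 0 \<Longrightarrow> \<not> below v (parent v)"
  by (cases v) auto

lemma finite_spine_verts: "proper_word W \<Longrightarrow> finite (spine_verts W)"
proof -
  assume W: "proper_word W"
  have "spine_verts W \<subseteq> Spine ` {..<length W} \<union> (\<lambda>((i, r), j). Pendant i r j) ` (word_leaves W \<times> {..3})"
  proof
    fix v assume v: "v \<in> spine_verts W"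
    show "v \<in> Spine ` {..<length W} \<union> (\<lambda>((i, r), j). Pendant i r j) ` (word_leaves W \<times> {..3})"
    proof (cases v)
      case (Pendant i r j)
      then have "(i, r) \<in> word_leaves W" using v by (auto simp: word_leaves_def)
      moreover from proper_wordD[OF W this] have "j \<le> 3" using v Pendant by auto
      ultimately show ?thesis using Pendant by (intro UnI2 image_eqI[of _ _ "((i, r), j)"]) auto
    qed (use v in auto)
  qed
  then show ?thesis by (rule finite_subset) (use finite_word_leaves[OF W] in simp)
qed

lemma rel_tree_spine_tree:
  assumes W: "proper_word W" "W \<noteq> []"
  shows "rel_tree (spine_verts W) (parcs (spine_tree W))"
proof
  let ?V = "spine_verts W" and ?E = "parcs (spine_tree W)"
  have E: "(a, b) \<in> ?E \<longleftrightarrow> a \<in> ?V \<and> b \<in> ?V \<and> spine_adj a b" for a b by (rule parcs_spine_tree[OF W(1)])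
  show "finite ?V" by (rule finite_spine_verts[OF W(1)])
  have root: "Spine 0 \<in> ?V" using W(2) by simp
  then show "?V \<noteq> {}" by blast
  show "?E \<subseteq> ?V \<times> ?V" using E by auto
  show sym: "(y, x) \<in> ?E" if "(x, y) \<in> ?E" for x y using that E spine_adj_sym by blast
  show "(x, x) \<notin> ?E" for x using E by (cases x) auto
  have up: "(v, Spine 0) \<in> ?E\<^sup>*" if "v \<in> ?V" for v
  proof -
    have S: "(Spine i, Spine 0) \<in> ?E\<^sup>*" if "i < length W" for i
      using that
    proof (induction i)
      case (Suc i)
      then have "(Spine (Suc i), Spine i) \<in> ?E" by (simp add: E)
      then show ?case using Suc by (simp add: converse_rtrancl_into_rtrancl)
    qed simp
    have P: "(Pendant i r j, Spine i) \<in> ?E\<^sup>*" if "i < length W" "r \<in> W ! i" "1 \<le> j" "j \<le> r" for i r j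
      using that(3,4)
    proof (induction j)
      case (Suc j)
      show ?case
      proof (cases j)
        case 0
        then have "(Pendant i r (Suc j), Spine i) \<in> ?E" using Suc that by (simp add: E)
        then show ?thesis by blast
      next
        case (Suc k)
        then have "(Pendant i r (Suc j), Pendant i r j) \<in> ?E" using Suc.prems that by (simp add: E)
        then show ?thesis using Suc.IH Suc Suc.prems by (simp add: converse_rtrancl_into_rtrancl)
      qed
    qed simp
    show ?thesis
    proof (cases v)
      case (Spine i) then show ?thesis using S \<open>v \<in> ?V\<close> by simp
    next
      case (Pendant i r j)
      then have "(v, Spine i) \<in> ?E\<^sup>*" "i < length W" using P \<open>v \<in> ?V\<close> by auto
      then show ?thesis using S by (meson rtrancl_trans)
    qed
  qed
  have "sym (?E\<^sup>*)" using sym by (intro sym_rtrancl) (auto simp: sym_def)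
  then show "(u, v) \<in> ?E\<^sup>*" if "u \<in> ?V" "v \<in> ?V" for u v
    using up[OF that(1)] up[OF that(2)] by (meson symE rtrancl_trans)
  have child: "(v, parent v) \<notin> (?E - {(v, parent v), (parent v, v)})\<^sup>*" if v: "v \<in> ?V" "v \<noteq> Spine 0" for v
  proof
    assume "(v, parent v) \<in> (?E - {(v, parent v), (parent v, v)})\<^sup>*"
    then have "below v (parent v)"
    proof (induction rule: rtrancl_induct)
      case (step a b)
      then show ?case using leave_below[of a W b v] E v(1) by blast
    qed (rule below_self)
    then show False using not_below_parent[OF v] by simp
  qed
  fix x y assume xy: "(x, y) \<in> ?E"
  have swap: "?E - {(x, y), (y, x)} = ?E - {(y, x), (x, y)}" by auto
  have symR: "sym ((?E - {(x, y), (y, x)})\<^sup>*)" using sym by (intro sym_rtrancl) (auto simp: sym_def)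
  consider "y = parent x" "x \<noteq> Spine 0" | "x = parent y" "y \<noteq> Spine 0"
    using spine_adj_parent[of x y W] xy E by blast
  then show "(x, y) \<notin> (?E - {(x, y), (y, x)})\<^sup>*"
  proof cases
    case 1 then show ?thesis using child[of x] xy E by blast
  next
    case 2
    then have "(y, x) \<notin> (?E - {(x, y), (y, x)})\<^sup>*" using child[of y] xy E swap by simp
    then show ?thesis using symR by (meson symE)
  qed
qed

text \<open>
  A function that changes by at most one along edges bounds the distance from below, and one that can
  always be decreased bounds it from above.
\<close>

lemma rdist_eqI:
  assumes E: "E \<subseteq> V \<times> V" and a: "a \<in> V"
    and zero: "h v = 0" "\<And>a. a \<in> V \<Longrightarrow> h a = 0 \<Longrightarrow> a = v"
    and lip: "\<And>a b. (a, b) \<in> E \<Longrightarrow> h a \<le> Suc (h b)"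
    and down: "\<And>a. a \<in> V \<Longrightarrow> 0 < h a \<Longrightarrow> \<exists>b. (a, b) \<in> E \<and> h a = Suc (h b)"
  shows "rdist E a v = h a"
  unfolding rdist_def
proof (rule Least_equality)
  show "(a, v) \<in> E ^^ h a" using a
  proof (induction "h a" arbitrary: a)
    case 0
    then have "a = v" using zero(2)[of a] by simp
    then show ?case using zero(1) by simp
  next
    case (Suc n)
    then obtain b where b: "(a, b) \<in> E" "h a = Suc (h b)" using down[of a] by auto
    then have "(b, v) \<in> E ^^ h b" using Suc E by auto
    then show ?case unfolding b(2) using b(1) by (rule relpow_Suc_I2[rotated])
  qed
  fix n assume "(a, v) \<in> E ^^ n"
  then show "h a \<le> n"
  proof (induction n arbitrary: a)
    case 0 then show ?case using zero(1) by simp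
  next
    case (Suc n)
    then obtain b where "(a, b) \<in> E" "(b, v) \<in> E ^^ n" by (meson relpow_Suc_E2)
    then show ?case using lip[of a b] Suc.IH[of b] by simp
  qed
qed

fun dist_to_leaf :: "nat \<times> nat \<Rightarrow> spine_vertex \<Rightarrow> nat" where
  "dist_to_leaf u (Spine k) = snd u + (fst u - k) + (k - fst u)"
| "dist_to_leaf u (Pendant k s j) =
     (if (k, s) = u then s - j else snd u + (fst u - k) + (k - fst u) + j)"

definition leaf_vertex :: "nat \<times> nat \<Rightarrow> spine_vertex" where
  "leaf_vertex u = Pendant (fst u) (snd u) (snd u)"

lemma leaf_vertex_in: "proper_word W \<Longrightarrow> u \<in> word_leaves W \<Longrightarrow> leaf_vertex u \<in> spine_verts W"
  using proper_wordD[of W u] by (auto simp: leaf_vertex_def word_leaves_def)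

lemma rdist_spine_tree:
  assumes W: "proper_word W" and u: "u \<in> word_leaves W" and a: "a \<in> spine_verts W"
  shows "rdist (parcs (spine_tree W)) a (leaf_vertex u) = dist_to_leaf u a"
proof (rule rdist_eqI[where V = "spine_verts W", OF _ a])
  let ?V = "spine_verts W" and ?E = "parcs (spine_tree W)"
  have E: "(a, b) \<in> ?E \<longleftrightarrow> a \<in> ?V \<and> b \<in> ?V \<and> spine_adj a b" for a b by (rule parcs_spine_tree[OF W])
  obtain i r where ir: "u = (i, r)" by (cases u)
  have i: "i < length W" "r \<in> W ! i" using u ir by (auto simp: word_leaves_def)
  have r: "1 \<le> r" using proper_wordD[OF W u] ir by auto
  show "?E \<subseteq> ?V \<times> ?V" using E by auto
  show "dist_to_leaf u (leaf_vertex u) = 0" by (simp add: leaf_vertex_def)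
  show "a = leaf_vertex u" if "a \<in> ?V" "dist_to_leaf u a = 0" for a
    using that r by (cases a) (auto simp: ir leaf_vertex_def split: if_splits)
  show "dist_to_leaf u a \<le> Suc (dist_to_leaf u b)" if "(a, b) \<in> ?E" for a b
    using that[unfolded E] by (cases a; cases b) (auto simp: ir)
  fix a assume a: "a \<in> ?V" "0 < dist_to_leaf u a"
  show "\<exists>b. (a, b) \<in> ?E \<and> dist_to_leaf u a = Suc (dist_to_leaf u b)"
  proof (cases a)
    case (Spine k)
    consider "k < i" | "i < k" | "k = i" by linarith
    then show ?thesis
    proof cases
      case 1
      then show ?thesis using a i Spine by (intro exI[of _ "Spine (Suc k)"]) (auto simp: E ir)
    next
      case 2
      then show ?thesis using a i Spine by (intro exI[of _ "Spine (k - 1)"]) (auto simp: E ir)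
    next
      case 3
      then show ?thesis using a i r Spine by (intro exI[of _ "Pendant i r 1"]) (auto simp: E ir)
    qed
  next
    case (Pendant k s j)
    show ?thesis
    proof (cases "(k, s) = u")
      case True
      then show ?thesis using a i r Pendant by (intro exI[of _ "Pendant k s (Suc j)"]) (auto simp: E ir)
    next
      case False
      show ?thesis
      proof (cases "j = 1")
        case True
        then show ?thesis using a Pendant False by (intro exI[of _ "Spine k"]) (auto simp: E ir)
      next
        case j: False
        then show ?thesis using a Pendant False by (intro exI[of _ "Pendant k s (j - 1)"]) (auto simp: E ir)
      qed
    qed
  qed
qed

lemma card_nbrs_ge_2:
  assumes "finite (E `` {v})" "(v, a) \<in> E" "(v, b) \<in> E" "a \<noteq> b"
  shows "card (E `` {v}) \<noteq> 1"
proof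
  assume "card (E `` {v}) = 1"
  then obtain c where c: "E `` {v} = {c}" by (auto simp: card_1_singleton_iff)
  have "a \<in> E `` {v}" "b \<in> E `` {v}" using assms by auto
  then show False unfolding c using assms(4) by simp
qed

lemma leaves_spine_tree:
  assumes W: "good_word W"
  shows "{v \<in> spine_verts W. card (parcs (spine_tree W) `` {v}) = 1} = leaf_vertex ` word_leaves W"
proof -
  let ?V = "spine_verts W" and ?E = "parcs (spine_tree W)"
  have pW: "proper_word W" and len: "2 \<le> length W" using W by (auto simp: good_word_def)
  have E: "(a, b) \<in> ?E \<longleftrightarrow> a \<in> ?V \<and> b \<in> ?V \<and> spine_adj a b" for a b by (rule parcs_spine_tree[OF pW])
  have fin: "finite (?E `` {v})" for v
    by (rule finite_subset[OF _ finite_spine_verts[OF pW]]) (use E in auto)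
  have "card (?E `` {v}) = 1 \<longleftrightarrow> v \<in> leaf_vertex ` word_leaves W" if v: "v \<in> ?V" for v
  proof (cases v)
    case (Spine i)
    have i: "i < length W" using v Spine by simp
    have "\<exists>a b. (v, a) \<in> ?E \<and> (v, b) \<in> ?E \<and> a \<noteq> b"
    proof (cases "0 < i \<and> Suc i < length W")
      case True
      then show ?thesis using Spine by (intro exI[of _ "Spine (i - 1)"] exI[of _ "Spine (Suc i)"]) (auto simp: E)
    next
      case False
      have "W \<noteq> []" using len by auto
      then have "W ! 0 = hd W" "W ! (length W - 1) = last W" by (simp_all add: hd_conv_nth last_conv_nth)
      moreover have "i = 0 \<or> i = length W - 1" using False i by auto
      ultimately have "2 \<le> card (W ! i)" using W by (auto simp: good_word_def)
      then obtain r where r: "r \<in> W ! i" by (metis card.empty ex_in_conv not_numeral_le_zero)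
      then have "1 \<le> r" using proper_wordD[OF pW, of "(i, r)"] i by (auto simp: word_leaves_def)
      then have "(v, Pendant i r 1) \<in> ?E" using Spine i r by (simp add: E)
      moreover have "\<exists>k. (v, Spine k) \<in> ?E"
      proof (cases i)
        case 0 then show ?thesis using Spine len i by (intro exI[of _ 1]) (simp add: E)
      next
        case (Suc k) then show ?thesis using Spine i by (intro exI[of _ k]) (simp add: E)
      qed
      ultimately show ?thesis by blast
    qed
    then show ?thesis using card_nbrs_ge_2[OF fin] Spine by (auto simp: leaf_vertex_def)
  next
    case (Pendant i r j)
    have up: "(v, parent v) \<in> ?E" using v Pendant by (auto simp: E)
    show ?thesis
    proof (cases "j = r")
      case True
      have "?E `` {v} = {parent v}"
      proof -
        have "b = parent v" if "(v, b) \<in> ?E" for b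
          using that Pendant True unfolding E by (cases b) auto
        then show ?thesis using up by blast
      qed
      moreover have "v = leaf_vertex (i, r)" "(i, r) \<in> word_leaves W"
        using Pendant True v by (auto simp: leaf_vertex_def word_leaves_def)
      ultimately show ?thesis by auto
    next
      case False
      have "(v, Pendant i r (Suc j)) \<in> ?E" using v Pendant False by (auto simp: E)
      moreover have "Pendant i r (Suc j) \<noteq> parent v" using Pendant by auto
      ultimately have "card (?E `` {v}) \<noteq> 1" using card_nbrs_ge_2[OF fin _ up] by blast
      then show ?thesis using Pendant False by (auto simp: leaf_vertex_def)
    qed
  qed
  moreover have "leaf_vertex ` word_leaves W \<subseteq> ?V" using leaf_vertex_in[OF pW] by blast
  ultimately show ?thesis by blast
qed

lemma rdist_leaf_vertices:
  assumes "proper_word W" "u \<in> word_leaves W" "v \<in> word_leaves W"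
  shows "rdist (parcs (spine_tree W)) (leaf_vertex u) (leaf_vertex v) = 5 \<longleftrightarrow> leaf_adj u v"
proof (cases "u = v")
  case True
  then show ?thesis using rdist_spine_tree[OF assms(1,3) leaf_vertex_in[OF assms(1,2)]] by (simp add: leaf_vertex_def)
next
  case False
  then show ?thesis using rdist_spine_tree[OF assms(1,3) leaf_vertex_in[OF assms(1,2)]]
    by (auto simp: leaf_vertex_def leaf_adj_def prod_eq_iff)
qed

lemma inj_leaf_vertex: "inj leaf_vertex"
  by (auto simp: inj_def leaf_vertex_def prod_eq_iff)

lemma exact_leaf_root_spine_tree:
  assumes W: "good_word W"
  shows "exact_leaf_root 5 (spine_tree W) (cycle_graph l) \<longleftrightarrow>
    (\<exists>\<phi>. cycle_numbering l \<phi> (word_leaves W) leaf_adj)"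
proof -
  have pW: "proper_word W" and ne: "W \<noteq> []" using W by (auto simp: good_word_def)
  let ?R = "\<lambda>u v. rdist (parcs (spine_tree W)) u v = 5"
  have bij: "bij_betw leaf_vertex (word_leaves W) (leaf_vertex ` word_leaves W)"
    by (intro inj_on_imp_bij_betw inj_on_subset[OF inj_leaf_vertex]) simp
  have "(\<exists>\<phi>. cycle_numbering l \<phi> (leaf_vertex ` word_leaves W) ?R) \<longleftrightarrow> (\<exists>\<phi>. cycle_numbering l \<phi> (word_leaves W) leaf_adj)"
  proof
    assume "\<exists>\<phi>. cycle_numbering l \<phi> (leaf_vertex ` word_leaves W) ?R"
    then obtain \<phi> where \<phi>: "cycle_numbering l \<phi> (leaf_vertex ` word_leaves W) ?R" by blast
    have "cycle_numbering l (inv leaf_vertex \<circ> \<phi>) (word_leaves W) leaf_adj"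
    proof (rule cycle_numbering_transfer[OF \<phi>])
      show "bij_betw (inv leaf_vertex) (leaf_vertex ` word_leaves W) (word_leaves W)"
        by (rule bij_betw_imageI) (auto simp: image_image inv_f_f[OF inj_leaf_vertex] inj_on_def)
    qed (auto simp: inv_f_f[OF inj_leaf_vertex] rdist_leaf_vertices[OF pW])
    then show "\<exists>\<phi>. cycle_numbering l \<phi> (word_leaves W) leaf_adj" by blast
  next
    assume "\<exists>\<phi>. cycle_numbering l \<phi> (word_leaves W) leaf_adj"
    then obtain \<phi> where \<phi>: "cycle_numbering l \<phi> (word_leaves W) leaf_adj" by blast
    have "cycle_numbering l (leaf_vertex \<circ> \<phi>) (leaf_vertex ` word_leaves W) ?R"
      by (rule cycle_numbering_transfer[OF \<phi> bij]) (simp add: rdist_leaf_vertices[OF pW])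
    then show "\<exists>\<phi>. cycle_numbering l \<phi> (leaf_vertex ` word_leaves W) ?R" by blast
  qed
  then show ?thesis
    unfolding exact_leaf_root_cycle_iff leaves_spine_tree[OF W] using rel_tree_spine_tree[OF pW ne] by simp
qed

section \<open>Reversal\<close>

lemma rev_numbering:
  assumes "cycle_numbering l \<phi> (word_leaves W) leaf_adj"
  shows "\<exists>\<phi>. cycle_numbering l \<phi> (word_leaves (rev W)) leaf_adj"
proof -
  define f where "f u = (length W - 1 - fst u, snd u)" for u :: "nat \<times> nat"
  have inL: "fst u < length W" if "u \<in> word_leaves W" for u using that by (auto simp: word_leaves_def)
  have mem: "f u \<in> word_leaves (rev W)" if "u \<in> word_leaves W" for u
    using that by (auto simp: f_def word_leaves_def rev_nth)
  have "bij_betw f (word_leaves W) (word_leaves (rev W))"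
  proof (rule bij_betw_imageI)
    show "inj_on f (word_leaves W)"
    proof (rule inj_onI)
      fix u v assume "u \<in> word_leaves W" "v \<in> word_leaves W" "f u = f v"
      then show "u = v" using inL[of u] inL[of v] by (auto simp: f_def prod_eq_iff)
    qed
    show "f ` word_leaves W = word_leaves (rev W)"
    proof
      show "word_leaves (rev W) \<subseteq> f ` word_leaves W"
      proof
        fix v assume v: "v \<in> word_leaves (rev W)"
        then have "f v \<in> word_leaves W" "f (f v) = v"
          by (auto simp: f_def word_leaves_def rev_nth prod_eq_iff)
        then show "v \<in> f ` word_leaves W" by force
      qed
    qed (use mem in auto)
  qed
  moreover have "leaf_adj u v \<longleftrightarrow> leaf_adj (f u) (f v)" if "u \<in> word_leaves W" "v \<in> word_leaves W" for u v
    using inL[OF that(1)] inL[OF that(2)] by (auto simp: leaf_adj_def f_def)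
  ultimately show ?thesis using cycle_numbering_transfer[OF assms] by blast
qed

lemma good_word_rev: "good_word W \<Longrightarrow> good_word (rev W)"
  by (auto simp: good_word_def proper_word_def hd_rev last_rev)

section \<open>Exact 5-leaf roots of cycles\<close>

lemma parcs_spine_tree_sub: "proper_word W \<Longrightarrow> parcs (spine_tree W) \<subseteq> spine_verts W \<times> spine_verts W"
  using parcs_spine_tree by auto

theorem theorem8p1:
  fixes T :: "'a pair_pre_digraph" and l :: nat
  assumes "8 \<le> l" and "even l"
  shows "exact_leaf_root 5 T (cycle_graph l) \<longleftrightarrow>
    (\<exists>W \<in> lang_N \<union> lang_X. spine_size W = l \<and>
      (digraph_iso T (spine_tree W) \<or> digraph_iso T (spine_tree (rev W))))"
proof
  assume root: "exact_leaf_root 5 T (cycle_graph l)"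
  let ?V = "pverts T" and ?E = "parcs T"
  obtain \<phi> where tree: "rel_tree ?V ?E"
    and \<phi>: "cycle_numbering l \<phi> {v \<in> ?V. card (?E `` {v}) = 1} (\<lambda>u v. rdist ?E u v = 5)"
    using root unfolding exact_leaf_root_cycle_iff by blast
  interpret rel_tree ?V ?E by (rule tree)
  have lf: "lf = {v \<in> ?V. card (?E `` {v}) = 1}" by (simp add: lf_def)
  have "cycle_numbering l (id \<circ> \<phi>) lf far5"
    by (rule cycle_numbering_transfer[OF \<phi>[folded lf]]) (auto simp: far5_def)
  moreover have "far5 u v \<Longrightarrow> far5 v u" for u v using d_sym lf_V by (auto simp: far5_def)
  moreover have "\<not> far5 u u" for u by (simp add: far5_def)
  ultimately have "long_cycle lf far5" using assms(1) by (intro long_cycle_if_numbering[of l]) auto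
  then have "leaf_cycle ?V ?E" by (intro leaf_cycle.intro leaf_cycle_axioms.intro tree)
  then interpret leaf_cycle ?V ?E .
  obtain W f where emb: "embeds ?E W f ?V" and W: "good_word W"
    using embeds_spine_tree by (auto simp: good_word_def)
  have pW: "proper_word W" using W by (simp add: good_word_def)
  have "rel_iso f (spine_verts W) (parcs (spine_tree W)) ?V ?E"
    using emb parcs_spine_tree[OF pW] parcs_spine_tree_sub[OF pW] E_sub
    by (auto simp: rel_iso_def embeds_def)
  then have iso: "rel_iso (inv_into (spine_verts W) f) ?V ?E (spine_verts W) (parcs (spine_tree W))"
    by (rule rel_iso_inv)
  then have diso: "digraph_iso T (spine_tree W)"
    unfolding digraph_iso_iff_rel_iso[OF parcs_spine_tree_sub[OF pW]] by blast
  obtain \<psi> where \<psi>: "cycle_numbering l \<psi> (word_leaves W) leaf_adj"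
    using exact_leaf_root_iso[OF iso root] unfolding exact_leaf_root_spine_tree[OF W] by blast
  have "long_cycle (word_leaves W) leaf_adj"
    using assms(1) leaf_adj_sym by (intro long_cycle_if_numbering[OF \<psi>]) auto
  then have "cyclic_word W" by (rule long_cycle.cyclic)
  then have "admissible W" using W by (auto simp: admissible_def good_word_def)
  then have "W \<in> lang_N \<union> lang_X" using W by (intro admissible_in_language) (auto simp: good_word_def)
  moreover have "spine_size W = l"
  proof -
    have "card (word_leaves W) = l" using \<psi> bij_betw_same_card[of \<psi> "{..<l}"] by (simp add: cycle_numbering_def)
    moreover have "\<forall>A\<in>set W. finite A" using pW by (auto simp: proper_word_def intro: finite_subset)
    ultimately show ?thesis using card_word_leaves by simp
  qed
  ultimately show "\<exists>W \<in> lang_N \<union> lang_X. spine_size W = l \<and>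
      (digraph_iso T (spine_tree W) \<or> digraph_iso T (spine_tree (rev W)))" using diso by blast
next
  assume "\<exists>W \<in> lang_N \<union> lang_X. spine_size W = l \<and>
      (digraph_iso T (spine_tree W) \<or> digraph_iso T (spine_tree (rev W)))"
  then obtain W where W: "W \<in> lang_N \<union> lang_X" and size: "spine_size W = l"
    and iso: "digraph_iso T (spine_tree W) \<or> digraph_iso T (spine_tree (rev W))" by blast
  have cyc: "cyclic_word W" and good: "good_word W"
    using language_cyclic[OF W] by (auto simp: good_word_def)
  have pW: "proper_word W" using good by (simp add: good_word_def)
  have "\<forall>A\<in>set W. finite A" using pW by (auto simp: proper_word_def intro: finite_subset)
  then have card: "card (word_leaves W) = l" using card_word_leaves size by simp
  have "word_leaves W \<noteq> {}" using card assms(1) by auto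
  then obtain \<phi> where \<phi>: "cycle_numbering l \<phi> (word_leaves W) leaf_adj"
    using numbering_if_cyclic[OF cyc finite_word_leaves[OF pW]] card leaf_adj_sym leaf_adj_irrefl by metis
  have root: "exact_leaf_root 5 T (cycle_graph l)"
    if U: "good_word U" and \<phi>: "cycle_numbering l \<phi> (word_leaves U) leaf_adj" and iso: "digraph_iso T (spine_tree U)" for U \<phi>
  proof -
    have pU: "proper_word U" using U by (simp add: good_word_def)
    obtain f where "rel_iso f (pverts T) (parcs T) (spine_verts U) (parcs (spine_tree U))"
      using iso unfolding digraph_iso_iff_rel_iso[OF parcs_spine_tree_sub[OF pU]] by blast
    then have "rel_iso (inv_into (pverts T) f) (spine_verts U) (parcs (spine_tree U)) (pverts T) (parcs T)"
      by (rule rel_iso_inv)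
    moreover have "exact_leaf_root 5 (spine_tree U) (cycle_graph l)"
      using exact_leaf_root_spine_tree[OF U] \<phi> by blast
    ultimately show ?thesis by (rule exact_leaf_root_iso)
  qed
  show "exact_leaf_root 5 T (cycle_graph l)"
    using iso root[OF good \<phi>] root[OF good_word_rev[OF good]] rev_numbering[OF \<phi>] by blast
qed

end
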